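(* Let $k$ be a field of characteristic not $2$ or $3$. Let $\pi:\mathfrak{g}\rightarrow\mathfrak{so}_{\epsilon}(V,(\ ,\ ))$ be a finite-dimensional $\epsilon$-orthogonal representation, with $\dim V\ge 2$, of colour Lie type of a finite-dimensional $\epsilon$-quadratic colour Lie algebra $(\mathfrak{g},B_{\mathfrak{g}})$. Let $\tilde{\mathfrak{g}}=\mathfrak{g}\oplus V$ be the associated colour Lie algebra and let $\tilde{D}$ be the cubic Dirac operator. Then in $U_{\epsilon}(\tilde{\mathfrak{g}})\otimes C_{\epsilon}(V,(\ ,\ ))$ we have $$\tilde{D}^2=\Omega(\tilde{\mathfrak{g}})\otimes 1-\Delta(\Omega(\mathfrak{g}))+\frac{1}{24}\Big(Tr_{\epsilon}(ad_{\tilde{\mathfrak{g}}}(\Omega(\tilde{\mathfrak{g}})))-Tr_{\epsilon}(ad_{\mathfrak{g}}(\Omega(\mathfrak{g})))\Big)\, 1\otimes 1,$$ where $\Omega(\tilde{\mathfrak{g}})$ (resp. $\Omega(\mathfrak{g})$) is the Casimir element of $\tilde{\mathfrak{g}}$ (resp. $\mathfrak{g}$).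
   Context: Graded conventions. $\Gamma$ is an abelian group (additive) and $\epsilon:\Gamma\times\Gamma\to k^{\times}$ is a commutation factor: $\epsilon(a,b)\epsilon(b,a)=1$, $\epsilon(a+b,c)=\epsilon(a,c)\epsilon(b,c)$, $\epsilon(a,b+c)=\epsilon(a,b)\epsilon(a,c)$. For homogeneous $v,w$ write $\epsilon(v,w)=\epsilon(|v|,|w|)$, $\epsilon(v)=\epsilon(|v|,|v|)$. Formulas involving degrees are for homogeneous elements and extended by linearity; bases are homogeneous; bilinear forms are of degree $0$ ($B(V_a,V_b)=0$ unless $a+b=0$). A bilinear map $B$ is $\epsilon$-symmetric if $B(v,w)=\epsilon(v,w)B(w,v)$, $\epsilon$-antisymmetric if $B(v,w)=-\epsilon(v,w)B(w,v)$. For a basis $\{e_i\}$ of a finite-dimensional space with a non-degenerate $\epsilon$-symmetric form, the dual basis $\{e^i\}$ is defined by $(e_i,e^j)=\delta_{ij}$. $Tr_\epsilon(f)=Tr(\mathcal{E}\circ f)$ where $\mathcal{E}(v)=\epsilon(v)v$. Colour Lie algebra: a $\Gamma$-graded space with bilinear bracket satisfying $\{\mathfrak{g}_a,\mathfrak{g}_b\}\subseteq\mathfrak{g}_{a+b}$, $\{x,y\}=-\epsilon(x,y)\{y,x\}$, $\epsilon(z,x)\{x,\{y,z\}\}+\epsilon(x,y)\{y,\{z,x\}\}+\epsilon(y,z)\{z,\{x,y\}\}=0$. It is $\epsilon$-quadratic if equipped with a non-degenerate $\epsilon$-symmetric form $B$ with $B(\{x,y\},z)=-\epsilon(x,y)B(y,\{x,z\})$.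 $\mathfrak{so}_\epsilon(V,(\ ,\ ))$ is the colour Lie algebra spanned by homogeneous $f\in\mathrm{End}(V)$ with $(f(v),w)+\epsilon(f,v)(v,f(w))=0$, with bracket $fg-\epsilon(f,g)gf$. An $\epsilon$-orthogonal representation is a $\Gamma$-graded space $V$ with a non-degenerate $\epsilon$-symmetric form and a degree $0$ morphism of colour Lie algebras $\pi:\mathfrak{g}\to\mathfrak{so}_\epsilon(V,(\ ,\ ))$. $ad(x)=\{x,\cdot\}$, extended to the enveloping algebra. $U_\epsilon(\mathfrak{g})=T(\mathfrak{g})/\langle x\otimes y-\epsilon(x,y)y\otimes x-\{x,y\}\rangle$; Casimir element $\Omega(\mathfrak{g})=\sum_i x^ix_i$ for a basis $\{x_i\}$ of $\mathfrak{g}$ with dual basis $\{x^i\}$ for the quadratic form. $C_\epsilon(V,(\ ,\ ))=T(V)/\langle x\otimes y+\epsilon(x,y)y\otimes x-2(x,y)1\rangle$, which is $\mathbb{Z}_2\times\Gamma$-graded; $\Lambda_\epsilon(V)=T(V)/\langle x\otimes y+\epsilon(x,y)y\otimes x\rangle$. Moment map: $\mu:\Lambda^2_\epsilon(V)\to\mathfrak{g}$ is given by $B_{\mathfrak{g}}(x,\mu(v,w))=(\pi(x)(v),w)$. Colour Lie type: $\pi$ is of colour Lie type if there is a degree $0$ $\epsilon$-antisymmetric bilinear map $\phi:V\times V\to V$ with $\pi(x)(\phi(v,w))=\phi(\pi(x)(v),w)+\epsilon(x,v)\phi(v,\pi(x)(w))$ and $(\phi(u,v),w)=-\epsilon(u,v)(v,\phi(u,w))$,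 such that $\tilde{\mathfrak{g}}=\mathfrak{g}\oplus V$, with the $\epsilon$-antisymmetric bracket extending that of $\mathfrak{g}$, $\{x,v\}=\pi(x)(v)$ and $\{v,w\}=\mu(v,w)+\phi(v,w)$ ($x\in\mathfrak{g}$, $v,w\in V$), and with $B_{\tilde{\mathfrak{g}}}=B_{\mathfrak{g}}\perp(\ ,\ )$, is an $\epsilon$-quadratic colour Lie algebra. Such a $\phi$ is fixed, and $(\tilde{\mathfrak{g}},B_{\tilde{\mathfrak{g}}})$ is the associated colour Lie algebra. The corresponding cubic term is $$\psi=\frac{1}{12}\sum_{i,j,l}(e^i,\phi(e^j,e^l))\,e_le_je_i\in C_\epsilon(V,(\ ,\ ))$$ for a basis $\{e_i\}$ of $V$ with dual basis $\{e^i\}$ (independent of the basis). Map $\pi_*$: $\pi_*:\mathfrak{g}\to C_\epsilon(V,(\ ,\ ))$, $\pi_*(x)=\frac14\sum_i\pi(x)(e^i)e_i$; it is a morphism of colour Lie algebras for the bracket $x\cdot y-\tilde\epsilon(x,y)y\cdot x$, where $\tilde\epsilon((a_1,\gamma_1),(a_2,\gamma_2))=(-1)^{a_1a_2}\epsilon(\gamma_1,\gamma_2)$ on $\mathbb{Z}_2\times\Gamma$. Cubic Dirac operator: on $U_\epsilon(\tilde{\mathfrak{g}})\otimes C_\epsilon(V,(\ ,\ ))$ (with $U_\epsilon(\tilde{\mathfrak{g}})$ of $\mathbb{Z}_2$-degree $0$) use the product $(a\otimes b)(c\otimes d)=\tilde\epsilon(b,c)\,ac\otimes bd$. Set $D=\sum_ie^i\otimes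 e_i$ and $\tilde D=D+1\otimes\psi$. The map $\Delta:\mathfrak{g}\to U_\epsilon(\tilde{\mathfrak{g}})\otimes C_\epsilon(V,(\ ,\ ))$, $\Delta(x)=x\otimes1+1\otimes\pi_*(x)$, is a colour Lie algebra morphism and is extended to an algebra morphism on $U_\epsilon(\mathfrak{g})$. *)

theory Defs
  imports Complex_Main "HOL-Library.Poly_Mapping" "HOL-Library.Product_Plus" "HOL-Library.Z2"
begin

text \<open>
  Vector spaces over a field \<open>'k\<close> are types with an explicit scalar multiplication \<open>s\<close>
  satisfying \<^locale>\<open>vector_space\<close>; a grading by an abelian group \<open>'a\<close> is the family \<open>G\<close> of
  homogeneous subspaces.
\<close>

subsection \<open>Graded spaces and forms\<close>

definition commutation_factor :: "('a::ab_group_add \<Rightarrow> 'a \<Rightarrow> 'k::field) \<Rightarrow> bool" where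
  "commutation_factor \<epsilon> \<longleftrightarrow>
     (\<forall>a b. \<epsilon> a b * \<epsilon> b a = 1) \<and>
     (\<forall>a b c. \<epsilon> (a + b) c = \<epsilon> a c * \<epsilon> b c) \<and>
     (\<forall>a b c. \<epsilon> a (b + c) = \<epsilon> a b * \<epsilon> a c)"

definition homogeneous_decomp :: "('a \<Rightarrow> 'v::ab_group_add set) \<Rightarrow> 'v \<Rightarrow> ('a \<Rightarrow> 'v) \<Rightarrow> bool" where
  "homogeneous_decomp G v f \<longleftrightarrow>
     (\<forall>a. f a \<in> G a) \<and> finite {a. f a \<noteq> 0} \<and> v = (\<Sum>a | f a \<noteq> 0. f a)"

definition graded_space ::
  "('k::field \<Rightarrow> 'v::ab_group_add \<Rightarrow> 'v) \<Rightarrow> ('a \<Rightarrow> 'v set) \<Rightarrow> bool" where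
  "graded_space s G \<longleftrightarrow>
     vector_space s \<and> (\<forall>a. module.subspace s (G a)) \<and> (\<forall>v. \<exists>!f. homogeneous_decomp G v f)"

definition hcomp :: "('a \<Rightarrow> 'v::ab_group_add set) \<Rightarrow> 'v \<Rightarrow> 'a \<Rightarrow> 'v" where
  "hcomp G v = (THE f. homogeneous_decomp G v f)"

definition bilinear_map ::
  "('k::field \<Rightarrow> 'u::ab_group_add \<Rightarrow> 'u) \<Rightarrow> ('k \<Rightarrow> 'v::ab_group_add \<Rightarrow> 'v) \<Rightarrow>
   ('k \<Rightarrow> 'w::ab_group_add \<Rightarrow> 'w) \<Rightarrow> ('u \<Rightarrow> 'v \<Rightarrow> 'w) \<Rightarrow> bool" where
  "bilinear_map s1 s2 s3 f \<longleftrightarrow>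
     (\<forall>u. Vector_Spaces.linear s2 s3 (\<lambda>v. f u v)) \<and>
     (\<forall>v. Vector_Spaces.linear s1 s3 (\<lambda>u. f u v))"

definition eps_symmetric_form ::
  "('k::field \<Rightarrow> 'v::ab_group_add \<Rightarrow> 'v) \<Rightarrow> ('a::ab_group_add \<Rightarrow> 'v set) \<Rightarrow> ('a \<Rightarrow> 'a \<Rightarrow> 'k) \<Rightarrow>
   ('v \<Rightarrow> 'v \<Rightarrow> 'k) \<Rightarrow> bool" where
  "eps_symmetric_form s G \<epsilon> B \<longleftrightarrow>
     bilinear_map s s (*) B \<and>
     (\<forall>a b. \<forall>v\<in>G a. \<forall>w\<in>G b. a + b \<noteq> 0 \<longrightarrow> B v w = 0) \<and>
     (\<forall>a b. \<forall>v\<in>G a. \<forall>w\<in>G b. B v w = \<epsilon> a b * B w v)"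

definition nondegenerate :: "('v::zero \<Rightarrow> 'v \<Rightarrow> 'k::zero) \<Rightarrow> bool" where
  "nondegenerate B \<longleftrightarrow>
     (\<forall>v. (\<forall>w. B v w = 0) \<longrightarrow> v = 0) \<and> (\<forall>w. (\<forall>v. B v w = 0) \<longrightarrow> w = 0)"

definition homogeneous_basis ::
  "('k::field \<Rightarrow> 'v::ab_group_add \<Rightarrow> 'v) \<Rightarrow> ('a \<Rightarrow> 'v set) \<Rightarrow> 'v set \<Rightarrow> bool" where
  "homogeneous_basis s G E \<longleftrightarrow>
     finite_dimensional_vector_space s E \<and> (\<forall>e\<in>E. \<exists>a. e \<in> G a)"

text \<open>\<open>dual_basis B E e\<close> is the member of the dual basis of \<open>E\<close> with the index of \<open>e \<in> E\<close>.\<close>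

definition dual_basis :: "('v \<Rightarrow> 'v \<Rightarrow> 'k::zero_neq_one) \<Rightarrow> 'v set \<Rightarrow> 'v \<Rightarrow> 'v" where
  "dual_basis B E e = (THE d. \<forall>f\<in>E. B f d = (if f = e then 1 else 0))"

definition lin_trace ::
  "('k::field \<Rightarrow> 'v::ab_group_add \<Rightarrow> 'v) \<Rightarrow> ('v \<Rightarrow> 'v) \<Rightarrow> 'k" where
  "lin_trace s f =
     (let E = (SOME E. finite_dimensional_vector_space s E)
      in \<Sum>e\<in>E. module.representation s E (f e) e)"

definition eps_op ::
  "('k::field \<Rightarrow> 'v::ab_group_add \<Rightarrow> 'v) \<Rightarrow> ('a \<Rightarrow> 'v set) \<Rightarrow> ('a \<Rightarrow> 'a \<Rightarrow> 'k) \<Rightarrow> 'v \<Rightarrow> 'v" where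
  "eps_op s G \<epsilon> v = (\<Sum>a | hcomp G v a \<noteq> 0. s (\<epsilon> a a) (hcomp G v a))"

definition eps_trace ::
  "('k::field \<Rightarrow> 'v::ab_group_add \<Rightarrow> 'v) \<Rightarrow> ('a \<Rightarrow> 'v set) \<Rightarrow> ('a \<Rightarrow> 'a \<Rightarrow> 'k) \<Rightarrow>
   ('v \<Rightarrow> 'v) \<Rightarrow> 'k" where
  "eps_trace s G \<epsilon> f = lin_trace s (eps_op s G \<epsilon> \<circ> f)"

subsection \<open>Colour Lie algebras and their representations\<close>

definition colour_lie_algebra ::
  "('k::field \<Rightarrow> 'g::ab_group_add \<Rightarrow> 'g) \<Rightarrow> ('a::ab_group_add \<Rightarrow> 'g set) \<Rightarrow> ('a \<Rightarrow> 'a \<Rightarrow> 'k) \<Rightarrow>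
   ('g \<Rightarrow> 'g \<Rightarrow> 'g) \<Rightarrow> bool" where
  "colour_lie_algebra s G \<epsilon> br \<longleftrightarrow>
     graded_space s G \<and> bilinear_map s s s br \<and>
     (\<forall>a b. \<forall>x\<in>G a. \<forall>y\<in>G b. br x y \<in> G (a + b)) \<and>
     (\<forall>a b. \<forall>x\<in>G a. \<forall>y\<in>G b. br x y = - s (\<epsilon> a b) (br y x)) \<and>
     (\<forall>a b c. \<forall>x\<in>G a. \<forall>y\<in>G b. \<forall>z\<in>G c.
        s (\<epsilon> c a) (br x (br y z)) + s (\<epsilon> a b) (br y (br z x)) + s (\<epsilon> b c) (br z (br x y)) = 0)"

definition eps_quadratic ::
  "('k::field \<Rightarrow> 'g::ab_group_add \<Rightarrow> 'g) \<Rightarrow> ('a::ab_group_add \<Rightarrow> 'g set) \<Rightarrow> ('a \<Rightarrow> 'a \<Rightarrow> 'k) \<Rightarrow>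
   ('g \<Rightarrow> 'g \<Rightarrow> 'g) \<Rightarrow> ('g \<Rightarrow> 'g \<Rightarrow> 'k) \<Rightarrow> bool" where
  "eps_quadratic s G \<epsilon> br B \<longleftrightarrow>
     colour_lie_algebra s G \<epsilon> br \<and> eps_symmetric_form s G \<epsilon> B \<and> nondegenerate B \<and>
     (\<forall>a b. \<forall>x\<in>G a. \<forall>y\<in>G b. \<forall>z. B (br x y) z = - \<epsilon> a b * B y (br x z))"

text \<open>The component of degree \<open>a\<close> of \<open>so\<^sub>\<epsilon>(V, B)\<close>.\<close>

definition so_eps ::
  "('k::field \<Rightarrow> 'v::ab_group_add \<Rightarrow> 'v) \<Rightarrow> ('a::ab_group_add \<Rightarrow> 'v set) \<Rightarrow> ('a \<Rightarrow> 'a \<Rightarrow> 'k) \<Rightarrow>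
   ('v \<Rightarrow> 'v \<Rightarrow> 'k) \<Rightarrow> 'a \<Rightarrow> ('v \<Rightarrow> 'v) set" where
  "so_eps s G \<epsilon> B a =
     {f. Vector_Spaces.linear s s f \<and> (\<forall>b. f ` G b \<subseteq> G (a + b)) \<and>
         (\<forall>b. \<forall>v\<in>G b. \<forall>w. B (f v) w + \<epsilon> a b * B v (f w) = 0)}"

definition orthogonal_rep ::
  "('k::field \<Rightarrow> 'g::ab_group_add \<Rightarrow> 'g) \<Rightarrow> ('a::ab_group_add \<Rightarrow> 'g set) \<Rightarrow> ('a \<Rightarrow> 'a \<Rightarrow> 'k) \<Rightarrow>
   ('g \<Rightarrow> 'g \<Rightarrow> 'g) \<Rightarrow>
   ('k \<Rightarrow> 'v::ab_group_add \<Rightarrow> 'v) \<Rightarrow> ('a \<Rightarrow> 'v set) \<Rightarrow> ('v \<Rightarrow> 'v \<Rightarrow> 'k) \<Rightarrow>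
   ('g \<Rightarrow> 'v \<Rightarrow> 'v) \<Rightarrow> bool" where
  "orthogonal_rep sg Gg \<epsilon> brg sv Gv Bv \<pi> \<longleftrightarrow>
     graded_space sv Gv \<and> eps_symmetric_form sv Gv \<epsilon> Bv \<and> nondegenerate Bv \<and>
     (\<forall>v. Vector_Spaces.linear sg sv (\<lambda>x. \<pi> x v)) \<and>
     (\<forall>a. \<forall>x\<in>Gg a. \<pi> x \<in> so_eps sv Gv \<epsilon> Bv a) \<and>
     (\<forall>a b. \<forall>x\<in>Gg a. \<forall>y\<in>Gg b. \<forall>v.
        \<pi> (brg x y) v = \<pi> x (\<pi> y v) - sv (\<epsilon> a b) (\<pi> y (\<pi> x v)))"

text \<open>The moment map, as an \<open>\<epsilon>\<close>-antisymmetric bilinear map on \<open>V \<times> V\<close>.\<close>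

definition moment_map ::
  "('g \<Rightarrow> 'g \<Rightarrow> 'k) \<Rightarrow> ('v \<Rightarrow> 'v \<Rightarrow> 'k) \<Rightarrow> ('g \<Rightarrow> 'v \<Rightarrow> 'v) \<Rightarrow> 'v \<Rightarrow> 'v \<Rightarrow> 'g" where
  "moment_map Bg Bv \<pi> v w = (THE m. \<forall>x. Bg x m = Bv (\<pi> x v) w)"

definition ext_scale ::
  "('k \<Rightarrow> 'g \<Rightarrow> 'g) \<Rightarrow> ('k \<Rightarrow> 'v \<Rightarrow> 'v) \<Rightarrow> 'k \<Rightarrow> 'g \<times> 'v \<Rightarrow> 'g \<times> 'v" where
  "ext_scale sg sv c = map_prod (sg c) (sv c)"

definition ext_part :: "('a \<Rightarrow> 'g set) \<Rightarrow> ('a \<Rightarrow> 'v set) \<Rightarrow> 'a \<Rightarrow> ('g \<times> 'v) set" where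
  "ext_part Gg Gv a = Gg a \<times> Gv a"

definition ext_form ::
  "('g \<Rightarrow> 'g \<Rightarrow> 'k::plus) \<Rightarrow> ('v \<Rightarrow> 'v \<Rightarrow> 'k) \<Rightarrow> 'g \<times> 'v \<Rightarrow> 'g \<times> 'v \<Rightarrow> 'k" where
  "ext_form Bg Bv p q = Bg (fst p) (fst q) + Bv (snd p) (snd q)"

text \<open>
  The bracket on \<open>\<g> \<oplus> V\<close>. The double sum is the bilinear extension of \<open>\<epsilon>(v, y) \<pi>(y)(v)\<close>, so that
  \<open>{v, y} = - \<epsilon>(v, y) {y, v}\<close> for homogeneous \<open>v \<in> V\<close> and \<open>y \<in> \<g>\<close>.
\<close>

definition ext_bracket ::
  "('a \<Rightarrow> 'g::ab_group_add set) \<Rightarrow> ('a \<Rightarrow> 'a \<Rightarrow> 'k) \<Rightarrow> ('g \<Rightarrow> 'g \<Rightarrow> 'g) \<Rightarrow> ('g \<Rightarrow> 'g \<Rightarrow> 'k) \<Rightarrow>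
   ('k \<Rightarrow> 'v::ab_group_add \<Rightarrow> 'v) \<Rightarrow> ('a \<Rightarrow> 'v set) \<Rightarrow> ('v \<Rightarrow> 'v \<Rightarrow> 'k) \<Rightarrow>
   ('g \<Rightarrow> 'v \<Rightarrow> 'v) \<Rightarrow> ('v \<Rightarrow> 'v \<Rightarrow> 'v) \<Rightarrow> 'g \<times> 'v \<Rightarrow> 'g \<times> 'v \<Rightarrow> 'g \<times> 'v" where
  "ext_bracket Gg \<epsilon> brg Bg sv Gv Bv \<pi> \<phi> = (\<lambda>(x, v) (y, w).
     (brg x y + moment_map Bg Bv \<pi> v w,
      \<pi> x w
      - (\<Sum>a | hcomp Gv v a \<noteq> 0. \<Sum>b | hcomp Gg y b \<noteq> 0.
           sv (\<epsilon> a b) (\<pi> (hcomp Gg y b) (hcomp Gv v a)))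
      + \<phi> v w))"

definition colour_lie_type ::
  "('k::field \<Rightarrow> 'g::ab_group_add \<Rightarrow> 'g) \<Rightarrow> ('a::ab_group_add \<Rightarrow> 'g set) \<Rightarrow> ('a \<Rightarrow> 'a \<Rightarrow> 'k) \<Rightarrow>
   ('g \<Rightarrow> 'g \<Rightarrow> 'g) \<Rightarrow> ('g \<Rightarrow> 'g \<Rightarrow> 'k) \<Rightarrow>
   ('k \<Rightarrow> 'v::ab_group_add \<Rightarrow> 'v) \<Rightarrow> ('a \<Rightarrow> 'v set) \<Rightarrow> ('v \<Rightarrow> 'v \<Rightarrow> 'k) \<Rightarrow>
   ('g \<Rightarrow> 'v \<Rightarrow> 'v) \<Rightarrow> ('v \<Rightarrow> 'v \<Rightarrow> 'v) \<Rightarrow> bool" where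
  "colour_lie_type sg Gg \<epsilon> brg Bg sv Gv Bv \<pi> \<phi> \<longleftrightarrow>
     bilinear_map sv sv sv \<phi> \<and>
     (\<forall>a b. \<forall>v\<in>Gv a. \<forall>w\<in>Gv b. \<phi> v w \<in> Gv (a + b)) \<and>
     (\<forall>a b. \<forall>v\<in>Gv a. \<forall>w\<in>Gv b. \<phi> v w = - sv (\<epsilon> a b) (\<phi> w v)) \<and>
     (\<forall>a b. \<forall>x\<in>Gg a. \<forall>v\<in>Gv b. \<forall>w. \<pi> x (\<phi> v w) = \<phi> (\<pi> x v) w + sv (\<epsilon> a b) (\<phi> v (\<pi> x w))) \<and>
     (\<forall>a b. \<forall>u\<in>Gv a. \<forall>v\<in>Gv b. \<forall>w. Bv (\<phi> u v) w = - \<epsilon> a b * Bv v (\<phi> u w)) \<and>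
     eps_quadratic (ext_scale sg sv) (ext_part Gg Gv) \<epsilon>
       (ext_bracket Gg \<epsilon> brg Bg sv Gv Bv \<pi> \<phi>) (ext_form Bg Bv)"

subsection \<open>Algebras given by generators and relations\<close>

datatype 'x free_monoid = Word (letters: "'x list")

instantiation free_monoid :: (type) monoid_add
begin

definition zero_free_monoid :: "'a free_monoid" where
  "0 = Word []"

definition plus_free_monoid :: "'a free_monoid \<Rightarrow> 'a free_monoid \<Rightarrow> 'a free_monoid" where
  "u + v = Word (letters u @ letters v)"

instance
  by standard (simp_all add: zero_free_monoid_def plus_free_monoid_def)

end

text \<open>The free associative unital algebra on the set of all elements of \<open>'x\<close>.\<close>

type_synonym ('x, 'k) free_algebra = "'x free_monoid \<Rightarrow>\<^sub>0 'k"

definition gen :: "'x \<Rightarrow> ('x, 'k::zero_neq_one) free_algebra" where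
  "gen x = Poly_Mapping.single (Word [x]) 1"

definition const :: "'k::zero \<Rightarrow> ('x, 'k) free_algebra" where
  "const c = Poly_Mapping.single 0 c"

inductive_set ideal_gen :: "'r::ring_1 set \<Rightarrow> 'r set" for R where
  zero: "0 \<in> ideal_gen R"
| base: "r \<in> R \<Longrightarrow> r \<in> ideal_gen R"
| add: "p \<in> ideal_gen R \<Longrightarrow> q \<in> ideal_gen R \<Longrightarrow> p + q \<in> ideal_gen R"
| mult_left: "p \<in> ideal_gen R \<Longrightarrow> q * p \<in> ideal_gen R"
| mult_right: "p \<in> ideal_gen R \<Longrightarrow> p * q \<in> ideal_gen R"

definition algebra_over :: "('k::field \<Rightarrow> 'u::ring_1 \<Rightarrow> 'u) \<Rightarrow> bool" where
  "algebra_over s \<longleftrightarrow>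
     vector_space s \<and> (\<forall>c u v. s c (u * v) = s c u * v) \<and> (\<forall>c u v. s c (u * v) = u * s c v)"

definition algebra_hom ::
  "('k::field \<Rightarrow> 'u::ring_1 \<Rightarrow> 'u) \<Rightarrow> ('k \<Rightarrow> 'w::ring_1 \<Rightarrow> 'w) \<Rightarrow> ('u \<Rightarrow> 'w) \<Rightarrow> bool" where
  "algebra_hom s1 s2 F \<longleftrightarrow>
     Vector_Spaces.linear s1 s2 F \<and> F 1 = 1 \<and> (\<forall>u v. F (u * v) = F u * F v)"

definition free_eval ::
  "('k::zero \<Rightarrow> 'u::ring_1 \<Rightarrow> 'u) \<Rightarrow> ('x \<Rightarrow> 'u) \<Rightarrow> ('x, 'k) free_algebra \<Rightarrow> 'u" where
  "free_eval s \<iota> p =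
     (\<Sum>w\<in>Poly_Mapping.keys p. s (Poly_Mapping.lookup p w) (prod_list (map \<iota> (letters w))))"

text \<open>
  \<open>presented_algebra s \<iota> R\<close>: the algebra \<open>'u\<close> is the quotient of the free algebra on \<open>'x\<close> by the
  two-sided ideal generated by \<open>R\<close>, and \<open>\<iota> x\<close> is the class of the generator \<open>x\<close>.
\<close>

definition presented_algebra ::
  "('k::field \<Rightarrow> 'u::ring_1 \<Rightarrow> 'u) \<Rightarrow> ('x \<Rightarrow> 'u) \<Rightarrow> ('x, 'k) free_algebra set \<Rightarrow> bool" where
  "presented_algebra s \<iota> R \<longleftrightarrow>
     algebra_over s \<and> range (free_eval s \<iota>) = UNIV \<and> {p. free_eval s \<iota> p = 0} = ideal_gen R"

text \<open>
  The free algebra on the underlying set of a vector space modulo the following relations is its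
  tensor algebra, hence adding further relations to them gives a quotient of the tensor algebra.
\<close>

definition tensor_rels ::
  "('k::field \<Rightarrow> 'x::ab_group_add \<Rightarrow> 'x) \<Rightarrow> ('x, 'k) free_algebra set" where
  "tensor_rels s =
     {gen (x + y) - gen x - gen y |x y. True} \<union> {gen (s c x) - const c * gen x |c x. True}"

definition enveloping_algebra ::
  "('k::field \<Rightarrow> 'g::ab_group_add \<Rightarrow> 'g) \<Rightarrow> ('a \<Rightarrow> 'g set) \<Rightarrow> ('a \<Rightarrow> 'a \<Rightarrow> 'k) \<Rightarrow>
   ('g \<Rightarrow> 'g \<Rightarrow> 'g) \<Rightarrow> ('k \<Rightarrow> 'u::ring_1 \<Rightarrow> 'u) \<Rightarrow> ('g \<Rightarrow> 'u) \<Rightarrow> bool" where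
  "enveloping_algebra s G \<epsilon> br sU \<iota> \<longleftrightarrow>
     presented_algebra sU \<iota> (tensor_rels s \<union>
       {gen x * gen y - const (\<epsilon> a b) * gen y * gen x - gen (br x y) |a b x y. x \<in> G a \<and> y \<in> G b})"

definition clifford_algebra ::
  "('k::field \<Rightarrow> 'v::ab_group_add \<Rightarrow> 'v) \<Rightarrow> ('a \<Rightarrow> 'v set) \<Rightarrow> ('a \<Rightarrow> 'a \<Rightarrow> 'k) \<Rightarrow>
   ('v \<Rightarrow> 'v \<Rightarrow> 'k) \<Rightarrow> ('k \<Rightarrow> 'c::ring_1 \<Rightarrow> 'c) \<Rightarrow> ('v \<Rightarrow> 'c) \<Rightarrow> bool" where
  "clifford_algebra s G \<epsilon> B sC \<iota> \<longleftrightarrow>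
     presented_algebra sC \<iota> (tensor_rels s \<union>
       {gen x * gen y + const (\<epsilon> a b) * gen y * gen x - const (2 * B x y) |a b x y.
          x \<in> G a \<and> y \<in> G b})"

text \<open>The grading of an algebra induced by a grading \<open>P\<close> of its generators.\<close>

definition algebra_part ::
  "('k::field \<Rightarrow> 'u::ring_1 \<Rightarrow> 'u) \<Rightarrow> ('x \<Rightarrow> 'u) \<Rightarrow> ('b::ab_group_add \<Rightarrow> 'x set) \<Rightarrow> 'b \<Rightarrow> 'u set" where
  "algebra_part s \<iota> P i =
     module.span s {prod_list (map \<iota> xs) |xs is.
       list_all2 (\<lambda>x j. x \<in> P j) xs is \<and> sum_list is = i}"

text \<open>The \<open>\<int>\<^sub>2 \<times> \<Gamma>\<close>-grading of a \<open>\<Gamma>\<close>-graded space placed in \<open>\<int>\<^sub>2\<close>-degree \<open>z\<close>.\<close>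

definition z2_part :: "bit \<Rightarrow> ('a \<Rightarrow> 'x::zero set) \<Rightarrow> bit \<times> 'a \<Rightarrow> 'x set" where
  "z2_part z G = (\<lambda>(y, a). if y = z then G a else {0})"

definition eps_tilde :: "('a \<Rightarrow> 'a \<Rightarrow> 'k::field) \<Rightarrow> bit \<times> 'a \<Rightarrow> bit \<times> 'a \<Rightarrow> 'k" where
  "eps_tilde \<epsilon> = (\<lambda>(z1, a1) (z2, a2). (if z1 * z2 = 1 then -1 else 1) * \<epsilon> a1 a2)"

subsection \<open>Tensor products\<close>

text \<open>
  \<open>tensor_product s1 s2 s3 t\<close>: the space \<open>'w\<close> with \<open>t u v\<close> as \<open>u \<otimes> v\<close> is the tensor product, that is,
  the quotient of the vector space with basis \<open>'u \<times> 'v\<close> by the bilinearity relations.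
\<close>

definition free_scale :: "'k::field \<Rightarrow> ('x \<Rightarrow>\<^sub>0 'k) \<Rightarrow> ('x \<Rightarrow>\<^sub>0 'k)" where
  "free_scale c = Poly_Mapping.map ((*) c)"

definition bilinearity_rels ::
  "('k::field \<Rightarrow> 'u::ab_group_add \<Rightarrow> 'u) \<Rightarrow> ('k \<Rightarrow> 'v::ab_group_add \<Rightarrow> 'v) \<Rightarrow>
   ('u \<times> 'v \<Rightarrow>\<^sub>0 'k) set" where
  "bilinearity_rels s1 s2 =
     (let b = (\<lambda>u v. Poly_Mapping.single (u, v) (1::'k)) in
       {b (u + u') v - b u v - b u' v |u u' v. True} \<union>
       {b u (v + v') - b u v - b u v' |u v v'. True} \<union>
       {b (s1 c u) v - free_scale c (b u v) |c u v. True} \<union>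
       {b u (s2 c v) - free_scale c (b u v) |c u v. True})"

definition tensor_eval ::
  "('k::zero \<Rightarrow> 'w::comm_monoid_add \<Rightarrow> 'w) \<Rightarrow> ('u \<Rightarrow> 'v \<Rightarrow> 'w) \<Rightarrow> ('u \<times> 'v \<Rightarrow>\<^sub>0 'k) \<Rightarrow> 'w" where
  "tensor_eval s3 t p = (\<Sum>(u, v)\<in>Poly_Mapping.keys p. s3 (Poly_Mapping.lookup p (u, v)) (t u v))"

definition tensor_product ::
  "('k::field \<Rightarrow> 'u::ab_group_add \<Rightarrow> 'u) \<Rightarrow> ('k \<Rightarrow> 'v::ab_group_add \<Rightarrow> 'v) \<Rightarrow>
   ('k \<Rightarrow> 'w::ab_group_add \<Rightarrow> 'w) \<Rightarrow> ('u \<Rightarrow> 'v \<Rightarrow> 'w) \<Rightarrow> bool" where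
  "tensor_product s1 s2 s3 t \<longleftrightarrow>
     vector_space s3 \<and> range (tensor_eval s3 t) = UNIV \<and>
     {p. tensor_eval s3 t p = 0} = module.span free_scale (bilinearity_rels s1 s2)"

text \<open>
  The tensor product of the algebras \<open>'u\<close> and \<open>'c\<close>, graded by \<open>PU\<close> and \<open>PC\<close>, with the product twisted
  by \<open>\<eta>\<close>: \<open>(a \<otimes> b) (c \<otimes> d) = \<eta>(b, c) ac \<otimes> bd\<close>.
\<close>

definition twisted_tensor_algebra ::
  "('k::field \<Rightarrow> 'u::ring_1 \<Rightarrow> 'u) \<Rightarrow> ('b \<Rightarrow> 'u set) \<Rightarrow> ('k \<Rightarrow> 'c::ring_1 \<Rightarrow> 'c) \<Rightarrow> ('b \<Rightarrow> 'c set) \<Rightarrow>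
   ('b \<Rightarrow> 'b \<Rightarrow> 'k) \<Rightarrow> ('k \<Rightarrow> 'w::ring_1 \<Rightarrow> 'w) \<Rightarrow> ('u \<Rightarrow> 'c \<Rightarrow> 'w) \<Rightarrow> bool" where
  "twisted_tensor_algebra sU PU sC PC \<eta> sW t \<longleftrightarrow>
     algebra_over sW \<and> tensor_product sU sC sW t \<and> t 1 1 = 1 \<and>
     (\<forall>i j a d. \<forall>b\<in>PC i. \<forall>c\<in>PU j. t a b * t c d = sW (\<eta> i j) (t (a * c) (b * d)))"

subsection \<open>Extensions to the enveloping algebra\<close>

definition env_extension ::
  "('k::field \<Rightarrow> 'u::ring_1 \<Rightarrow> 'u) \<Rightarrow> ('g \<Rightarrow> 'u) \<Rightarrow> ('k \<Rightarrow> 'w::ring_1 \<Rightarrow> 'w) \<Rightarrow> ('g \<Rightarrow> 'w) \<Rightarrow>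
   'u \<Rightarrow> 'w" where
  "env_extension sU \<iota> sW f = (THE F. algebra_hom sU sW F \<and> (\<forall>x. F (\<iota> x) = f x))"

text \<open>The extension of the adjoint representation to an algebra morphism \<open>U\<^sub>\<epsilon>(\<g>) \<rightarrow> End(\<g>)\<close>.\<close>

definition ad_extension ::
  "('k::field \<Rightarrow> 'g::ab_group_add \<Rightarrow> 'g) \<Rightarrow> ('g \<Rightarrow> 'g \<Rightarrow> 'g) \<Rightarrow> ('k \<Rightarrow> 'u::ring_1 \<Rightarrow> 'u) \<Rightarrow>
   ('g \<Rightarrow> 'u) \<Rightarrow> 'u \<Rightarrow> 'g \<Rightarrow> 'g" where
  "ad_extension s br sU \<iota> =
     (THE A. (\<forall>x. A (\<iota> x) = br x) \<and> A 1 = id \<and> (\<forall>u v. A (u * v) = A u \<circ> A v) \<and>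
        (\<forall>z. Vector_Spaces.linear sU s (\<lambda>u. A u z)) \<and> (\<forall>u. Vector_Spaces.linear s s (A u)))"

subsection \<open>Casimir element and cubic Dirac operator\<close>

definition casimir :: "('g \<Rightarrow> 'u::ring_1) \<Rightarrow> ('g \<Rightarrow> 'g \<Rightarrow> 'k::zero_neq_one) \<Rightarrow> 'g set \<Rightarrow> 'u" where
  "casimir \<iota> B X = (\<Sum>x\<in>X. \<iota> (dual_basis B X x) * \<iota> x)"

definition cubic_term ::
  "('k::field \<Rightarrow> 'c::ring_1 \<Rightarrow> 'c) \<Rightarrow> ('v \<Rightarrow> 'c) \<Rightarrow> ('v \<Rightarrow> 'v \<Rightarrow> 'k) \<Rightarrow> ('v \<Rightarrow> 'v \<Rightarrow> 'v) \<Rightarrow> 'v set \<Rightarrow> 'c" where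
  "cubic_term sC \<iota> B \<phi> E =
     sC (1 / 12) (\<Sum>ei\<in>E. \<Sum>ej\<in>E. \<Sum>el\<in>E.
       sC (B (dual_basis B E ei) (\<phi> (dual_basis B E ej) (dual_basis B E el))) (\<iota> el * \<iota> ej * \<iota> ei))"

definition pi_star ::
  "('k::field \<Rightarrow> 'c::ring_1 \<Rightarrow> 'c) \<Rightarrow> ('v \<Rightarrow> 'c) \<Rightarrow> ('v \<Rightarrow> 'v \<Rightarrow> 'k) \<Rightarrow> ('g \<Rightarrow> 'v \<Rightarrow> 'v) \<Rightarrow> 'v set \<Rightarrow>
   'g \<Rightarrow> 'c" where
  "pi_star sC \<iota> B \<pi> E x = sC (1 / 4) (\<Sum>e\<in>E. \<iota> (\<pi> x (dual_basis B E e)) * \<iota> e)"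

definition cubic_dirac ::
  "('u::ring_1 \<Rightarrow> 'c::ring_1 \<Rightarrow> 'w::ring_1) \<Rightarrow> ('g::zero \<times> 'v \<Rightarrow> 'u) \<Rightarrow>
   ('k::field \<Rightarrow> 'c \<Rightarrow> 'c) \<Rightarrow> ('v \<Rightarrow> 'c) \<Rightarrow> ('v \<Rightarrow> 'v \<Rightarrow> 'k) \<Rightarrow> ('v \<Rightarrow> 'v \<Rightarrow> 'v) \<Rightarrow> 'v set \<Rightarrow> 'w" where
  "cubic_dirac t \<iota>U sC \<iota>C B \<phi> E =
     (\<Sum>e\<in>E. t (\<iota>U (0, dual_basis B E e)) (\<iota>C e)) + t 1 (cubic_term sC \<iota>C B \<phi> E)"

definition delta_map ::
  "('u::ring_1 \<Rightarrow> 'c::ring_1 \<Rightarrow> 'w::ring_1) \<Rightarrow> ('g \<times> 'v::zero \<Rightarrow> 'u) \<Rightarrow>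
   ('k::field \<Rightarrow> 'c \<Rightarrow> 'c) \<Rightarrow> ('v \<Rightarrow> 'c) \<Rightarrow> ('v \<Rightarrow> 'v \<Rightarrow> 'k) \<Rightarrow> ('g \<Rightarrow> 'v \<Rightarrow> 'v) \<Rightarrow> 'v set \<Rightarrow> 'g \<Rightarrow> 'w" where
  "delta_map t \<iota>U sC \<iota>C B \<pi> E x = t (\<iota>U (x, 0)) 1 + t 1 (pi_star sC \<iota>C B \<pi> E x)"

end

theory Submission
  imports Defs
begin

text \<open>
  Let \<open>f\<^sub>* = 1/4 \<Sum> f(e\<^sup>i) e\<^sub>i\<close> be the lift of \<open>f \<in> so\<^sub>\<epsilon>(V)\<close> to the Clifford algebra, so that
  \<open>[f\<^sub>*, v] = f(v)\<close>. Reordering \<open>D\<^sup>2\<close> with the relations of both factors leaves the Casimir element of \<open>V\<close>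
  and \<open>- 1/2 \<Sum> {e\<^sup>i, e\<^sup>j} \<otimes> e\<^sub>j e\<^sub>i\<close>. The \<open>\<mu>\<close>-part of the latter is the mixed part of \<open>- \<Delta>(\<Omega>(\<g>))\<close>, and the
  \<open>\<phi>\<close>-part cancels against \<open>D \<psi> + \<psi> D\<close>, because \<open>v \<psi> + \<psi> v = 2 \<phi>(v, -)\<^sub>*\<close>. It remains to see that
  \<open>\<psi>\<^sup>2 + \<pi>\<^sub>*(\<Omega>(\<g>))\<close> is the scalar \<open>\<tau>/8 + \<kappa>/24\<close>, where \<open>\<tau>\<close> and \<open>\<kappa>\<close> are the \<open>\<epsilon>\<close>-traces on \<open>V\<close> of
  \<open>\<pi>(\<Omega>(\<g>))\<close> and of \<open>\<Sum> \<phi>(e\<^sup>i, \<phi>(e\<^sub>i, -))\<close>.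

  The Jacobi identity expresses \<open>[\<phi>(u, -)\<^sub>*, \<psi>]\<close> through \<open>\<pi>\<close> alone. Contracting this with \<open>3 \<psi> = \<Sum> \<phi>(e\<^sup>i, -)\<^sub>* e\<^sub>i\<close>
  gives one linear relation between \<open>\<psi>\<^sup>2\<close>, \<open>\<pi>\<^sub>*(\<Omega>(\<g>))\<close> and \<open>Q = \<Sum> \<phi>(e\<^sup>i, -)\<^sub>* \<phi>(e\<^sub>i, -)\<^sub>*\<close>; a second relation,
  between \<open>Q\<close> and \<open>\<pi>\<^sub>*(\<Omega>(\<g>))\<close>, comes from writing \<open>Q\<close> as a sum over \<open>\<phi>(\<phi>(e\<^sup>a, e\<^sup>b), e\<^sup>c)\<close> and permuting
  the indices cyclically. Invariance of the form shows that the difference of the two traces in the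
  statement is \<open>3 \<tau> + \<kappa>\<close>.
\<close>

abbreviation lin ::
  "('k::field \<Rightarrow> 'v::ab_group_add \<Rightarrow> 'v) \<Rightarrow> ('k \<Rightarrow> 'w::ab_group_add \<Rightarrow> 'w) \<Rightarrow> ('v \<Rightarrow> 'w) \<Rightarrow> bool" where
  "lin \<equiv> Vector_Spaces.linear"

section \<open>Linear and bilinear maps\<close>

lemma lin_addD: "lin s t f \<Longrightarrow> f (x + y) = f x + f y"
  and lin_scaleD: "lin s t f \<Longrightarrow> f (s c x) = t c (f x)"
  and lin_vs1: "lin s t f \<Longrightarrow> vector_space s"
  and lin_vs2: "lin s t f \<Longrightarrow> vector_space t"
  by (simp_all add: Vector_Spaces.linear_iff)

lemma lin_zeroD: "lin s t f \<Longrightarrow> f 0 = 0"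
  by (metis add_cancel_right_left lin_addD)

lemma lin_minusD: "lin s t f \<Longrightarrow> f (- x) = - f x"
  by (metis eq_neg_iff_add_eq_0 lin_addD lin_zeroD add.left_inverse)

lemma lin_diffD: "lin s t f \<Longrightarrow> f (x - y) = f x - f y"
  by (metis diff_conv_add_uminus lin_addD lin_minusD)

lemma lin_sumD: "lin s t f \<Longrightarrow> f (\<Sum>i\<in>I. g i) = (\<Sum>i\<in>I. f (g i))"
  by (induction I rule: infinite_finite_induct) (simp_all add: lin_zeroD lin_addD)

lemma lin_ident: "vector_space s \<Longrightarrow> lin s s (\<lambda>x. x)"
  by (simp add: Vector_Spaces.linear_iff)

lemma lin_comp: "lin s2 s3 g \<Longrightarrow> lin s1 s2 f \<Longrightarrow> lin s1 s3 (\<lambda>x. g (f x))"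
  by (simp add: Vector_Spaces.linear_iff)

lemma lin_add: "lin s t f \<Longrightarrow> lin s t g \<Longrightarrow> lin s t (\<lambda>x. f x + g x)"
  by (simp add: Vector_Spaces.linear_iff vector_space_def algebra_simps)

lemma lin_neg: "lin s t f \<Longrightarrow> lin s t (\<lambda>x. - f x)"
  using module.scale_minus_right[of t]
  by (simp add: Vector_Spaces.linear_iff module_iff_vector_space)

lemma lin_diff: "lin s t f \<Longrightarrow> lin s t g \<Longrightarrow> lin s t (\<lambda>x. f x - g x)"
  using lin_add[of s t f "\<lambda>x. - g x"] by (simp add: lin_neg)

lemma lin_scale: "lin s t f \<Longrightarrow> lin s t (\<lambda>x. t c (f x))"
  by (simp add: Vector_Spaces.linear_iff vector_space_def mult.commute)

lemma lin_zero: "vector_space s \<Longrightarrow> vector_space t \<Longrightarrow> lin s t (\<lambda>x. 0)"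
  by (simp add: Vector_Spaces.linear_iff module.scale_zero_right module_iff_vector_space)

lemma lin_sum:
  "vector_space s \<Longrightarrow> vector_space t \<Longrightarrow> (\<And>i. i \<in> I \<Longrightarrow> lin s t (f i)) \<Longrightarrow> lin s t (\<lambda>x. \<Sum>i\<in>I. f i x)"
  by (induction I rule: infinite_finite_induct) (simp_all add: lin_zero lin_add)

lemma lin_scale_fixed: "vector_space t \<Longrightarrow> lin s (*) f \<Longrightarrow> lin s t (\<lambda>x. t (f x) v)"
  by (simp add: Vector_Spaces.linear_iff vector_space_def)

lemma lin_mult_left: "algebra_over t \<Longrightarrow> lin s t f \<Longrightarrow> lin s t (\<lambda>x. f x * c)"
  by (simp add: Vector_Spaces.linear_iff algebra_over_def distrib_right)

lemma lin_mult_right: "algebra_over t \<Longrightarrow> lin s t f \<Longrightarrow> lin s t (\<lambda>x. c * f x)"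
  unfolding Vector_Spaces.linear_iff algebra_over_def by (metis distrib_left)

lemma algebra_over_field: "algebra_over ((*) :: 'k::field \<Rightarrow> 'k \<Rightarrow> 'k)"
  by (simp add: algebra_over_def vector_space_def algebra_simps)

lemma algebra_over_vs: "algebra_over t \<Longrightarrow> vector_space t"
  by (simp add: algebra_over_def)

lemma bilinear_mapD:
  assumes "bilinear_map s1 s2 s3 F"
  shows "lin s2 s3 (F u)" and "lin s1 s3 (\<lambda>u. F u v)"
  using assms by (auto simp: bilinear_map_def)

lemma bilinear_mapI:
  "(\<And>u. lin s2 s3 (\<lambda>v. F u v)) \<Longrightarrow> (\<And>v. lin s1 s3 (\<lambda>u. F u v)) \<Longrightarrow> bilinear_map s1 s2 s3 F"
  by (auto simp: bilinear_map_def)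

section \<open>Commutation factors\<close>

locale commutation =
  fixes \<epsilon> :: "'a::ab_group_add \<Rightarrow> 'a \<Rightarrow> 'k::field"
  assumes commutation: "commutation_factor \<epsilon>"
begin

lemma eps_inv: "\<epsilon> a b * \<epsilon> b a = 1"
  and eps_add_left: "\<epsilon> (a + b) c = \<epsilon> a c * \<epsilon> b c"
  and eps_add_right: "\<epsilon> c (a + b) = \<epsilon> c a * \<epsilon> c b"
  using commutation by (simp_all add: commutation_factor_def)

lemma eps_nz: "\<epsilon> a b \<noteq> 0"
  using eps_inv[of a b] by auto

lemma eps_zero [simp]: "\<epsilon> 0 c = 1" "\<epsilon> c 0 = 1"
  using eps_add_left[of 0 0 c] eps_add_right[of c 0 0] eps_nz[of 0 c] eps_nz[of c 0] by auto

lemma eps_minus_left: "\<epsilon> (- a) b = \<epsilon> b a"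
proof -
  have "\<epsilon> (- a) b * \<epsilon> a b = \<epsilon> b a * \<epsilon> a b"
    using eps_add_left[of "- a" a b] by (simp add: eps_inv)
  then show ?thesis
    using eps_nz[of a b] by simp
qed

lemma eps_minus_right: "\<epsilon> b (- a) = \<epsilon> a b"
proof -
  have "\<epsilon> b (- a) * \<epsilon> b a = \<epsilon> a b * \<epsilon> b a"
    using eps_add_right[of b "- a" a] by (simp add: eps_inv)
  then show ?thesis
    using eps_nz[of b a] by simp
qed

lemma eps_diff_left: "\<epsilon> (a - b) c = \<epsilon> a c * \<epsilon> c b"
  and eps_diff_right: "\<epsilon> c (a - b) = \<epsilon> c a * \<epsilon> b c"
  using eps_add_left[of a "- b" c] eps_add_right[of c a "- b"]
  by (simp_all add: eps_minus_left eps_minus_right)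

text \<open>These rewrite every commutation factor as a product of factors of the basic degrees.
  What remains is an identity of monomials modulo the relations \<open>eps_inv\<close>, which
  polynomial arithmetic decides.\<close>

lemmas eps_simps = eps_diff_left eps_diff_right eps_add_left eps_add_right eps_minus_left eps_minus_right

lemma eps_cancel [simp]: "\<epsilon> a b * \<epsilon> b a = 1" "\<epsilon> a b * (\<epsilon> b a * c) = c"
  using eps_inv[of a b] by (simp_all flip: mult.assoc)

end

section \<open>Dual bases\<close>

text \<open>The function \<open>d\<close> selects a degree for each basis vector, so that the
  commutation factors inside a sum over \<open>E\<close> are functions of the summation index. The
  locale is instantiated for \<open>\<g>\<close>, for \<open>V\<close> and for their direct
  sum.\<close>

locale colour_form = commutation \<epsilon>
  for \<epsilon> :: "'a::ab_group_add \<Rightarrow> 'a \<Rightarrow> 'k::field" +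
  fixes s :: "'k \<Rightarrow> 'v::ab_group_add \<Rightarrow> 'v" and G :: "'a \<Rightarrow> 'v set" and B :: "'v \<Rightarrow> 'v \<Rightarrow> 'k"
    and E :: "'v set" and d :: "'v \<Rightarrow> 'a"
  assumes graded: "graded_space s G"
    and form: "eps_symmetric_form s G \<epsilon> B"
    and nondeg: "nondegenerate B"
    and basis: "finite_dimensional_vector_space s E"
    and deg: "e \<in> E \<Longrightarrow> e \<in> G (d e)"
begin

abbreviation du :: "'v \<Rightarrow> 'v" where "du \<equiv> dual_basis B E"

lemma vs: "vector_space s"
  using graded by (simp add: graded_space_def)

lemma finE: "finite E"
  using basis by (simp add: finite_dimensional_vector_space_def finite_dimensional_vector_space_axioms_def)

lemma B_lin: "lin s (*) (B u)" "lin s (*) (\<lambda>u. B u v)"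
  using form by (simp_all add: eps_symmetric_form_def bilinear_map_def)

lemma B_lin_comp: "lin t s f \<Longrightarrow> lin t (*) (\<lambda>x. B u (f x))" "lin t s f \<Longrightarrow> lin t (*) (\<lambda>x. B (f x) v)"
  using lin_comp[OF B_lin(1)] lin_comp[OF B_lin(2)] by blast+

lemma B_deg: "v \<in> G a \<Longrightarrow> w \<in> G b \<Longrightarrow> a + b \<noteq> 0 \<Longrightarrow> B v w = 0"
  using form by (simp add: eps_symmetric_form_def)

lemma B_sym: "v \<in> G a \<Longrightarrow> w \<in> G b \<Longrightarrow> B v w = \<epsilon> a b * B w v"
  using form unfolding eps_symmetric_form_def by blast

text \<open>The form vanishes unless the two degrees are opposite, and then
  \<open>\<epsilon> a (- a)\<close> equals \<open>\<epsilon> a a\<close>.\<close>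

lemma B_swap:
  assumes "v \<in> G a" "w \<in> G b"
  shows "B v w = \<epsilon> a a * B w v" and "B v w = \<epsilon> b b * B w v"
proof -
  have "B w v = 0 \<or> b = - a"
    using B_deg[OF assms(2,1)] by (metis add_eq_0_iff2 add.commute)
  then show "B v w = \<epsilon> a a * B w v" "B v w = \<epsilon> b b * B w v"
    using B_sym[OF assms] by (auto simp: eps_simps)
qed

lemma B_eqI: "(\<And>u. B u v = B u w) \<Longrightarrow> v = w"
proof -
  assume "\<And>u. B u v = B u w"
  then have "\<forall>u. B u (v - w) = 0"
    by (simp add: lin_diffD[OF B_lin(1)])
  then show "v = w"
    using nondeg unfolding nondegenerate_def by (metis right_minus_eq)
qed

text \<open>Nondegeneracy makes \<open>\<Phi>\<close> injective, hence surjective by finite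
  dimension, and the dual vector is a preimage. The basis \<open>E'\<close> is arbitrary because
  \<open>lin_trace\<close> picks its basis by choice, without regard to the grading.\<close>

lemma dual_exists:
  assumes basis: "finite_dimensional_vector_space s E'"
  shows "\<exists>!u. \<forall>f\<in>E'. B f u = (if f = e then 1 else 0)"
proof -
  interpret F: finite_dimensional_vector_space s E' by fact
  have zero: "u = 0" if "\<And>f. f \<in> E' \<Longrightarrow> B f u = 0" for u
  proof -
    have "B v u = 0" for v
    proof -
      have "v \<in> F.span E'"
        using F.span_Basis by simp
      then show ?thesis
        by (induction rule: F.span_induct_alt)
          (simp_all add: lin_zeroD[OF B_lin(2)] lin_addD[OF B_lin(2)] lin_scaleD[OF B_lin(2)] that)
    qed
    then show ?thesis
      using nondeg by (simp add: nondegenerate_def)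
  qed
  define \<Phi> where "\<Phi> u = (\<Sum>f\<in>E'. s (B f u) f)" for u
  have lin: "lin s s \<Phi>"
    unfolding \<Phi>_def
    by (intro lin_sum lin_scale_fixed vs B_lin_comp lin_ident)
  have coeff: "\<forall>f\<in>E'. c f = c' f" if "(\<Sum>f\<in>E'. s (c f) f) = (\<Sum>f\<in>E'. s (c' f) f)" for c c'
  proof -
    have "(\<Sum>f\<in>E'. s (c f - c' f) f) = 0"
      using that by (simp add: F.scale_left_diff_distrib sum_subtractf)
    then show ?thesis
      using F.independentD[OF F.independent_Basis F.finite_Basis subset_refl, of "\<lambda>f. c f - c' f"] by auto
  qed
  have "inj \<Phi>"
  proof (rule injI)
    fix u v assume "\<Phi> u = \<Phi> v"
    then have "\<forall>f\<in>E'. B f u = B f v"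
      unfolding \<Phi>_def by (rule coeff)
    then have "u - v = 0"
      by (intro zero) (simp add: lin_diffD[OF B_lin(1)])
    then show "u = v" by simp
  qed
  then have "surj \<Phi>"
    using F.linear_inj_imp_surj lin by blast
  then obtain u where u: "\<Phi> u = (\<Sum>f\<in>E'. s (if f = e then 1 else 0) f)"
    by (metis surjD)
  show ?thesis
  proof (rule ex1I)
    show "\<forall>f\<in>E'. B f u = (if f = e then 1 else 0)"
      using u unfolding \<Phi>_def by (rule coeff)
  next
    fix u' assume u': "\<forall>f\<in>E'. B f u' = (if f = e then 1 else 0)"
    have "\<forall>f\<in>E'. B f u = (if f = e then 1 else 0)"
      using u unfolding \<Phi>_def by (rule coeff)
    then have "u' - u = 0"
      using u' by (intro zero) (simp add: lin_diffD[OF B_lin(1)])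
    then show "u' = u" by simp
  qed
qed

lemma B_dual_basis:
  assumes "finite_dimensional_vector_space s E'" "f \<in> E'"
  shows "B f (dual_basis B E' e) = (if f = e then 1 else 0)"
  using theI'[OF dual_exists[OF assms(1)], of e] assms(2) unfolding dual_basis_def by simp

lemma expand_basis:
  assumes basis: "finite_dimensional_vector_space s E'"
  shows "(\<Sum>e\<in>E'. s (B v (dual_basis B E' e)) e) = v"
proof -
  interpret F: finite_dimensional_vector_space s E' by fact
  have "v \<in> F.span E'"
    using F.span_Basis by simp
  then show ?thesis
  proof (induction rule: F.span_induct_alt)
    case base
    then show ?case by (simp add: lin_zeroD[OF B_lin(2)])
  next
    case (step c x y)
    have "(\<Sum>e\<in>E'. s (B (s c x + y) (dual_basis B E' e)) e)
        = (\<Sum>e\<in>E'. s (c * B x (dual_basis B E' e)) e) + (\<Sum>e\<in>E'. s (B y (dual_basis B E' e)) e)"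
      by (simp add: lin_addD[OF B_lin(2)] lin_scaleD[OF B_lin(2)] F.scale_left_distrib sum.distrib)
    also have "(\<Sum>e\<in>E'. s (c * B x (dual_basis B E' e)) e) = (\<Sum>e\<in>E'. if x = e then s c e else 0)"
      using step.hyps by (intro sum.cong) (auto simp: B_dual_basis[OF basis])
    also have "\<dots> = s c x"
      using step.hyps by (simp add: F.finite_Basis)
    finally show ?case
      using step.IH by simp
  qed
qed

text \<open>Both sides have the same pairing with every \<open>u\<close>, as one sees by expanding
  \<open>u\<close> in the basis.\<close>

lemma expand_dual_basis:
  assumes basis: "finite_dimensional_vector_space s E'"
  shows "(\<Sum>e\<in>E'. s (B e v) (dual_basis B E' e)) = v"
proof -
  interpret F: finite_dimensional_vector_space s E' by fact
  let ?w = "\<Sum>e\<in>E'. s (B e v) (dual_basis B E' e)"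
  have "B u ?w = B u v" for u
  proof -
    have "B u v = B (\<Sum>e\<in>E'. s (B u (dual_basis B E' e)) e) v"
      by (simp add: expand_basis[OF basis])
    also have "\<dots> = B u ?w"
      by (simp add: lin_sumD[OF B_lin(2)] lin_sumD[OF B_lin(1)] lin_scaleD[OF B_lin(2)]
          lin_scaleD[OF B_lin(1)] mult.commute)
    finally show ?thesis ..
  qed
  then show ?thesis
    by (rule B_eqI)
qed

section \<open>Contractions of sums over a basis and its dual\<close>

lemma expand: "lin s t F \<Longrightarrow> (\<Sum>e\<in>E. t (B v (du e)) (F e)) = F v"
  and expand_dual: "lin s t F \<Longrightarrow> (\<Sum>e\<in>E. t (B e v) (F (du e))) = F v"
proof -
  assume "lin s t F"
  then show "(\<Sum>e\<in>E. t (B v (du e)) (F e)) = F v" "(\<Sum>e\<in>E. t (B e v) (F (du e))) = F v"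
    using lin_sumD[of s t F "\<lambda>e. s (B v (du e)) e" E] lin_sumD[of s t F "\<lambda>e. s (B e v) (du e)" E]
    by (simp_all add: expand_basis[OF basis] expand_dual_basis[OF basis] lin_scaleD)
qed

text \<open>The element \<open>\<Sum> e\<^sup>i \<otimes> e\<^sub>i\<close> does not depend on the
  basis. The second family only has to reproduce every vector, over any index set, which allows for
  bases glued from those of two summands.\<close>

lemma dual_sum_independent:
  assumes basis: "finite_dimensional_vector_space s E'"
    and F: "bilinear_map s s t F"
    and exp1: "\<And>v. v = (\<Sum>i\<in>I. s (B v (b' i)) (b i))"
  shows "(\<Sum>e\<in>E'. F (dual_basis B E' e) e) = (\<Sum>i\<in>I. F (b' i) (b i))"
proof -
  note F1 = bilinear_mapD(1)[OF F] and F2 = bilinear_mapD(2)[OF F]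
  have "F (dual_basis B E' e) e = (\<Sum>i\<in>I. t (B e (b' i)) (F (dual_basis B E' e) (b i)))" for e
  proof -
    have "F (dual_basis B E' e) e = F (dual_basis B E' e) (\<Sum>i\<in>I. s (B e (b' i)) (b i))"
      by (rule arg_cong[OF exp1])
    also have "\<dots> = (\<Sum>i\<in>I. t (B e (b' i)) (F (dual_basis B E' e) (b i)))"
      by (simp add: lin_sumD[OF F1] lin_scaleD[OF F1])
    finally show ?thesis .
  qed
  then have "(\<Sum>e\<in>E'. F (dual_basis B E' e) e)
      = (\<Sum>i\<in>I. \<Sum>e\<in>E'. t (B e (b' i)) (F (dual_basis B E' e) (b i)))"
    by (simp add: sum.swap[of _ I])
  also have "\<dots> = (\<Sum>i\<in>I. F (\<Sum>e\<in>E'. s (B e (b' i)) (dual_basis B E' e)) (b i))"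
    by (simp add: lin_sumD[OF F2] lin_scaleD[OF F2])
  finally show ?thesis
    by (simp add: expand_dual_basis[OF basis])
qed

text \<open>Only the component of degree \<open>- d f\<close> of a vector pairs nontrivially with
  \<open>f\<close>. Hence the component of \<open>du e\<close> of degree \<open>- d e\<close>
  satisfies the equations that define \<open>du e\<close>, and uniqueness identifies the
  two.\<close>

lemma du_deg:
  assumes e: "e \<in> E"
  shows "du e \<in> G (- d e)"
proof -
  obtain h where h: "\<And>a. h a \<in> G a" "finite {a. h a \<noteq> 0}" "du e = (\<Sum>a | h a \<noteq> 0. h a)"
    using graded unfolding graded_space_def homogeneous_decomp_def by metis
  have comp: "B f (du e) = B f (h (- d f))" if f: "f \<in> E" for f
  proof -
    have "B f (du e) = (\<Sum>a | h a \<noteq> 0. B f (h a))"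
      by (simp add: h(3) lin_sumD[OF B_lin(1)])
    also have "\<dots> = (\<Sum>a | h a \<noteq> 0. if a = - d f then B f (h a) else 0)"
      using B_deg[OF deg[OF f] h(1)] by (intro sum.cong) (auto simp: eq_neg_iff_add_eq_0 add.commute)
    also have "\<dots> = B f (h (- d f))"
      using h(2) by (simp add: lin_zeroD[OF B_lin(1)])
    finally show ?thesis .
  qed
  have "B f (h (- d e)) = (if f = e then 1 else 0)" if f: "f \<in> E" for f
  proof (cases "d f = d e")
    case True
    then show ?thesis using comp[OF f] B_dual_basis[OF basis f] by simp
  next
    case False
    then show ?thesis using B_deg[OF deg[OF f] h(1), of "- d e"] by auto
  qed
  then have "h (- d e) = du e"
    using dual_exists[OF basis, of e] B_dual_basis[OF basis, of _ e] by blast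
  then show ?thesis
    using h(1) by metis
qed

lemma contract:
  assumes F: "lin s t F" and e: "e \<in> E"
  shows "(\<Sum>f\<in>E. t (B e f) (F (du f))) = t (\<epsilon> (d e) (d e)) (F e)"
proof -
  interpret t: vector_space t using F by (rule lin_vs2)
  have "(\<Sum>f\<in>E. t (B e f) (F (du f))) = (\<Sum>f\<in>E. t (\<epsilon> (d e) (d e)) (t (B f e) (F (du f))))"
    using B_swap(1)[OF deg[OF e] deg] by (intro sum.cong) auto
  also have "\<dots> = t (\<epsilon> (d e) (d e)) (F e)"
    by (simp only: t.scale_sum_right[symmetric] expand_dual[OF F])
  finally show ?thesis .
qed

text \<open>The basis dual to \<open>{du e}\<close> consists of the vectors
  \<open>\<epsilon> (d e) (d e)\<close> times \<open>e\<close>, so the roles of a basis and its dual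
  can be exchanged. A weight \<open>c\<close> depending on the degree changes its argument to
  \<open>- d e\<close>, the degree of the dual vector.\<close>

lemma flip_weighted:
  assumes F: "bilinear_map s s t F"
  shows "(\<Sum>e\<in>E. t (c (d e) * \<epsilon> (d e) (d e)) (F e (du e))) = (\<Sum>e\<in>E. t (c (- d e)) (F (du e) e))"
proof -
  note F1 = bilinear_mapD(1)[OF F] and F2 = bilinear_mapD(2)[OF F]
  interpret t: vector_space t using F1 by (rule lin_vs2)
  have "(\<Sum>e\<in>E. t (c (d e) * \<epsilon> (d e) (d e)) (F e (du e)))
      = (\<Sum>e\<in>E. t (c (d e)) (\<Sum>f\<in>E. t (B e f) (F (du f) (du e))))"
    using contract[OF F2] by (intro sum.cong) auto
  also have "\<dots> = (\<Sum>e\<in>E. \<Sum>f\<in>E. t (c (- d f)) (t (B e f) (F (du f) (du e))))"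
  proof (intro sum.cong refl)
    fix e assume e: "e \<in> E"
    \<comment> \<open>The form forces \<open>d e = - d f\<close>, so the weight can be read off from
      either index.\<close>
    have "c (d e) * B e f = c (- d f) * B e f" if "f \<in> E" for f
      using B_deg[OF deg[OF e] deg[OF that]] by (metis eq_neg_iff_add_eq_0 mult_zero_right)
    then show "t (c (d e)) (\<Sum>f\<in>E. t (B e f) (F (du f) (du e)))
        = (\<Sum>f\<in>E. t (c (- d f)) (t (B e f) (F (du f) (du e))))"
      unfolding t.scale_sum_right t.scale_scale by (intro sum.cong) simp_all
  qed
  also have "\<dots> = (\<Sum>f\<in>E. \<Sum>e\<in>E. t (c (- d f)) (t (B e f) (F (du f) (du e))))"
    by (rule sum.swap)
  also have "\<dots> = (\<Sum>f\<in>E. t (c (- d f)) (F (du f) f))"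
    by (simp only: t.scale_sum_right[symmetric] expand_dual[OF F1])
  finally show ?thesis .
qed

lemma flip:
  assumes F: "bilinear_map s s t F"
  shows "(\<Sum>e\<in>E. t (\<epsilon> (d e) (d e)) (F e (du e))) = (\<Sum>e\<in>E. F (du e) e)"
  using flip_weighted[OF F, of "\<lambda>_. 1"] lin_vs2[OF bilinear_mapD(1)[OF F]]
  by (simp add: vector_space_def)

text \<open>Expanding \<open>f e\<close> in the basis, applying the adjunction to the coefficients
  and summing over \<open>e\<close> first transports an operator from the basis to the dual basis.
  The weight \<open>c\<close> absorbs the commutation factors of the adjunction.\<close>

lemma adjoint_sum:
  assumes F: "bilinear_map s s t F" and f: "lin s s f" and g: "lin s s g"
    and adj: "\<And>e e'. e \<in> E \<Longrightarrow> e' \<in> E \<Longrightarrow> c e * B (f e) (du e') = B e (g (du e'))"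
  shows "(\<Sum>e\<in>E. t (c e) (F (du e) (f e))) = (\<Sum>e\<in>E. F (g (du e)) e)"
proof -
  note F1 = bilinear_mapD(1)[OF F] and F2 = bilinear_mapD(2)[OF F]
  interpret t: vector_space t using F1 by (rule lin_vs2)
  have "(\<Sum>e\<in>E. t (c e) (F (du e) (f e)))
      = (\<Sum>e\<in>E. t (c e) (\<Sum>e'\<in>E. t (B (f e) (du e')) (F (du e) e')))"
    by (simp only: expand[OF F1])
  also have "\<dots> = (\<Sum>e\<in>E. \<Sum>e'\<in>E. t (B e (g (du e'))) (F (du e) e'))"
    using adj by (intro sum.cong) (simp_all add: t.scale_sum_right)
  also have "\<dots> = (\<Sum>e'\<in>E. \<Sum>e\<in>E. t (B e (g (du e'))) (F (du e) e'))"
    by (rule sum.swap)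
  also have "\<dots> = (\<Sum>e\<in>E. F (g (du e)) e)"
    by (simp only: expand_dual[OF F2])
  finally show ?thesis .
qed

section \<open>Skew operators and the Casimir operators built from them\<close>

lemma so_epsD:
  assumes "f \<in> so_eps s G \<epsilon> B a"
  shows "lin s s f" and "v \<in> G b \<Longrightarrow> f v \<in> G (a + b)"
    and "v \<in> G b \<Longrightarrow> B (f v) w = - \<epsilon> a b * B v (f w)"
  using assms unfolding so_eps_def by (auto simp: add_eq_0_iff2)

text \<open>This is \<open>adjoint_sum\<close> for a skew operator: its adjoint is
  \<open>- f\<close> up to \<open>\<epsilon> a (d e)\<close>, the inverse of the weight.\<close>

lemma so_adjoint:
  assumes F: "bilinear_map s s t F" and f: "f \<in> so_eps s G \<epsilon> B a"
  shows "(\<Sum>e\<in>E. t (\<epsilon> a (- d e)) (F (du e) (f e))) = - (\<Sum>e\<in>E. F (f (du e)) e)"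
proof -
  have "(\<Sum>e\<in>E. t (\<epsilon> a (- d e)) (F (du e) (f e))) = (\<Sum>e\<in>E. F (- f (du e)) e)"
  proof (rule adjoint_sum[OF F so_epsD(1)[OF f] lin_neg[OF so_epsD(1)[OF f]]])
    fix e e' assume "e \<in> E" "e' \<in> E"
    then show "\<epsilon> a (- d e) * B (f e) (du e') = B e (- f (du e'))"
      using so_epsD(3)[OF f deg]
      by (simp add: lin_minusD[OF B_lin(1)] eps_minus_right eps_inv[of "d e" a] flip: mult.assoc)
  qed
  then show ?thesis
    by (simp add: lin_minusD[OF bilinear_mapD(2)[OF F]] sum_negf)
qed

lemma subspaces: "module.subspace s (G a)"
  using graded by (simp add: graded_space_def)

text \<open>Moving both skew operators across the form reverses their order and produces
  \<open>\<epsilon> (dx x) (dx x)\<close>, and \<open>g.flip\<close>-type exchange of basis and dual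
  basis restores the order. A general skew family \<open>\<rho>\<close> covers both
  \<open>\<pi>\<close> with the basis of \<open>\<g>\<close> and \<open>\<phi>\<close> with the
  basis of \<open>V\<close>.\<close>

lemma casimir_symmetric:
  fixes \<rho> :: "'x::ab_group_add \<Rightarrow> 'v \<Rightarrow> 'v"
  assumes form': "colour_form \<epsilon> s' G' B' X dx"
    and lin1: "\<And>v. lin s' s (\<lambda>x. \<rho> x v)" and lin2: "\<And>x. lin s s (\<rho> x)"
    and so: "\<And>a x. x \<in> G' a \<Longrightarrow> \<rho> x \<in> so_eps s G \<epsilon> B a"
  defines "K \<equiv> \<lambda>v. \<Sum>x\<in>X. \<rho> (dual_basis B' X x) (\<rho> x v)"
  shows "lin s s K" and "v \<in> G a \<Longrightarrow> K v \<in> G a" and "v \<in> G a \<Longrightarrow> B (K v) w = B v (K w)"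
proof -
  interpret X: colour_form \<epsilon> s' G' B' X dx by fact
  interpret vs: vector_space s by (rule vs)
  show "lin s s K"
    unfolding K_def by (intro lin_sum vs lin_comp[OF lin2 lin2])
  assume v: "v \<in> G a"
  have xv: "\<rho> x v \<in> G (dx x + a)" if "x \<in> X" for x
    by (rule so_epsD(2)[OF so[OF X.deg[OF that]] v])
  have "\<rho> (X.du x) (\<rho> x v) \<in> G a" if "x \<in> X" for x
    using so_epsD(2)[OF so[OF X.du_deg[OF that]] xv[OF that]] by simp
  then show "K v \<in> G a"
    unfolding K_def by (intro vs.subspace_sum subspaces)
  have "B (\<rho> (X.du x) (\<rho> x v)) w = \<epsilon> (dx x) (dx x) * B v (\<rho> x (\<rho> (X.du x) w))" if x: "x \<in> X" for x
  proof -
    have "B (\<rho> (X.du x) (\<rho> x v)) w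
      = \<epsilon> (- dx x) (dx x + a) * (\<epsilon> (dx x) a * B v (\<rho> x (\<rho> (X.du x) w)))"
      using so_epsD(3)[OF so[OF X.du_deg[OF x]] xv[OF x]] so_epsD(3)[OF so[OF X.deg[OF x]] v] by simp
    then show ?thesis
      using eps_inv[of "dx x" a] unfolding eps_simps by algebra
  qed
  moreover have "bilinear_map s' s' (*) (\<lambda>p q. B v (\<rho> p (\<rho> q w)))"
    by (intro bilinear_mapI B_lin_comp lin1 lin_comp[OF lin2 lin1])
  from X.flip[OF this]
  have "(\<Sum>x\<in>X. \<epsilon> (dx x) (dx x) * B v (\<rho> x (\<rho> (X.du x) w))) = (\<Sum>x\<in>X. B v (\<rho> (X.du x) (\<rho> x w)))" .
  ultimately show "B (K v) w = B v (K w)"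
    by (simp add: K_def lin_sumD[OF B_lin(1)] lin_sumD[OF B_lin(2)])
qed

end

section \<open>Quadratic elements of a colour Clifford algebra\<close>

text \<open>The Clifford algebra enters through its defining relations, solved for the product in
  the opposite order so that they serve as reordering rules.\<close>

locale clifford_form = colour_form \<epsilon> s G B E d
  for \<epsilon> :: "'a::ab_group_add \<Rightarrow> 'a \<Rightarrow> 'k::field"
    and s :: "'k \<Rightarrow> 'v::ab_group_add \<Rightarrow> 'v" and G B E d +
  fixes sC :: "'k \<Rightarrow> 'c::ring_1 \<Rightarrow> 'c" and C :: "'v \<Rightarrow> 'c"
  assumes alg: "algebra_over sC"
    and C_lin: "lin s sC C"
    and C_rel: "x \<in> G a \<Longrightarrow> y \<in> G b \<Longrightarrow> C x * C y = sC (2 * B x y) 1 - sC (\<epsilon> a b) (C y * C x)"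
    and two: "(2::'k) \<noteq> 0" and three: "(3::'k) \<noteq> 0"
begin

sublocale sC: vector_space sC
  using alg by (rule algebra_over_vs)

lemma mult_scale: "sC c u * v = sC c (u * v)" "u * sC c v = sC c (u * v)"
  using alg unfolding algebra_over_def by metis+

lemmas scale_simps = mult_scale sC.scale_right_distrib sC.scale_right_diff_distrib
  distrib_left distrib_right right_diff_distrib left_diff_distrib mult.assoc

lemmas lin_rules = lin_mult_left[OF alg] lin_mult_right[OF alg] lin_comp[OF C_lin] C_lin
  lin_ident[OF vs] vs sC.vector_space_axioms lin_scale

text \<open>Unnormalised: \<open>S (\<pi> x)\<close> is \<open>4 \<pi>\<^sub>*(x)\<close>, and \<open>Psi\<close> below is \<open>12 \<psi>\<close>.\<close>

definition S :: "('v \<Rightarrow> 'v) \<Rightarrow> 'c" where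
  "S f = (\<Sum>e\<in>E. C (f (du e)) * C e)"

text \<open>Moving \<open>C w\<close> to the left past the two factors of each summand leaves two
  contractions. One sums directly to twice \<open>C (f w)\<close>, the other does so after skewness
  has moved \<open>f\<close> to \<open>w\<close>.\<close>

lemma S_commutator_C:
  assumes f: "f \<in> so_eps s G \<epsilon> B a" and w: "w \<in> G b"
  shows "S f * C w = sC (\<epsilon> a b) (C w * S f) + sC 4 (C (f w))"
proof -
  have summand: "C (f (du e)) * C e * C w
      = sC (2 * B e w) (C (f (du e))) + sC (2 * B (f w) (du e)) (C e)
        + sC (\<epsilon> a b) (C w * (C (f (du e)) * C e))" if e: "e \<in> E" for e
  proof -
    have fe: "f (du e) \<in> G (a + - d e)"
      by (intro so_epsD(2)[OF f] du_deg e)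
    have "B (f (du e)) w = - \<epsilon> a (- d e) * (\<epsilon> (- d e) (a + b) * B (f w) (du e))"
      using so_epsD(3)[OF f du_deg[OF e]] B_sym[OF du_deg[OF e] so_epsD(2)[OF f w]] by simp
    \<comment> \<open>Skewness of \<open>f\<close> followed by the symmetry of the form; all factors
      but the sign cancel.\<close>
    then have B: "\<epsilon> (d e) b * B (f (du e)) w = - B (f w) (du e)"
      using eps_inv[of a "d e"] eps_inv[of b "d e"] unfolding eps_simps by algebra
    have eps: "\<epsilon> (d e) b * \<epsilon> (a + - d e) b = \<epsilon> a b"
      using eps_inv[of b "d e"] unfolding eps_simps by algebra
    have "C (f (du e)) * C e * C w
      = sC (2 * B e w) (C (f (du e))) - sC (\<epsilon> (d e) b) (C (f (du e)) * C w * C e)"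
      by (simp add: mult.assoc C_rel[OF deg[OF e] w] scale_simps)
    also have "C (f (du e)) * C w * C e
      = sC (2 * B (f (du e)) w) (C e) - sC (\<epsilon> (a + - d e) b) (C w * (C (f (du e)) * C e))"
      by (simp add: C_rel[OF fe w] scale_simps)
    also have "sC (\<epsilon> (d e) b) \<dots>
      = sC (2 * (\<epsilon> (d e) b * B (f (du e)) w)) (C e)
        - sC (\<epsilon> (d e) b * \<epsilon> (a + - d e) b) (C w * (C (f (du e)) * C e))"
      by (simp add: scale_simps mult.left_commute)
    finally show ?thesis
      unfolding B eps by simp
  qed
  have "S f * C w = (\<Sum>e\<in>E. sC 2 (sC (B e w) (C (f (du e))))) + (\<Sum>e\<in>E. sC 2 (sC (B (f w) (du e)) (C e)))
      + (\<Sum>e\<in>E. sC (\<epsilon> a b) (C w * (C (f (du e)) * C e)))"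
    unfolding S_def sum_distrib_right by (simp add: summand sum.distrib)
  also have "\<dots> = sC 2 (C (f w)) + sC 2 (C (f w)) + sC (\<epsilon> a b) (C w * S f)"
    unfolding S_def sum_distrib_left sC.scale_sum_right[symmetric]
    by (simp add: expand[OF C_lin] expand_dual[OF lin_comp[OF C_lin so_epsD(1)[OF f]]])
  finally show ?thesis
    by (simp flip: sC.scale_left_distrib)
qed

text \<open>By \<open>S_commutator_C\<close>, \<open>S f\<close> acts as a derivation on each
  product in \<open>S g\<close>. The term in which \<open>f\<close> hits \<open>C e\<close> is
  transported to the dual vector by \<open>so_adjoint\<close>, which produces the second half of the
  commutator of \<open>f\<close> and \<open>g\<close>.\<close>

lemma S_commutator:
  assumes f: "f \<in> so_eps s G \<epsilon> B a" and g: "g \<in> so_eps s G \<epsilon> B b"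
  shows "S f * S g = sC (\<epsilon> a b) (S g * S f) + sC 4 (S (\<lambda>v. f (g v) - s (\<epsilon> a b) (g (f v))))"
proof -
  note flin = so_epsD(1)[OF f] and glin = so_epsD(1)[OF g]
  have summand: "S f * (C (g (du e)) * C e) = sC (\<epsilon> a b) (C (g (du e)) * C e * S f)
      + sC (4 * \<epsilon> a b) (sC (\<epsilon> a (- d e)) (C (g (du e)) * C (f e)))
      + sC 4 (C (f (g (du e))) * C e)" if e: "e \<in> E" for e
  proof -
    have ge: "g (du e) \<in> G (b + - d e)"
      by (intro so_epsD(2)[OF g] du_deg e)
    have eps: "\<epsilon> a (b + - d e) * \<epsilon> a (d e) = \<epsilon> a b"
      using eps_inv[of "d e" a] unfolding eps_simps by algebra
    have "S f * (C (g (du e)) * C e) = (sC (\<epsilon> a (b + - d e)) (C (g (du e)) * S f) + sC 4 (C (f (g (du e))))) * C e"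
      by (simp only: S_commutator_C[OF f ge] mult.assoc[symmetric])
    also have "\<dots> = sC (\<epsilon> a (b + - d e)) (C (g (du e)) * (S f * C e)) + sC 4 (C (f (g (du e))) * C e)"
      by (simp add: scale_simps)
    also have "sC (\<epsilon> a (b + - d e)) (C (g (du e)) * (S f * C e))
      = sC (\<epsilon> a (b + - d e) * \<epsilon> a (d e)) (C (g (du e)) * C e * S f)
        + sC (4 * \<epsilon> a (b + - d e)) (C (g (du e)) * C (f e))"
      by (simp add: S_commutator_C[OF f deg[OF e]] scale_simps mult.commute)
    finally show ?thesis
      unfolding eps unfolding eps_add_right by (simp add: mult.assoc)
  qed
  have bil: "bilinear_map s s sC (\<lambda>p q. C (g p) * C q)"
    by (intro bilinear_mapI lin_rules glin)
  have "S f * S g = sC (\<epsilon> a b) (\<Sum>e\<in>E. C (g (du e)) * C e * S f)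
      + sC (4 * \<epsilon> a b) (\<Sum>e\<in>E. sC (\<epsilon> a (- d e)) (C (g (du e)) * C (f e)))
      + sC 4 (\<Sum>e\<in>E. C (f (g (du e))) * C e)"
    unfolding S_def[of g] sum_distrib_left sC.scale_sum_right sum.distrib[symmetric]
    by (intro sum.cong refl summand)
  also have "(\<Sum>e\<in>E. sC (\<epsilon> a (- d e)) (C (g (du e)) * C (f e))) = - S (\<lambda>v. g (f v))"
    using so_adjoint[OF bil f] by (simp add: S_def)
  also have "(\<Sum>e\<in>E. C (g (du e)) * C e * S f) = S g * S f"
    by (simp add: S_def[of g] sum_distrib_right)
  finally show ?thesis
    by (simp add: S_def lin_diffD[OF C_lin] lin_scaleD[OF C_lin] left_diff_distrib sum_subtractf
        mult_scale sC.scale_right_diff_distrib sC.scale_sum_right)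
qed

text \<open>Reversing the two factors by the Clifford relation gives twice a scalar minus the
  reversed sum. By \<open>flip\<close> and the symmetry of \<open>f\<close> the reversed sum is
  \<open>S f\<close> again, so twice \<open>S f\<close> is a scalar.\<close>

lemma symmetric_quadratic_scalar:
  assumes f: "lin s s f" and fdeg: "\<And>a v. v \<in> G a \<Longrightarrow> f v \<in> G a"
    and sym: "\<And>e e'. e \<in> E \<Longrightarrow> e' \<in> E \<Longrightarrow> B (f e) (du e') = B e (f (du e'))"
  shows "S f = sC (\<Sum>e\<in>E. B (f (du e)) e) 1"
proof -
  have bil: "bilinear_map s s sC (\<lambda>p q. C p * C (f q))" "bilinear_map s s sC (\<lambda>p q. C p * C q)"
    by (intro bilinear_mapI lin_rules f)+
  have "S f = (\<Sum>e\<in>E. sC (2 * B (f (du e)) e) 1 - sC (\<epsilon> (d e) (d e)) (C e * C (f (du e))))"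
    unfolding S_def using C_rel[OF fdeg[OF du_deg] deg] by (simp add: eps_simps)
  also have "\<dots> = sC (2 * (\<Sum>e\<in>E. B (f (du e)) e)) 1 - (\<Sum>e\<in>E. C (du e) * C (f e))"
    by (simp add: sum_subtractf flip[OF bil(1)] sC.scale_sum_left sum_distrib_left)
  also have "(\<Sum>e\<in>E. C (du e) * C (f e)) = S f"
    using adjoint_sum[OF bil(2) f f, of "\<lambda>_. 1"] sym by (simp add: S_def)
  finally have "sC 2 (S f) = sC 2 (sC (\<Sum>e\<in>E. B (f (du e)) e) 1)"
    by (metis diff_add_cancel one_add_one sC.scale_left_distrib sC.scale_one sC.scale_scale)
  then show ?thesis
    using two sC.scale_left_imp_eq by blast
qed

end

section \<open>The square of the cubic term\<close>

lemma sum_rotate: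
  "(\<Sum>i\<in>I. \<Sum>j\<in>J. \<Sum>k\<in>K. h i j k) = (\<Sum>k\<in>K. \<Sum>i\<in>I. \<Sum>j\<in>J. h i j k)"
proof -
  have "(\<Sum>i\<in>I. \<Sum>j\<in>J. \<Sum>k\<in>K. h i j k) = (\<Sum>i\<in>I. \<Sum>k\<in>K. \<Sum>j\<in>J. h i j k)"
    by (intro sum.cong refl sum.swap)
  also have "\<dots> = (\<Sum>k\<in>K. \<Sum>i\<in>I. \<Sum>j\<in>J. h i j k)"
    by (rule sum.swap)
  finally show ?thesis .
qed

text \<open>The assumption \<open>mu_expand\<close> is the moment map in the dual basis of
  \<open>\<g>\<close>, and \<open>jacobi\<close> is the \<open>V\<close>-component of the Jacobi
  identity for three elements of \<open>V\<close>, with the brackets through \<open>\<g>\<close>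
  collected on the right.\<close>

locale colour_lie_form = clifford_form \<epsilon> s G B E d sC C + g: colour_form \<epsilon> sg Gg Bg X dx
  for \<epsilon> :: "'a::ab_group_add \<Rightarrow> 'a \<Rightarrow> 'k::field"
    and s :: "'k \<Rightarrow> 'v::ab_group_add \<Rightarrow> 'v" and G B E d
    and sC :: "'k \<Rightarrow> 'c::ring_1 \<Rightarrow> 'c" and C
    and sg :: "'k \<Rightarrow> 'g::ab_group_add \<Rightarrow> 'g" and Gg Bg X dx +
  fixes \<pi> :: "'g \<Rightarrow> 'v \<Rightarrow> 'v" and \<phi> :: "'v \<Rightarrow> 'v \<Rightarrow> 'v" and \<mu> :: "'v \<Rightarrow> 'v \<Rightarrow> 'g"
  assumes pi_lin1: "lin sg s (\<lambda>x. \<pi> x v)" and pi_lin2: "lin s s (\<pi> x)"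
    and pi_so: "x \<in> Gg a \<Longrightarrow> \<pi> x \<in> so_eps s G \<epsilon> B a"
    and phi_bil: "bilinear_map s s s \<phi>"
    and phi_so: "u \<in> G a \<Longrightarrow> \<phi> u \<in> so_eps s G \<epsilon> B a"
    and phi_anti: "v \<in> G a \<Longrightarrow> w \<in> G b \<Longrightarrow> \<phi> v w = - s (\<epsilon> a b) (\<phi> w v)"
    and mu_expand: "\<mu> v w = (\<Sum>x\<in>X. sg (B (\<pi> x v) w) (dual_basis Bg X x))"
    and jacobi: "u \<in> G a \<Longrightarrow> v \<in> G b \<Longrightarrow> w \<in> G c \<Longrightarrow>
      \<phi> u (\<phi> v w) - \<phi> (\<phi> u v) w - s (\<epsilon> a b) (\<phi> v (\<phi> u w))
      = s (\<epsilon> a (b + c)) (\<pi> (\<mu> v w) u) + \<pi> (\<mu> u v) w - s (\<epsilon> b c) (\<pi> (\<mu> u w) v)"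
begin

lemmas phi_lin = bilinear_mapD[OF phi_bil]

lemmas lins = lin_rules lin_comp[OF phi_lin(1)] lin_comp[OF phi_lin(2)] lin_comp[OF pi_lin1]
  lin_comp[OF pi_lin2] phi_lin pi_lin1 pi_lin2 lin_ident[OF g.vs] g.vs

lemma S_lin: "(\<And>v. lin t s (\<lambda>u. h u v)) \<Longrightarrow> lin t sC (\<lambda>u. S (h u))"
  unfolding S_def by (intro lin_sum lins lin_vs1[of t s "\<lambda>u. h u 0"]) blast+

lemma S_phi_lin: "lin t s f \<Longrightarrow> lin t sC (\<lambda>u. S (\<phi> (f u)))"
  and S_pi_lin: "lin t sg h \<Longrightarrow> lin t sC (\<lambda>u. S (\<pi> (h u)))"
  by (intro S_lin lins; assumption)+

section \<open>The cubic element and its commutators with vectors and quadratic elements\<close>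

definition Psi :: 'c where
  "Psi = (\<Sum>e\<in>E. S (\<phi> (du e)) * C e)"

lemma phi_deg: "v \<in> G a \<Longrightarrow> w \<in> G b \<Longrightarrow> \<phi> v w \<in> G (a + b)"
  using so_epsD(2)[OF phi_so] by blast

text \<open>The coefficient is 2 + 4: contracting \<open>C v\<close> with \<open>C e\<close> gives
  2, and commuting it past \<open>S (\<phi> (du e))\<close> gives 4. The commutation factors of
  \<open>e\<close> and \<open>du e\<close> cancel, so an ordinary anticommutator appears.\<close>

lemma Psi_anticommutator:
  assumes v: "v \<in> G b"
  shows "C v * Psi + Psi * C v = sC 6 (S (\<phi> v))"
proof -
  have summand: "S (\<phi> (du e)) * C e * C v = sC 2 (sC (B e v) (S (\<phi> (du e))))
      - C v * (S (\<phi> (du e)) * C e) + sC 4 (C (\<phi> v (du e)) * C e)" if e: "e \<in> E" for e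
  proof -
    have eps: "\<epsilon> (d e) b * \<epsilon> (- d e) b = 1"
      by (simp add: eps_simps)
    have "S (\<phi> (du e)) * C e * C v = sC 2 (sC (B e v) (S (\<phi> (du e))))
        - sC (\<epsilon> (d e) b) (S (\<phi> (du e)) * C v * C e)"
      by (simp add: mult.assoc C_rel[OF deg[OF e] v] scale_simps)
    also have "S (\<phi> (du e)) * C v = sC (\<epsilon> (- d e) b) (C v * S (\<phi> (du e)) - sC 4 (C (\<phi> v (du e))))"
      by (simp add: S_commutator_C[OF phi_so[OF du_deg[OF e]] v] phi_anti[OF du_deg[OF e] v]
          lin_minusD[OF C_lin] lin_scaleD[OF C_lin] scale_simps mult.commute)
    also have "sC (\<epsilon> (d e) b) (\<dots> * C e) = sC (\<epsilon> (d e) b * \<epsilon> (- d e) b) ((C v * S (\<phi> (du e)) - sC 4 (C (\<phi> v (du e)))) * C e)"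
      by (simp only: mult_scale sC.scale_scale)
    finally show ?thesis
      unfolding eps by (simp add: scale_simps)
  qed
  have "Psi * C v = (\<Sum>e\<in>E. sC 2 (sC (B e v) (S (\<phi> (du e)))))
      - (\<Sum>e\<in>E. C v * (S (\<phi> (du e)) * C e)) + (\<Sum>e\<in>E. sC 4 (C (\<phi> v (du e)) * C e))"
    unfolding Psi_def sum_distrib_right by (simp add: summand sum.distrib sum_subtractf)
  also have "\<dots> = sC 2 (S (\<phi> v)) - C v * Psi + sC 4 (S (\<phi> v))"
    unfolding sC.scale_sum_right[symmetric] sum_distrib_left[symmetric] Psi_def[symmetric]
    using expand_dual[OF S_phi_lin[OF lin_ident[OF vs]]] by (simp add: S_def)
  finally show ?thesis
    by (simp add: algebra_simps flip: sC.scale_left_distrib)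
qed

text \<open>\<open>S f\<close> acts as a derivation on the three Clifford factors of
  \<open>Psi\<close>. Transporting \<open>f\<close> from \<open>e\<close> and \<open>e'\<close> to
  their duals leaves the defect of \<open>f\<close> from being a derivation of
  \<open>\<phi>\<close>, which the Jacobi identity will evaluate for
  \<open>f = \<phi> u\<close>.\<close>

lemma S_commutator_Psi:
  assumes f: "f \<in> so_eps s G \<epsilon> B a"
  shows "S f * Psi = Psi * S f + sC 4 (\<Sum>e\<in>E. \<Sum>e'\<in>E.
    C (f (\<phi> (du e) (du e')) - \<phi> (f (du e)) (du e') - s (\<epsilon> a (- d e)) (\<phi> (du e) (f (du e')))) * (C e' * C e))"
proof -
  note flin = so_epsD(1)[OF f]
  let ?p = "\<lambda>e e'. \<phi> (du e) (du e')"
  have summand: "S f * (C (?p e e') * (C e' * C e)) = C (?p e e') * (C e' * C e) * S f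
      + sC 4 (C (f (?p e e')) * (C e' * C e)
        + sC (\<epsilon> a (- d e)) (sC (\<epsilon> a (- d e')) (C (?p e e') * (C (f e') * C e)))
        + sC (\<epsilon> a (- d e)) (C (?p e e') * (C e' * C (f e))))" if e: "e \<in> E" "e' \<in> E" for e e'
  proof -
    have p: "?p e e' \<in> G (- d e + - d e')"
      by (intro phi_deg du_deg e)
    have eps: "\<epsilon> a (- d e + - d e') = \<epsilon> a (- d e) * \<epsilon> a (- d e')"
      "\<epsilon> a (- d e) * \<epsilon> a (- d e') * \<epsilon> a (d e') = \<epsilon> a (- d e)"
      "\<epsilon> a (- d e) * \<epsilon> a (d e) = 1"
      by (simp_all add: eps_simps mult.assoc)
    have "S f * (C (?p e e') * (C e' * C e)) = (S f * C (?p e e')) * (C e' * C e)"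
      by (simp only: mult.assoc)
    also have "\<dots> = sC (\<epsilon> a (- d e) * \<epsilon> a (- d e')) (C (?p e e') * (S f * C e') * C e) + sC 4 (C (f (?p e e')) * (C e' * C e))"
      by (simp only: S_commutator_C[OF f p] eps(1) scale_simps)
    also have "C (?p e e') * (S f * C e') * C e
        = sC (\<epsilon> a (d e')) (C (?p e e') * (C e' * (S f * C e))) + sC 4 (C (?p e e') * (C (f e') * C e))"
      by (simp add: S_commutator_C[OF f deg[OF e(2)]] scale_simps)
    also have "S f * C e = sC (\<epsilon> a (d e)) (C e * S f) + sC 4 (C (f e))"
      by (rule S_commutator_C[OF f deg[OF e(1)]])
    also have "sC (\<epsilon> a (- d e) * \<epsilon> a (- d e')) (sC (\<epsilon> a (d e')) (C (?p e e') * (C e' * (sC (\<epsilon> a (d e)) (C e * S f) + sC 4 (C (f e)))))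
        + sC 4 (C (?p e e') * (C (f e') * C e)))
      = sC (\<epsilon> a (- d e) * \<epsilon> a (- d e') * \<epsilon> a (d e')) (sC (\<epsilon> a (d e)) (C (?p e e') * (C e' * (C e * S f))))
        + sC (\<epsilon> a (- d e) * \<epsilon> a (- d e') * \<epsilon> a (d e')) (sC 4 (C (?p e e') * (C e' * C (f e))))
        + sC 4 (sC (\<epsilon> a (- d e)) (sC (\<epsilon> a (- d e')) (C (?p e e') * (C (f e') * C e))))"
      by (simp add: scale_simps mult_ac)
    finally show ?thesis
      unfolding eps(2) sC.scale_scale eps(3) by (simp add: scale_simps mult_ac add_ac)
  qed
  have Psi: "Psi = (\<Sum>e\<in>E. \<Sum>e'\<in>E. C (?p e e') * (C e' * C e))"
    by (simp add: Psi_def S_def sum_distrib_right mult.assoc)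
  have bil1: "bilinear_map s s sC (\<lambda>p q. C (\<phi> (du e) p) * (C q * C e))" for e
    by (intro bilinear_mapI lins)
  have bil2: "bilinear_map s s sC (\<lambda>p q. C (\<phi> p (du e')) * (C e' * C q))" for e'
    by (intro bilinear_mapI lins)
  have "S f * Psi = Psi * S f + sC 4 ((\<Sum>e\<in>E. \<Sum>e'\<in>E. C (f (?p e e')) * (C e' * C e))
      + (\<Sum>e\<in>E. sC (\<epsilon> a (- d e)) (\<Sum>e'\<in>E. sC (\<epsilon> a (- d e')) (C (?p e e') * (C (f e') * C e))))
      + (\<Sum>e\<in>E. \<Sum>e'\<in>E. sC (\<epsilon> a (- d e)) (C (?p e e') * (C e' * C (f e)))))"
    unfolding Psi sum_distrib_left sum_distrib_right sC.scale_sum_right sum.distrib[symmetric] sC.scale_right_distrib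
    by (intro sum.cong refl) (simp add: summand scale_simps)
  also have "(\<Sum>e\<in>E. sC (\<epsilon> a (- d e)) (\<Sum>e'\<in>E. sC (\<epsilon> a (- d e')) (C (?p e e') * (C (f e') * C e))))
      = - (\<Sum>e\<in>E. \<Sum>e'\<in>E. sC (\<epsilon> a (- d e)) (C (\<phi> (du e) (f (du e'))) * (C e' * C e)))"
    by (simp add: so_adjoint[OF bil1 f] sum_negf sC.scale_sum_right)
  also have "(\<Sum>e\<in>E. \<Sum>e'\<in>E. sC (\<epsilon> a (- d e)) (C (?p e e') * (C e' * C (f e))))
      = - (\<Sum>e\<in>E. \<Sum>e'\<in>E. C (\<phi> (f (du e)) (du e')) * (C e' * C e))"
    \<comment> \<open>\<open>bil2\<close> fixes \<open>e'\<close> and varies \<open>e\<close>, so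
      the sum over \<open>e\<close> has to be the inner one.\<close>
    by (subst (1 2) sum.swap) (simp add: so_adjoint[OF bil2 f] sum_negf)
  finally show ?thesis
    by (simp add: lin_diffD[OF C_lin] lin_addD[OF C_lin] lin_scaleD[OF C_lin] mult_scale
        sum_subtractf sum.distrib algebra_simps)
qed

section \<open>Contractions of the Jacobi identity with the moment map\<close>

lemma mu_hom: "lin sg t h \<Longrightarrow> h (\<mu> v w) = (\<Sum>x\<in>X. t (B (\<pi> x v) w) (h (g.du x)))"
  by (simp add: mu_expand lin_sumD lin_scaleD)

text \<open>\<open>Cas\<close> is \<open>\<pi>(\<Omega>(\<g>))\<close>; \<open>Kas\<close> is its analogue for \<open>\<phi>\<close>, which is not a representation.\<close>

definition Cas :: "'v \<Rightarrow> 'v" where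
  "Cas v = (\<Sum>x\<in>X. \<pi> (g.du x) (\<pi> x v))"

definition Kas :: "'v \<Rightarrow> 'v" where
  "Kas v = (\<Sum>e\<in>E. \<phi> (du e) (\<phi> e v))"

text \<open>As \<open>S (\<pi> x)\<close> is four times \<open>pi_star\<close> at \<open>x\<close>,
  this is 16 times the image of the Casimir element of \<open>\<g>\<close> in the Clifford
  algebra.\<close>

definition R :: 'c where
  "R = (\<Sum>x\<in>X. S (\<pi> (g.du x)) * S (\<pi> x))"

text \<open>\<open>Cas\<close> is symmetric of degree 0, so its quadratic element is a scalar. The
  scalar is the \<open>\<epsilon>\<close>-trace of \<open>Cas\<close>, in the form given by
  \<open>eps_trace_dual\<close>.\<close>

lemma S_Cas: "S Cas = sC (\<Sum>e\<in>E. B (Cas (du e)) e) 1"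
  using casimir_symmetric[OF g.colour_form_axioms pi_lin1 pi_lin2 pi_so]
  unfolding Cas_def[abs_def] by (intro symmetric_quadratic_scalar) (auto dest: deg)

lemma S_Kas: "S Kas = sC (\<Sum>e\<in>E. B (Kas (du e)) e) 1"
  using casimir_symmetric[OF colour_form_axioms phi_lin(2,1) phi_so]
  unfolding Kas_def[abs_def] by (intro symmetric_quadratic_scalar) (auto dest: deg)

text \<open>Four times \<open>Z u\<close> is the commutator of \<open>S (\<phi> u)\<close> with
  \<open>Psi\<close>, for homogeneous \<open>u\<close>, written through \<open>\<pi>\<close> alone;
  this combines \<open>S_commutator_Psi\<close> with \<open>jacobi_sum\<close>.\<close>

definition Z :: "'v \<Rightarrow> 'c" where
  "Z u = sC 3 (\<Sum>x\<in>X. S (\<pi> (g.du x)) * C (\<pi> x u)) - sC 6 (C (Cas u))"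

text \<open>The Jacobi identity replaces the summand by three moment map terms. With
  \<open>?P\<close> as reference, the first sums to \<open>?P\<close> minus four times
  \<open>C (Cas u)\<close>, the second to \<open>?P\<close>, and the third, which is subtracted, to
  twice \<open>C (Cas u)\<close> minus \<open>?P\<close>.\<close>

lemma jacobi_sum:
  assumes u: "u \<in> G a"
  shows "(\<Sum>e\<in>E. \<Sum>e'\<in>E.
    C (\<phi> u (\<phi> (du e) (du e')) - \<phi> (\<phi> u (du e)) (du e') - s (\<epsilon> a (- d e)) (\<phi> (du e) (\<phi> u (du e'))))
      * (C e' * C e)) = Z u"
proof -
  let ?P = "\<Sum>x\<in>X. S (\<pi> (g.du x)) * C (\<pi> x u)"
  have 1: "(\<Sum>e\<in>E. \<Sum>e'\<in>E. sC (\<epsilon> a (- d e + - d e')) (C (\<pi> (\<mu> (du e) (du e')) u) * (C e' * C e)))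
      = (\<Sum>x\<in>X. sC (\<epsilon> (dx x) a) (C (\<pi> (g.du x) u) * S (\<pi> x)))"
  proof -
    have "sC (\<epsilon> a (- d e + - d e')) (C (\<pi> (\<mu> (du e) (du e')) u) * (C e' * C e))
        = (\<Sum>x\<in>X. sC (\<epsilon> (dx x) a) (C (\<pi> (g.du x) u) * (sC (B (\<pi> x (du e)) (du e')) (C e') * C e)))"
      if e: "e \<in> E" "e' \<in> E" for e e'
    proof -
      \<comment> \<open>Where the form is nonzero, \<open>dx x = d e + d e'\<close>; the factor
        therefore depends on \<open>x\<close> only and leaves the sums over \<open>e\<close> and
        \<open>e'\<close>.\<close>
      have wt: "\<epsilon> a (- d e + - d e') * B (\<pi> x (du e)) (du e') = \<epsilon> (dx x) a * B (\<pi> x (du e)) (du e')"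
        if x: "x \<in> X" for x
      proof (cases "dx x + - d e + - d e' = 0")
        case True
        then have "- d e + - d e' = - dx x"
          by (simp add: algebra_simps eq_neg_iff_add_eq_0)
        then show ?thesis by (simp only: eps_minus_right)
      next
        case False
        then show ?thesis
          using B_deg[OF so_epsD(2)[OF pi_so[OF g.deg[OF x]] du_deg[OF e(1)]] du_deg[OF e(2)]] by simp
      qed
      have "C (\<pi> (\<mu> (du e) (du e')) u) * (C e' * C e)
          = (\<Sum>x\<in>X. sC (B (\<pi> x (du e)) (du e')) (C (\<pi> (g.du x) u) * (C e' * C e)))"
        by (rule mu_hom) (intro lins)
      then show ?thesis
        by (simp only: sC.scale_sum_right mult_scale sC.scale_scale wt cong: sum.cong)
    qed
    then have "(\<Sum>e\<in>E. \<Sum>e'\<in>E. sC (\<epsilon> a (- d e + - d e')) (C (\<pi> (\<mu> (du e) (du e')) u) * (C e' * C e)))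
      = (\<Sum>e\<in>E. \<Sum>e'\<in>E. \<Sum>x\<in>X. sC (\<epsilon> (dx x) a) (C (\<pi> (g.du x) u) * (sC (B (\<pi> x (du e)) (du e')) (C e') * C e)))"
      by simp
    also have "\<dots> = (\<Sum>x\<in>X. \<Sum>e\<in>E. \<Sum>e'\<in>E. sC (\<epsilon> (dx x) a) (C (\<pi> (g.du x) u) * (sC (B (\<pi> x (du e)) (du e')) (C e') * C e)))"
      by (rule sum_rotate)
    also have "\<dots> = (\<Sum>x\<in>X. sC (\<epsilon> (dx x) a) (C (\<pi> (g.du x) u) * S (\<pi> x)))"
      unfolding sC.scale_sum_right[symmetric] sum_distrib_left[symmetric] sum_distrib_right[symmetric]
        expand[OF C_lin] S_def ..
    finally show ?thesis .
  qed
  \<comment> \<open>The commutator of \<open>S (\<pi> (g.du x))\<close> with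
    \<open>C (\<pi> x u)\<close> accounts for the Casimir term; the reordered product is brought
    back to the shape of \<open>1\<close> by exchanging \<open>x\<close> with its dual.\<close>
  have flip: "?P = (\<Sum>x\<in>X. sC (\<epsilon> (dx x) a) (C (\<pi> (g.du x) u) * S (\<pi> x))) + sC 4 (C (Cas u))"
  proof -
    have "S (\<pi> (g.du x)) * C (\<pi> x u)
        = sC (\<epsilon> a (dx x) * \<epsilon> (dx x) (dx x)) (C (\<pi> x u) * S (\<pi> (g.du x))) + sC 4 (C (\<pi> (g.du x) (\<pi> x u)))"
      if x: "x \<in> X" for x
      using S_commutator_C[OF pi_so[OF g.du_deg[OF x]] so_epsD(2)[OF pi_so[OF g.deg[OF x]] u]]
      by (simp add: eps_simps mult.commute)
    then have "?P = (\<Sum>x\<in>X. sC (\<epsilon> a (dx x) * \<epsilon> (dx x) (dx x)) (C (\<pi> x u) * S (\<pi> (g.du x))))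
        + sC 4 (C (Cas u))"
      by (simp add: sum.distrib Cas_def lin_sumD[OF C_lin] sC.scale_sum_right)
    also have "(\<Sum>x\<in>X. sC (\<epsilon> a (dx x) * \<epsilon> (dx x) (dx x)) (C (\<pi> x u) * S (\<pi> (g.du x))))
        = (\<Sum>x\<in>X. sC (\<epsilon> a (- dx x)) (C (\<pi> (g.du x) u) * S (\<pi> x)))"
      by (rule g.flip_weighted) (intro bilinear_mapI lins S_pi_lin)
    finally show ?thesis
      by (simp add: eps_minus_right)
  qed
  have 2: "(\<Sum>e\<in>E. \<Sum>e'\<in>E. C (\<pi> (\<mu> u (du e)) (du e')) * (C e' * C e)) = ?P"
  proof -
    have "(\<Sum>e\<in>E. \<Sum>e'\<in>E. C (\<pi> (\<mu> u (du e)) (du e')) * (C e' * C e)) = (\<Sum>e\<in>E. S (\<pi> (\<mu> u (du e))) * C e)"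
      by (simp add: S_def sum_distrib_right mult.assoc)
    also have "\<dots> = (\<Sum>e\<in>E. \<Sum>x\<in>X. sC (B (\<pi> x u) (du e)) (S (\<pi> (g.du x)) * C e))"
      by (intro sum.cong refl mu_hom) (intro lins S_pi_lin)
    also have "\<dots> = (\<Sum>x\<in>X. \<Sum>e\<in>E. sC (B (\<pi> x u) (du e)) (S (\<pi> (g.du x)) * C e))"
      by (rule sum.swap)
    also have "\<dots> = ?P"
      by (intro sum.cong refl expand) (intro lins)
    finally show ?thesis .
  qed
  \<comment> \<open>Reordering \<open>C e' * C e\<close> gives minus the sum in \<open>2\<close>
    with its indices renamed, and a contraction in which both remaining sums collapse to
    \<open>C (Cas u)\<close>.\<close>
  have 3: "(\<Sum>e\<in>E. \<Sum>e'\<in>E. sC (\<epsilon> (- d e) (- d e')) (C (\<pi> (\<mu> u (du e')) (du e)) * (C e' * C e)))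
      = sC 2 (C (Cas u)) - ?P"
  proof -
    have "sC (\<epsilon> (- d e) (- d e')) (C (\<pi> (\<mu> u (du e')) (du e)) * (C e' * C e))
        = sC 2 (sC (B e e') (C (\<pi> (\<mu> u (du e')) (du e)))) - C (\<pi> (\<mu> u (du e')) (du e)) * (C e * C e')"
      if e: "e \<in> E" "e' \<in> E" for e e'
    proof -
      have "\<epsilon> (- d e) (- d e') * B e' e = B e e'"
        using B_sym[OF deg[OF e(1)] deg[OF e(2)]] by (simp add: eps_simps)
      then have "\<epsilon> (- d e) (- d e') * (2 * B e' e) = 2 * B e e'"
        by simp
      moreover have "\<epsilon> (- d e) (- d e') * \<epsilon> (d e') (d e) = 1"
        by (simp add: eps_simps)
      ultimately show ?thesis
        unfolding C_rel[OF deg[OF e(2)] deg[OF e(1)]] by (simp add: scale_simps)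
    qed
    then have "(\<Sum>e\<in>E. \<Sum>e'\<in>E. sC (\<epsilon> (- d e) (- d e')) (C (\<pi> (\<mu> u (du e')) (du e)) * (C e' * C e)))
      = (\<Sum>e\<in>E. \<Sum>e'\<in>E. sC 2 (sC (B e e') (C (\<pi> (\<mu> u (du e')) (du e)))))
        - (\<Sum>e\<in>E. \<Sum>e'\<in>E. C (\<pi> (\<mu> u (du e')) (du e)) * (C e * C e'))"
      by (simp add: sum_subtractf)
    also have "(\<Sum>e\<in>E. \<Sum>e'\<in>E. C (\<pi> (\<mu> u (du e')) (du e)) * (C e * C e')) = ?P"
      by (subst sum.swap) (rule 2)
    also have "(\<Sum>e\<in>E. \<Sum>e'\<in>E. sC 2 (sC (B e e') (C (\<pi> (\<mu> u (du e')) (du e)))))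
        = sC 2 (\<Sum>e'\<in>E. \<Sum>e\<in>E. sC (B e e') (C (\<pi> (\<mu> u (du e')) (du e))))"
      unfolding sC.scale_sum_right by (rule sum.swap)
    also have "(\<Sum>e'\<in>E. \<Sum>e\<in>E. sC (B e e') (C (\<pi> (\<mu> u (du e')) (du e)))) = (\<Sum>e'\<in>E. C (\<pi> (\<mu> u (du e')) e'))"
      by (intro sum.cong refl expand_dual) (intro lins)
    also have "\<dots> = (\<Sum>e'\<in>E. \<Sum>x\<in>X. sC (B (\<pi> x u) (du e')) (C (\<pi> (g.du x) e')))"
      by (intro sum.cong refl mu_hom) (intro lins)
    also have "\<dots> = (\<Sum>x\<in>X. \<Sum>e'\<in>E. sC (B (\<pi> x u) (du e')) (C (\<pi> (g.du x) e')))"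
      by (rule sum.swap)
    also have "\<dots> = (\<Sum>x\<in>X. C (\<pi> (g.du x) (\<pi> x u)))"
      by (intro sum.cong refl expand) (intro lins)
    finally show ?thesis
      by (simp add: Cas_def lin_sumD[OF C_lin])
  qed
  have "(\<Sum>e\<in>E. \<Sum>e'\<in>E.
    C (\<phi> u (\<phi> (du e) (du e')) - \<phi> (\<phi> u (du e)) (du e') - s (\<epsilon> a (- d e)) (\<phi> (du e) (\<phi> u (du e'))))
      * (C e' * C e)) = (\<Sum>e\<in>E. \<Sum>e'\<in>E. sC (\<epsilon> a (- d e + - d e')) (C (\<pi> (\<mu> (du e) (du e')) u) * (C e' * C e))
      + C (\<pi> (\<mu> u (du e)) (du e')) * (C e' * C e)
      - sC (\<epsilon> (- d e) (- d e')) (C (\<pi> (\<mu> u (du e')) (du e)) * (C e' * C e)))"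
    by (intro sum.cong refl) (simp only: jacobi[OF u du_deg du_deg] lin_diffD[OF C_lin] lin_addD[OF C_lin]
      lin_scaleD[OF C_lin] mult_scale left_diff_distrib distrib_right)
  also have "\<dots> = (\<Sum>x\<in>X. sC (\<epsilon> (dx x) a) (C (\<pi> (g.du x) u) * S (\<pi> x))) + ?P - (sC 2 (C (Cas u)) - ?P)"
    unfolding sum.distrib sum_subtractf 1 2 3 ..
  also have "\<dots> = ?P - sC 4 (C (Cas u)) + ?P - (sC 2 (C (Cas u)) - ?P)"
    using flip by simp
  also have "\<dots> = (?P + ?P + ?P) - (sC 2 (C (Cas u)) + sC 4 (C (Cas u)))"
    by simp
  also have "?P + ?P + ?P = sC 3 ?P"
    using sC.scale_left_distrib[of 1 1 ?P] sC.scale_left_distrib[of 2 1 ?P] by simp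
  also have "sC 2 (C (Cas u)) + sC 4 (C (Cas u)) = sC 6 (C (Cas u))"
    by (simp flip: sC.scale_left_distrib)
  finally show ?thesis
    by (simp add: Z_def)
qed

text \<open>First evaluation of this contraction: the first half of \<open>Z\<close> folds into
  \<open>R\<close>, the second into the scalar \<open>S Cas\<close>. The second evaluation is
  \<open>sum_Z'\<close>.\<close>

lemma sum_Z: "(\<Sum>e\<in>E. Z (du e) * C e) = sC 3 R - sC (6 * (\<Sum>e\<in>E. B (Cas (du e)) e)) 1"
proof -
  have "(\<Sum>e\<in>E. (\<Sum>x\<in>X. S (\<pi> (g.du x)) * C (\<pi> x (du e))) * C e)
      = (\<Sum>x\<in>X. \<Sum>e\<in>E. S (\<pi> (g.du x)) * C (\<pi> x (du e)) * C e)"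
    unfolding sum_distrib_right by (rule sum.swap)
  also have "\<dots> = R"
    by (simp add: R_def S_def[of "\<pi> x" for x] sum_distrib_left mult.assoc)
  finally show ?thesis
    using S_Cas unfolding Z_def left_diff_distrib sum_subtractf mult_scale sC.scale_sum_right[symmetric]
    by (simp add: S_def)
qed

section \<open>A second evaluation of the same contraction, through nested products of
  \<open>\<phi>\<close>\<close>

definition Q :: 'c where
  "Q = (\<Sum>e\<in>E. S (\<phi> (du e)) * S (\<phi> e))"

text \<open>The counterpart of \<open>Q_cubic\<close> with \<open>\<phi>\<close> nested in its
  second argument.\<close>

definition N :: 'c where
  "N = (\<Sum>a\<in>E. \<Sum>b\<in>E. \<Sum>c\<in>E. C (\<phi> (du a) (\<phi> (du b) (du c))) * (C c * (C b * C a)))"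

text \<open>Antisymmetry makes \<open>\<phi> (du b)\<close> act on the index \<open>e\<close>, and
  \<open>so_adjoint\<close> transports it to \<open>du e\<close>, where it nests inside the other
  \<open>\<phi>\<close>. The two signs cancel.\<close>

lemma Q_cubic: "Q = (\<Sum>a\<in>E. \<Sum>b\<in>E. \<Sum>c\<in>E. C (\<phi> (\<phi> (du a) (du b)) (du c)) * (C c * (C b * C a)))"
proof -
  have bil: "bilinear_map s s sC (\<lambda>p q. S (\<phi> p) * (C q * C b))" for b
    by (intro bilinear_mapI lins S_phi_lin)
  have "Q = (\<Sum>e\<in>E. \<Sum>b\<in>E. S (\<phi> (du e)) * (C (\<phi> e (du b)) * C b))"
    by (simp add: Q_def S_def[of "\<phi> e" for e] sum_distrib_left)
  also have "\<dots> = (\<Sum>b\<in>E. \<Sum>e\<in>E. S (\<phi> (du e)) * (C (\<phi> e (du b)) * C b))"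
    by (rule sum.swap)
  also have "\<dots> = (\<Sum>b\<in>E. - (\<Sum>e\<in>E. sC (\<epsilon> (- d b) (- d e)) (S (\<phi> (du e)) * (C (\<phi> (du b) e) * C b))))"
    unfolding sum_negf[symmetric]
    by (intro sum.cong refl) (simp add: phi_anti[OF deg du_deg] eps_simps lin_minusD[OF C_lin]
        lin_scaleD[OF C_lin] mult_scale)
  also have "\<dots> = (\<Sum>b\<in>E. \<Sum>e\<in>E. S (\<phi> (\<phi> (du b) (du e))) * (C e * C b))"
    by (simp add: so_adjoint[OF bil phi_so[OF du_deg]])
  finally show ?thesis
    by (simp add: S_def sum_distrib_right mult.assoc)
qed

lemma sum_Kas: "(\<Sum>b\<in>E. \<Sum>c\<in>E. C (\<phi> (du b) (\<phi> b (du c))) * C c) = S Kas"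
proof -
  have "(\<Sum>b\<in>E. \<Sum>c\<in>E. C (\<phi> (du b) (\<phi> b (du c))) * C c) = (\<Sum>c\<in>E. \<Sum>b\<in>E. C (\<phi> (du b) (\<phi> b (du c))) * C c)"
    by (rule sum.swap)
  then show ?thesis
    by (simp add: S_def Kas_def lin_sumD[OF C_lin] sum_distrib_right)
qed

lemma contract_Kas:
  "(\<Sum>a\<in>E. \<Sum>b\<in>E. \<Sum>c\<in>E. sC (B b a) (C (\<phi> (du a) (\<phi> (du b) (du c))) * C c)) = S Kas"
proof -
  have "(\<Sum>a\<in>E. \<Sum>b\<in>E. \<Sum>c\<in>E. sC (B b a) (C (\<phi> (du a) (\<phi> (du b) (du c))) * C c))
      = (\<Sum>c\<in>E. \<Sum>a\<in>E. \<Sum>b\<in>E. sC (B b a) (C (\<phi> (du a) (\<phi> (du b) (du c))) * C c))"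
    by (rule sum_rotate)
  also have "\<dots> = (\<Sum>c\<in>E. \<Sum>a\<in>E. C (\<phi> (du a) (\<phi> a (du c))) * C c)"
    by (intro sum.cong refl expand_dual) (intro lins)
  also have "\<dots> = (\<Sum>b\<in>E. \<Sum>c\<in>E. C (\<phi> (du b) (\<phi> b (du c))) * C c)"
    by (rule sum.swap)
  finally show ?thesis by (simp only: sum_Kas)
qed

text \<open>Reordering \<open>C b * C a\<close> gives a contraction, evaluated by
  \<open>contract_Kas\<close>, and minus a sum that becomes \<open>N\<close> when \<open>a\<close>
  and \<open>b\<close> are renamed.\<close>

lemma N_swap:
  "(\<Sum>a\<in>E. \<Sum>b\<in>E. \<Sum>c\<in>E. sC (\<epsilon> (- d a) (- d b)) (C (\<phi> (du b) (\<phi> (du a) (du c))) * (C c * (C b * C a))))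
    = sC 2 (S Kas) - N"
proof -
  let ?w = "\<lambda>a b c. C (\<phi> (du b) (\<phi> (du a) (du c)))"
  have summand: "sC (\<epsilon> (- d a) (- d b)) (?w a b c * (C c * (C b * C a)))
      = sC 2 (sC (B a b) (?w a b c * C c)) - ?w a b c * (C c * (C a * C b))"
    if e: "a \<in> E" "b \<in> E" for a b c
  proof -
    have "\<epsilon> (- d a) (- d b) * B b a = B a b"
      using B_sym[OF deg[OF e(1)] deg[OF e(2)]] by (simp add: eps_simps)
    then have "\<epsilon> (- d a) (- d b) * (2 * B b a) = 2 * B a b"
      by simp
    moreover have "\<epsilon> (- d a) (- d b) * \<epsilon> (d b) (d a) = 1"
      by (simp add: eps_simps)
    ultimately show ?thesis
      unfolding C_rel[OF deg[OF e(2)] deg[OF e(1)]] by (simp add: scale_simps)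
  qed
  have "(\<Sum>a\<in>E. \<Sum>b\<in>E. \<Sum>c\<in>E. sC (\<epsilon> (- d a) (- d b)) (?w a b c * (C c * (C b * C a))))
      = sC 2 (\<Sum>a\<in>E. \<Sum>b\<in>E. \<Sum>c\<in>E. sC (B a b) (?w a b c * C c))
        - (\<Sum>a\<in>E. \<Sum>b\<in>E. \<Sum>c\<in>E. ?w a b c * (C c * (C a * C b)))"
    unfolding sC.scale_sum_right sum_subtractf[symmetric] by (intro sum.cong refl summand)
  also have "(\<Sum>a\<in>E. \<Sum>b\<in>E. \<Sum>c\<in>E. ?w a b c * (C c * (C a * C b))) = N"
    unfolding N_def by (rule sum.swap)
  also have "(\<Sum>a\<in>E. \<Sum>b\<in>E. \<Sum>c\<in>E. sC (B a b) (?w a b c * C c))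
      = (\<Sum>b\<in>E. \<Sum>a\<in>E. \<Sum>c\<in>E. sC (B a b) (?w a b c * C c))"
    by (rule sum.swap)
  also have "\<dots> = S Kas"
    by (rule contract_Kas)
  finally show ?thesis .
qed

text \<open>\<open>C a\<close> is moved to the front of the Clifford word, a cyclic permutation.
  Each of the two contractions on the way gives twice \<open>S Kas\<close>, and antisymmetry of the
  outer \<open>\<phi>\<close> turns what is left into minus the summand of \<open>Q_cubic\<close>
  with rotated indices.\<close>

lemma N_eq: "N = sC 4 (S Kas) - Q"
proof -
  let ?w = "\<lambda>a b c. C (\<phi> (du a) (\<phi> (du b) (du c)))"
  have summand: "?w a b c * (C c * (C b * C a))
      = sC 2 (sC (B b a) (?w a b c * C c)) + sC 2 (sC (B c a) (?w a c b * C b))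
        - C (\<phi> (\<phi> (du b) (du c)) (du a)) * (C a * (C c * C b))"
    if e: "a \<in> E" "b \<in> E" "c \<in> E" for a b c
  proof -
    have bc: "\<phi> (du b) (du c) \<in> G (- d b + - d c)"
      by (intro phi_deg du_deg e)
    have 1: "?w a b c = - sC (\<epsilon> (- d a) (- d b + - d c)) (C (\<phi> (\<phi> (du b) (du c)) (du a)))"
      by (simp only: phi_anti[OF du_deg[OF e(1)] bc] lin_minusD[OF C_lin] lin_scaleD[OF C_lin])
    have 2: "?w a b c = - sC (\<epsilon> (- d b) (- d c)) (?w a c b)"
      by (simp add: phi_anti[OF du_deg[OF e(2)] du_deg[OF e(3)]] lin_minusD[OF C_lin] lin_scaleD[OF C_lin]
          lin_minusD[OF phi_lin(1)] lin_scaleD[OF phi_lin(1)])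
    \<comment> \<open>The form forces \<open>d a = - d c\<close>, which makes the two commutation
      factors inverse to each other.\<close>
    have "\<epsilon> (d b) (d a) * B c a * \<epsilon> (- d b) (- d c) = B c a"
    proof (cases "d c + d a = 0")
      case True
      then have "d a = - d c"
        by (metis eq_neg_iff_add_eq_0 add.commute)
      then show ?thesis by (simp add: eps_simps mult_ac)
    next
      case False
      then show ?thesis using B_deg[OF deg[OF e(3)] deg[OF e(1)]] by simp
    qed
    then have 3: "sC (\<epsilon> (d b) (d a) * B c a) (?w a b c) = - sC (B c a) (?w a c b)"
      unfolding 2 by simp
    have "\<epsilon> (d b) (d a) * \<epsilon> (d c) (d a) * \<epsilon> (- d a) (- d b + - d c) = 1"
      using eps_inv[of "d a" "d b"] eps_inv[of "d a" "d c"] unfolding eps_simps by algebra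
    then have 4: "sC (\<epsilon> (d b) (d a) * \<epsilon> (d c) (d a)) (?w a b c) = - C (\<phi> (\<phi> (du b) (du c)) (du a))"
      unfolding 1 by simp
    have "C c * (C b * C a) = sC (2 * B b a) (C c) - sC (\<epsilon> (d b) (d a)) ((C c * C a) * C b)"
      by (simp add: C_rel[OF deg[OF e(2)] deg[OF e(1)]] scale_simps)
    also have "C c * C a = sC (2 * B c a) 1 - sC (\<epsilon> (d c) (d a)) (C a * C c)"
      by (rule C_rel[OF deg[OF e(3)] deg[OF e(1)]])
    finally have "?w a b c * (C c * (C b * C a)) = sC 2 (sC (B b a) (?w a b c * C c))
        - sC 2 (sC (\<epsilon> (d b) (d a) * B c a) (?w a b c) * C b)
        + sC (\<epsilon> (d b) (d a) * \<epsilon> (d c) (d a)) (?w a b c) * (C a * (C c * C b))"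
      by (simp add: scale_simps mult_ac)
    then show ?thesis
      unfolding 3 4 by (simp add: mult_scale)
  qed
  have "N = sC 2 (\<Sum>a\<in>E. \<Sum>b\<in>E. \<Sum>c\<in>E. sC (B b a) (?w a b c * C c))
      + sC 2 (\<Sum>a\<in>E. \<Sum>b\<in>E. \<Sum>c\<in>E. sC (B c a) (?w a c b * C b))
      - (\<Sum>a\<in>E. \<Sum>b\<in>E. \<Sum>c\<in>E. C (\<phi> (\<phi> (du b) (du c)) (du a)) * (C a * (C c * C b)))"
    unfolding N_def sC.scale_sum_right sum.distrib[symmetric] sum_subtractf[symmetric]
    by (intro sum.cong refl summand)
  also have "(\<Sum>a\<in>E. \<Sum>b\<in>E. \<Sum>c\<in>E. sC (B c a) (?w a c b * C b))
      = (\<Sum>a\<in>E. \<Sum>c\<in>E. \<Sum>b\<in>E. sC (B c a) (?w a c b * C b))"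
    by (intro sum.cong refl sum.swap)
  also have "\<dots> = S Kas"
    by (rule contract_Kas)
  also have "(\<Sum>a\<in>E. \<Sum>b\<in>E. \<Sum>c\<in>E. C (\<phi> (\<phi> (du b) (du c)) (du a)) * (C a * (C c * C b))) = Q"
    unfolding Q_cubic by (rule sum_rotate[symmetric])
  finally show ?thesis
    by (simp add: contract_Kas flip: sC.scale_left_distrib)
qed

text \<open>Here \<open>jacobi_sum\<close> is read from right to left: its three terms contract to
  \<open>N\<close>, \<open>Q\<close> and the sum in \<open>N_swap\<close>, and \<open>N_eq\<close>
  eliminates \<open>N\<close>.\<close>

lemma sum_Z': "(\<Sum>e\<in>E. Z (du e) * C e) = sC 6 (S Kas) - sC 3 Q"
proof -
  have "(\<Sum>e\<in>E. Z (du e) * C e) = (\<Sum>a\<in>E. \<Sum>b\<in>E. \<Sum>c\<in>E.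
      C (\<phi> (du a) (\<phi> (du b) (du c))) * (C c * (C b * C a))
      - C (\<phi> (\<phi> (du a) (du b)) (du c)) * (C c * (C b * C a))
      - sC (\<epsilon> (- d a) (- d b)) (C (\<phi> (du b) (\<phi> (du a) (du c))) * (C c * (C b * C a))))"
    by (simp add: jacobi_sum[OF du_deg, symmetric] sum_distrib_right lin_diffD[OF C_lin]
        lin_scaleD[OF C_lin] mult_scale left_diff_distrib mult.assoc)
  also have "\<dots> = N - Q - (sC 2 (S Kas) - N)"
    unfolding sum_subtractf N_swap N_def[symmetric] Q_cubic[symmetric] ..
  also have "\<dots> = sC 6 (S Kas) - sC 3 Q"
  proof -
    have "sC 6 (S Kas) = sC 4 (S Kas) + sC 4 (S Kas) - sC 2 (S Kas)"
      by (simp flip: sC.scale_left_distrib sC.scale_left_diff_distrib)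
    moreover have "sC 3 Q = Q + Q + Q"
      using sC.scale_left_distrib[of 1 1 Q] sC.scale_left_distrib[of 2 1 Q] by simp
    ultimately show ?thesis
      by (simp add: N_eq)
  qed
  finally show ?thesis .
qed

text \<open>Comparing \<open>sum_Z\<close> with \<open>sum_Z'\<close> and dividing by 3 expresses
  \<open>Q\<close> through \<open>R\<close> and the two traces. Twice \<open>Psi * Psi\<close> is
  the anticommutator of \<open>Psi\<close> with its own expansion, which equals 6 \<open>Q\<close>
  minus 4 times the sum in \<open>sum_Z\<close>. In terms of \<open>\<psi>\<close>, that is after
  division by 144, \<open>R\<close> enters as the image of the Casimir element.\<close>

lemma Psi_square:
  "Psi * Psi = sC (18 * (\<Sum>e\<in>E. B (Cas (du e)) e) + 6 * (\<Sum>e\<in>E. B (Kas (du e)) e)) 1 - sC 9 R"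
proof -
  let ?t = "\<Sum>e\<in>E. B (Cas (du e)) e" and ?k = "\<Sum>e\<in>E. B (Kas (du e)) e"
  have "sC 3 Q = sC 6 (S Kas) - (sC 3 R - sC (6 * ?t) 1)"
    using sum_Z sum_Z' by (simp add: algebra_simps)
  also have "\<dots> = sC 3 (sC (2 * ?k + 2 * ?t) 1 - R)"
    by (simp add: S_Kas algebra_simps)
  finally have Q: "Q = sC (2 * ?k + 2 * ?t) 1 - R"
    using three sC.scale_left_imp_eq by blast
  \<comment> \<open>Commuting \<open>Psi\<close> past \<open>S (\<phi> (du e))\<close> costs the
    \<open>Z\<close> term; what remains is \<open>S (\<phi> (du e))\<close> times the anticommutator
    of \<open>Psi\<close> with \<open>C e\<close>.\<close>
  have "Psi * (S (\<phi> (du e)) * C e) + S (\<phi> (du e)) * C e * Psi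
      = sC 6 (S (\<phi> (du e)) * S (\<phi> e)) - sC 4 (Z (du e) * C e)" if e: "e \<in> E" for e
  proof -
    have "Psi * S (\<phi> (du e)) = S (\<phi> (du e)) * Psi - sC 4 (Z (du e))"
      using S_commutator_Psi[OF phi_so[OF du_deg[OF e]]] jacobi_sum[OF du_deg[OF e]] by simp
    then have "Psi * (S (\<phi> (du e)) * C e) = S (\<phi> (du e)) * (Psi * C e) - sC 4 (Z (du e) * C e)"
      by (simp add: mult_scale left_diff_distrib flip: mult.assoc)
    moreover have "Psi * C e = sC 6 (S (\<phi> e)) - C e * Psi"
      using Psi_anticommutator[OF deg[OF e]] by (simp add: algebra_simps)
    ultimately show ?thesis
      by (simp add: mult_scale right_diff_distrib mult.assoc)
  qed
  then have "(\<Sum>e\<in>E. Psi * (S (\<phi> (du e)) * C e)) + (\<Sum>e\<in>E. S (\<phi> (du e)) * C e * Psi)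
      = sC 6 Q - sC 4 (sC 3 R - sC (6 * ?t) 1)"
    unfolding sum.distrib[symmetric] sum_Z[symmetric] Q_def sC.scale_sum_right sum_subtractf[symmetric]
    by (intro sum.cong refl)
  then have "Psi * Psi + Psi * Psi = sC 6 Q - sC 4 (sC 3 R - sC (6 * ?t) 1)"
    unfolding sum_distrib_left[symmetric] sum_distrib_right[symmetric] Psi_def[symmetric] .
  also have "\<dots> = sC 2 (sC (18 * ?t + 6 * ?k) 1 - sC 9 R)"
  proof -
    have "sC 6 Q - sC 4 (sC 3 R - sC (6 * ?t) 1)
        = sC (12 * ?k) 1 + (sC (12 * ?t) 1 + sC (24 * ?t) 1) - (sC 6 R + sC 12 R)"
      by (simp add: Q algebra_simps)
    also have "sC (12 * ?t) 1 + sC (24 * ?t) 1 = sC (36 * ?t) 1"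
      by (subst sC.scale_left_distrib[symmetric]) simp
    also have "sC 6 R + sC 12 R = sC 18 R"
      by (subst sC.scale_left_distrib[symmetric]) simp
    finally show ?thesis
      by (simp add: algebra_simps)
  qed
  finally have "sC 2 (Psi * Psi) = sC 2 (sC (18 * ?t + 6 * ?k) 1 - sC 9 R)"
    using sC.scale_left_distrib[of 1 1 "Psi * Psi"] by simp
  then show ?thesis
    using two sC.scale_left_imp_eq by blast
qed

lemma B_phi:
  assumes v: "v \<in> G a" and u: "u \<in> G b"
  shows "B v (\<phi> u w) = B (\<phi> v u) w"
  using so_epsD(3)[OF phi_so[OF u] v, of w] eps_inv[of a b]
  by (simp add: phi_anti[OF v u] lin_minusD[OF B_lin(2)] lin_scaleD[OF B_lin(2)])

text \<open>Invariance of the form turns the coefficient into the pairing of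
  \<open>\<phi> (du a) (du b)\<close> with \<open>du c\<close>, so the sum over \<open>c\<close> is
  a basis expansion.\<close>

lemma cubic_term_Psi: "cubic_term sC C B \<phi> E = sC (1 / 12) Psi"
proof -
  have "(\<Sum>c\<in>E. sC (B (du a) (\<phi> (du b) (du c))) (C c * C b * C a)) = C (\<phi> (du a) (du b)) * C b * C a"
    if "a \<in> E" "b \<in> E" for a b
    unfolding B_phi[OF du_deg[OF that(1)] du_deg[OF that(2)]] by (rule expand) (intro lins)
  then show ?thesis
    by (simp add: cubic_term_def Psi_def S_def sum_distrib_right)
qed

end

section \<open>The square of the Dirac operator\<close>

text \<open>\<open>Xg\<close> and \<open>XV\<close> stand for \<open>x \<otimes> 1\<close> with
  \<open>x\<close> in \<open>\<g>\<close> and in \<open>V\<close>, and \<open>T\<close> for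
  \<open>1 \<otimes> c\<close>. Exchanging a Clifford vector with one of them costs
  \<open>\<epsilon>\<close> but no sign, since the enveloping algebra is even.\<close>

locale dirac_form = colour_lie_form \<epsilon> s G B E d sC C sg Gg Bg X dx \<pi> \<phi> \<mu>
  for \<epsilon> :: "'a::ab_group_add \<Rightarrow> 'a \<Rightarrow> 'k::field"
    and s :: "'k \<Rightarrow> 'v::ab_group_add \<Rightarrow> 'v" and G B E d
    and sC :: "'k \<Rightarrow> 'c::ring_1 \<Rightarrow> 'c" and C
    and sg :: "'k \<Rightarrow> 'g::ab_group_add \<Rightarrow> 'g" and Gg Bg X dx \<pi> \<phi> \<mu> +
  fixes br :: "'g \<Rightarrow> 'g \<Rightarrow> 'g"
    and sW :: "'k \<Rightarrow> 'w::ring_1 \<Rightarrow> 'w" and Xg :: "'g \<Rightarrow> 'w" and XV :: "'v \<Rightarrow> 'w" and T :: "'c \<Rightarrow> 'w"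
  assumes algW: "algebra_over sW"
    and pi_br: "x \<in> Gg a \<Longrightarrow> y \<in> Gg b \<Longrightarrow> \<pi> (br x y) v = \<pi> x (\<pi> y v) - s (\<epsilon> a b) (\<pi> y (\<pi> x v))"
    and Xg_lin: "lin sg sW Xg" and XV_lin: "lin s sW XV" and T_lin: "lin sC sW T"
    and T_one: "T 1 = 1" and T_mult: "T (p * q) = T p * T q"
    and Xg_Xg: "x \<in> Gg a \<Longrightarrow> y \<in> Gg b \<Longrightarrow> Xg x * Xg y = sW (\<epsilon> a b) (Xg y * Xg x) + Xg (br x y)"
    and XV_XV: "v \<in> G a \<Longrightarrow> w \<in> G b \<Longrightarrow>
      XV v * XV w = sW (\<epsilon> a b) (XV w * XV v) + Xg (\<mu> v w) + XV (\<phi> v w)"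
    and T_Xg: "v \<in> G a \<Longrightarrow> x \<in> Gg b \<Longrightarrow> T (C v) * Xg x = sW (\<epsilon> a b) (Xg x * T (C v))"
    and T_XV: "v \<in> G a \<Longrightarrow> w \<in> G b \<Longrightarrow> T (C v) * XV w = sW (\<epsilon> a b) (XV w * T (C v))"
begin

section \<open>Commuting Clifford elements past the enveloping algebra\<close>

sublocale sW: vector_space sW
  using algW by (rule algebra_over_vs)

lemma mult_scaleW: "sW c u * v = sW c (u * v)" "u * sW c v = sW c (u * v)"
  using algW unfolding algebra_over_def by metis+

lemmas linsW = lin_mult_left[OF algW] lin_mult_right[OF algW] lin_comp[OF Xg_lin] Xg_lin
  lin_comp[OF XV_lin] XV_lin lin_comp[OF T_lin] T_lin lins S_phi_lin S_pi_lin

lemma commute_mult: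
  assumes "u * x = sW p (x * u)" "v * x = sW q (x * v)"
  shows "(u * v) * x = sW (p * q) (x * (u * v))"
proof -
  have "(u * v) * x = u * (v * x)"
    by (simp only: mult.assoc)
  also have "\<dots> = sW q ((u * x) * v)"
    by (simp only: assms(2) mult_scaleW mult.assoc)
  finally show ?thesis
    by (simp add: assms(1) mult_scaleW mult_ac)
qed

text \<open>\<open>S f\<close> behaves like an element of degree \<open>a\<close>, as the degrees of
  \<open>e\<close> and \<open>du e\<close> cancel in each summand.\<close>

lemma T_S_commute:
  assumes f: "f \<in> so_eps s G \<epsilon> B a"
    and x: "\<And>c v. v \<in> G c \<Longrightarrow> T (C v) * x = sW (\<epsilon> c b) (x * T (C v))"
  shows "T (S f) * x = sW (\<epsilon> a b) (x * T (S f))"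
proof -
  have "T (C (f (du e)) * C e) * x = sW (\<epsilon> a b) (x * T (C (f (du e)) * C e))" if e: "e \<in> E" for e
  proof -
    have "\<epsilon> (a + - d e) b * \<epsilon> (d e) b = \<epsilon> a b"
      using eps_inv[of b "d e"] unfolding eps_simps by algebra
    then show ?thesis
      using commute_mult[OF x[OF so_epsD(2)[OF f du_deg[OF e]]] x[OF deg[OF e]]]
      by (simp only: T_mult)
  qed
  then show ?thesis
    by (simp add: S_def lin_sumD[OF T_lin] sum_distrib_left sum_distrib_right sW.scale_sum_right)
qed

lemma T_Psi_commute:
  assumes w: "w \<in> G b"
  shows "T Psi * XV w = XV w * T Psi"
proof -
  have "T (S (\<phi> (du e)) * C e) * XV w = XV w * T (S (\<phi> (du e)) * C e)" if e: "e \<in> E" for e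
  proof -
    have "\<epsilon> (- d e) b * \<epsilon> (d e) b = 1"
      by (simp add: eps_simps)
    then show ?thesis
      using commute_mult[OF T_S_commute[OF phi_so[OF du_deg[OF e]] T_XV[OF _ w]] T_XV[OF deg[OF e] w]]
      by (simp add: T_mult)
  qed
  then show ?thesis
    by (simp add: Psi_def lin_sumD[OF T_lin] sum_distrib_left sum_distrib_right)
qed

section \<open>The square of the Dirac operator without its cubic term\<close>

definition Dir :: 'w where
  "Dir = (\<Sum>e\<in>E. XV (du e) * T (C e))"

lemma sum_mu: "(\<Sum>e\<in>E. \<Sum>f\<in>E. Xg (\<mu> (du e) (du f)) * T (C f * C e)) = (\<Sum>x\<in>X. Xg (g.du x) * T (S (\<pi> x)))"
proof -
  have "(\<Sum>e\<in>E. \<Sum>f\<in>E. Xg (\<mu> (du e) (du f)) * T (C f * C e))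
      = (\<Sum>e\<in>E. \<Sum>f\<in>E. \<Sum>x\<in>X. sW (B (\<pi> x (du e)) (du f)) (Xg (g.du x) * T (C f * C e)))"
    by (intro sum.cong refl mu_hom) (intro linsW)
  also have "\<dots> = (\<Sum>x\<in>X. \<Sum>e\<in>E. \<Sum>f\<in>E. sW (B (\<pi> x (du e)) (du f)) (Xg (g.du x) * T (C f * C e)))"
    by (rule sum_rotate)
  also have "\<dots> = (\<Sum>x\<in>X. \<Sum>e\<in>E. Xg (g.du x) * T (C (\<pi> x (du e)) * C e))"
    by (intro sum.cong refl expand) (intro linsW)
  finally show ?thesis
    by (simp add: S_def lin_sumD[OF T_lin] sum_distrib_left)
qed

text \<open>The analogue of \<open>sum_mu\<close>: expanding \<open>\<phi> (du e) (du f)\<close> in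
  the dual basis and applying invariance (\<open>B_phi\<close>) makes \<open>\<phi> k\<close> act on
  the Clifford factor.\<close>

lemma sum_phi: "(\<Sum>e\<in>E. \<Sum>f\<in>E. XV (\<phi> (du e) (du f)) * T (C f * C e)) = (\<Sum>e\<in>E. XV (du e) * T (S (\<phi> e)))"
proof -
  have "XV (\<phi> (du e) (du f)) * T (C f * C e)
      = (\<Sum>k\<in>E. sW (B (\<phi> k (du e)) (du f)) (XV (du k) * T (C f * C e)))" if e: "e \<in> E" for e f
  proof -
    have "XV (\<phi> (du e) (du f)) * T (C f * C e)
        = (\<Sum>k\<in>E. sW (B k (\<phi> (du e) (du f))) (XV (du k) * T (C f * C e)))"
      by (rule expand_dual[symmetric]) (intro linsW)
    then show ?thesis
      by (simp add: B_phi[OF deg du_deg[OF e]])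
  qed
  then have "(\<Sum>e\<in>E. \<Sum>f\<in>E. XV (\<phi> (du e) (du f)) * T (C f * C e))
      = (\<Sum>e\<in>E. \<Sum>f\<in>E. \<Sum>k\<in>E. sW (B (\<phi> k (du e)) (du f)) (XV (du k) * T (C f * C e)))"
    by simp
  also have "\<dots> = (\<Sum>k\<in>E. \<Sum>e\<in>E. \<Sum>f\<in>E. sW (B (\<phi> k (du e)) (du f)) (XV (du k) * T (C f * C e)))"
    by (rule sum_rotate)
  also have "\<dots> = (\<Sum>k\<in>E. \<Sum>e\<in>E. XV (du k) * T (C (\<phi> k (du e)) * C e))"
    by (intro sum.cong refl expand) (intro linsW)
  finally show ?thesis
    by (simp add: S_def lin_sumD[OF T_lin] sum_distrib_left)
qed

text \<open>Reordering both tensor factors reproduces \<open>Dir * Dir\<close> with a minus sign,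
  which is why the identity is stated for its double. The Clifford contraction yields the Casimir
  sum of \<open>V\<close>, the bracket of the enveloping factors the other two sums.\<close>

lemma Dir_square:
  "sW 2 (Dir * Dir) = sW 2 (\<Sum>e\<in>E. XV (du e) * XV e)
    - (\<Sum>x\<in>X. Xg (g.du x) * T (S (\<pi> x))) - (\<Sum>e\<in>E. XV (du e) * T (S (\<phi> e)))"
proof -
  let ?h = "\<lambda>e f. sW (\<epsilon> (d f) (d e)) (XV (du e) * XV (du f) * T (C e * C f))"
  have Dir2: "Dir * Dir = (\<Sum>e\<in>E. \<Sum>f\<in>E. ?h e f)"
  proof -
    have "XV (du e) * T (C e) * (XV (du f) * T (C f)) = ?h e f" if e: "e \<in> E" "f \<in> E" for e f
    proof -
      have "XV (du e) * T (C e) * (XV (du f) * T (C f)) = XV (du e) * (T (C e) * XV (du f)) * T (C f)"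
        by (simp only: mult.assoc)
      then show ?thesis
        by (simp add: T_XV[OF deg[OF e(1)] du_deg[OF e(2)]] mult_scaleW eps_minus_right T_mult mult.assoc)
    qed
    then show ?thesis
      by (simp add: Dir_def sum_product)
  qed
  \<comment> \<open>The Clifford factors are exchanged first, then the enveloping factors; their
    commutation factors combine to the one in \<open>?h f e\<close>.\<close>
  have summand: "?h e f = sW 2 (sW (B f e) (XV (du e) * XV (du f))) - ?h f e
      - Xg (\<mu> (du e) (du f)) * T (C f * C e) - XV (\<phi> (du e) (du f)) * T (C f * C e)"
    if e: "e \<in> E" "f \<in> E" for e f
  proof -
    have B: "\<epsilon> (d f) (d e) * (2 * B e f) = 2 * B f e"
      using B_sym[OF deg[OF e(2)] deg[OF e(1)]] by simp
    have "?h e f = sW (\<epsilon> (d f) (d e) * (2 * B e f)) (XV (du e) * XV (du f))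
        - XV (du e) * XV (du f) * T (C f * C e)"
      by (simp add: C_rel[OF deg[OF e(1)] deg[OF e(2)]] lin_diffD[OF T_lin] lin_scaleD[OF T_lin] T_one
          mult_scaleW right_diff_distrib sW.scale_right_diff_distrib)
    also have "XV (du e) * XV (du f) * T (C f * C e)
        = ?h f e + Xg (\<mu> (du e) (du f)) * T (C f * C e) + XV (\<phi> (du e) (du f)) * T (C f * C e)"
      by (simp add: XV_XV[OF du_deg[OF e(1)] du_deg[OF e(2)]] eps_simps mult_scaleW distrib_right)
    finally show ?thesis
      by (simp add: B)
  qed
  have "Dir * Dir = sW 2 (\<Sum>e\<in>E. \<Sum>f\<in>E. sW (B f e) (XV (du e) * XV (du f))) - (\<Sum>e\<in>E. \<Sum>f\<in>E. ?h f e)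
      - (\<Sum>e\<in>E. \<Sum>f\<in>E. Xg (\<mu> (du e) (du f)) * T (C f * C e))
      - (\<Sum>e\<in>E. \<Sum>f\<in>E. XV (\<phi> (du e) (du f)) * T (C f * C e))"
    unfolding Dir2 sW.scale_sum_right sum_subtractf[symmetric]
    by (intro sum.cong refl summand)
  also have "(\<Sum>e\<in>E. \<Sum>f\<in>E. ?h f e) = Dir * Dir"
    unfolding Dir2 by (rule sum.swap)
  also have "(\<Sum>e\<in>E. \<Sum>f\<in>E. sW (B f e) (XV (du e) * XV (du f))) = (\<Sum>e\<in>E. XV (du e) * XV e)"
    by (intro sum.cong refl expand_dual) (intro linsW)
  finally show ?thesis
    using sW.scale_left_distrib[of 1 1 "Dir * Dir"] by (simp add: sum_mu sum_phi algebra_simps)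
qed

section \<open>The diagonal map and the completed square\<close>

definition Delta :: "'g \<Rightarrow> 'w" where
  "Delta x = Xg x + T (sC (1 / 4) (S (\<pi> x)))"

lemma four: "(4::'k) \<noteq> 0"
  using two mult_eq_0_iff[of "2::'k" 2] by simp

text \<open>This is the relation required to extend \<open>Delta\<close> to the enveloping algebra.
  The mixed terms cancel by \<open>T_S_commute\<close>, and the factor 4 of
  \<open>S_commutator\<close> turns 1/16 into the normalisation 1/4.\<close>

lemma Delta_commutator:
  assumes x: "x \<in> Gg a" and y: "y \<in> Gg b"
  shows "Delta x * Delta y = sW (\<epsilon> a b) (Delta y * Delta x) + Delta (br x y)"
proof -
  have xy: "T (S (\<pi> x)) * Xg y = sW (\<epsilon> a b) (Xg y * T (S (\<pi> x)))"
    by (rule T_S_commute[OF pi_so[OF x] T_Xg[OF _ y]])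
  have "T (S (\<pi> y)) * Xg x = sW (\<epsilon> b a) (Xg x * T (S (\<pi> y)))"
    by (rule T_S_commute[OF pi_so[OF y] T_Xg[OF _ x]])
  then have yx: "Xg x * T (S (\<pi> y)) = sW (\<epsilon> a b) (T (S (\<pi> y)) * Xg x)"
    by simp
  have "\<pi> (br x y) = (\<lambda>v. \<pi> x (\<pi> y v) - s (\<epsilon> a b) (\<pi> y (\<pi> x v)))"
    using pi_br[OF x y] by blast
  then have SS: "T (S (\<pi> x)) * T (S (\<pi> y)) = sW (\<epsilon> a b) (T (S (\<pi> y)) * T (S (\<pi> x))) + sW 4 (T (S (\<pi> (br x y))))"
    using arg_cong[OF S_commutator[OF pi_so[OF x] pi_so[OF y]],  of T]
    by (simp add: T_mult lin_addD[OF T_lin] lin_scaleD[OF T_lin])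
  have quarter: "(1 / 4 * (1 / 4)) * 4 = (1 / 4 :: 'k)"
    using four mult_eq_0_iff[of "4::'k" 4] by (simp add: field_simps)
  have "Delta x * Delta y = Xg x * Xg y + sW (1 / 4) (Xg x * T (S (\<pi> y))) + sW (1 / 4) (T (S (\<pi> x)) * Xg y)
      + sW (1 / 4 * (1 / 4)) (T (S (\<pi> x)) * T (S (\<pi> y)))"
    by (simp add: Delta_def lin_scaleD[OF T_lin] mult_scaleW distrib_left distrib_right
        sW.scale_right_distrib add_ac)
  also have "\<dots> = sW (\<epsilon> a b) (Xg y * Xg x) + Xg (br x y)
      + sW (1 / 4) (sW (\<epsilon> a b) (T (S (\<pi> y)) * Xg x)) + sW (1 / 4) (sW (\<epsilon> a b) (Xg y * T (S (\<pi> x))))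
      + (sW (1 / 4 * (1 / 4)) (sW (\<epsilon> a b) (T (S (\<pi> y)) * T (S (\<pi> x))))
        + sW (1 / 4 * (1 / 4) * 4) (T (S (\<pi> (br x y)))))"
    unfolding SS xy yx Xg_Xg[OF x y] sW.scale_right_distrib sW.scale_scale mult.assoc ..
  also have "\<dots> = sW (\<epsilon> a b) (Delta y * Delta x) + Delta (br x y)"
    unfolding quarter
    by (simp add: Delta_def lin_scaleD[OF T_lin] mult_scaleW distrib_left distrib_right
        sW.scale_right_distrib mult_ac add_ac)
  finally show ?thesis .
qed

text \<open>The two mixed sums agree after exchanging the basis with its dual, whence 1/4 +
  1/4.\<close>

lemma sum_Delta:
  "(\<Sum>x\<in>X. Delta (g.du x) * Delta x) = (\<Sum>x\<in>X. Xg (g.du x) * Xg x)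
    + sW (1 / 2) (\<Sum>x\<in>X. Xg (g.du x) * T (S (\<pi> x))) + sW (1 / 16) (T R)"
proof -
  let ?M = "\<Sum>x\<in>X. Xg (g.du x) * T (S (\<pi> x))"
  have num: "1 / 4 * (1 / 4) = (1 / 16 :: 'k)" "1 / 4 + 1 / 4 = (1 / 2 :: 'k)"
    using two four by (simp_all add: field_simps)
  have "Delta (g.du x) * Delta x = Xg (g.du x) * Xg x + sW (1 / 4) (Xg (g.du x) * T (S (\<pi> x)))
      + sW (1 / 4) (sW (\<epsilon> (dx x) (dx x)) (Xg x * T (S (\<pi> (g.du x)))))
      + sW (1 / 4 * (1 / 4)) (T (S (\<pi> (g.du x)) * S (\<pi> x)))" if x: "x \<in> X" for x
    using T_S_commute[OF pi_so[OF g.du_deg[OF x]] T_Xg[OF _ g.deg[OF x]]]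
    by (simp add: Delta_def lin_scaleD[OF T_lin] mult_scaleW T_mult distrib_left distrib_right
        sW.scale_right_distrib add_ac eps_simps)
  then have "(\<Sum>x\<in>X. Delta (g.du x) * Delta x) = (\<Sum>x\<in>X. Xg (g.du x) * Xg x) + sW (1 / 4) ?M
      + sW (1 / 4) (\<Sum>x\<in>X. sW (\<epsilon> (dx x) (dx x)) (Xg x * T (S (\<pi> (g.du x)))))
      + sW (1 / 4 * (1 / 4)) (T R)"
    by (simp only: sum.distrib sW.scale_sum_right R_def lin_sumD[OF T_lin] cong: sum.cong)
  also have "(\<Sum>x\<in>X. sW (\<epsilon> (dx x) (dx x)) (Xg x * T (S (\<pi> (g.du x))))) = ?M"
    by (rule g.flip) (intro bilinear_mapI linsW)
  also have "(\<Sum>x\<in>X. Xg (g.du x) * Xg x) + sW (1 / 4) ?M + sW (1 / 4) ?M = (\<Sum>x\<in>X. Xg (g.du x) * Xg x) + sW (1 / 2) ?M"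
    by (simp only: add.assoc sW.scale_left_distrib[symmetric] num)
  finally show ?thesis
    by (simp only: num)
qed

text \<open>The sum \<open>?F\<close> from \<open>Dir_square\<close> cancels against the
  anticommutator of \<open>Dir\<close> with \<open>T Psi\<close>. The sum \<open>?M\<close> and the
  term in \<open>T R\<close> from \<open>Psi_square\<close> are the last two terms of
  \<open>sum_Delta\<close>, up to sign.\<close>

lemma cubic_Dirac_square:
  "(Dir + T (sC (1 / 12) Psi))\<^sup>2 = (\<Sum>x\<in>X. Xg (g.du x) * Xg x) + (\<Sum>e\<in>E. XV (du e) * XV e)
    - (\<Sum>x\<in>X. Delta (g.du x) * Delta x)
    + sW (1 / 24 * (3 * (\<Sum>e\<in>E. B (Cas (du e)) e) + (\<Sum>e\<in>E. B (Kas (du e)) e))) 1"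
proof -
  let ?t = "\<Sum>e\<in>E. B (Cas (du e)) e" and ?k = "\<Sum>e\<in>E. B (Kas (du e)) e"
  let ?M = "\<Sum>x\<in>X. Xg (g.du x) * T (S (\<pi> x))" and ?F = "\<Sum>e\<in>E. XV (du e) * T (S (\<phi> e))"
  have nz: "(12::'k) \<noteq> 0" "(144::'k) \<noteq> 0" "(24::'k) \<noteq> 0" "(16::'k) \<noteq> 0"
    using two three mult_eq_0_iff[of "4::'k" 3] four mult_eq_0_iff[of "12::'k" 12]
      mult_eq_0_iff[of "12::'k" 2] mult_eq_0_iff[of "4::'k" 4] by simp_all
  have "Dir * Dir = sW (1 / 2) (sW 2 (Dir * Dir))"
    using two by simp
  also have "\<dots> = (\<Sum>e\<in>E. XV (du e) * XV e) - sW (1 / 2) ?M - sW (1 / 2) ?F"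
    unfolding Dir_square using two by (simp add: sW.scale_right_diff_distrib)
  finally have 1: "Dir * Dir = (\<Sum>e\<in>E. XV (du e) * XV e) - sW (1 / 2) ?M - sW (1 / 2) ?F" .
  have "XV (du e) * T (C e) * T Psi + T Psi * (XV (du e) * T (C e)) = sW 6 (XV (du e) * T (S (\<phi> e)))"
    if e: "e \<in> E" for e
  proof -
    have "T Psi * (XV (du e) * T (C e)) = XV (du e) * T Psi * T (C e)"
      by (simp only: T_Psi_commute[OF du_deg[OF e]] mult.assoc[symmetric])
    then have "XV (du e) * T (C e) * T Psi + T Psi * (XV (du e) * T (C e)) = XV (du e) * T (C e * Psi + Psi * C e)"
      by (simp add: T_mult lin_addD[OF T_lin] distrib_left mult.assoc)
    then show ?thesis
      by (simp add: Psi_anticommutator[OF deg[OF e]] lin_scaleD[OF T_lin] mult_scaleW)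
  qed
  then have 2: "Dir * T Psi + T Psi * Dir = sW 6 ?F"
    by (simp add: Dir_def sum_distrib_left sum_distrib_right sW.scale_sum_right flip: sum.distrib)
  have 3: "T Psi * T Psi = sW (18 * ?t + 6 * ?k) 1 - sW 9 (T R)"
    by (simp add: Psi_square lin_diffD[OF T_lin] lin_scaleD[OF T_lin] T_one flip: T_mult)
  have num: "1 / 12 * 6 = (1 / 2 :: 'k)" "1 / 12 * (1 / 12) * 9 = (1 / 16 :: 'k)"
    "1 / 12 * (1 / 12) * (18 * ?t + 6 * ?k) = 1 / 24 * (3 * ?t + ?k)"
    using nz two by (simp_all add: field_simps)
  have "(Dir + T (sC (1 / 12) Psi))\<^sup>2 = Dir * Dir + sW (1 / 12) (Dir * T Psi + T Psi * Dir)
      + sW (1 / 12 * (1 / 12)) (T Psi * T Psi)"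
    by (simp add: power2_eq_square lin_scaleD[OF T_lin] mult_scaleW distrib_left distrib_right add_ac
        sW.scale_right_distrib)
  also have "\<dots> = (\<Sum>e\<in>E. XV (du e) * XV e) - sW (1 / 2) ?M - sW (1 / 2) ?F
      + sW (1 / 12 * 6) ?F + (sW (1 / 12 * (1 / 12) * (18 * ?t + 6 * ?k)) 1 - sW (1 / 12 * (1 / 12) * 9) (T R))"
    by (simp only: 1 2 3 sW.scale_right_diff_distrib sW.scale_scale)
  finally show ?thesis
    unfolding num sum_Delta by (simp add: algebra_simps)
qed

end

section \<open>Presented algebras and tensor products\<close>

definition free_extension ::
  "('k::zero \<Rightarrow> 'z::comm_monoid_add \<Rightarrow> 'z) \<Rightarrow> ('x \<Rightarrow> 'z) \<Rightarrow> ('x \<Rightarrow>\<^sub>0 'k) \<Rightarrow> 'z" where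
  "free_extension s h p = (\<Sum>x\<in>Poly_Mapping.keys p. s (Poly_Mapping.lookup p x) (h x))"

lemma free_extension_simps:
  assumes "vector_space s"
  shows "free_extension s h (p + q) = free_extension s h p + free_extension s h q"
    and "free_extension s h (p - q) = free_extension s h p - free_extension s h q"
    and "free_extension s h (Poly_Mapping.single x c) = s c (h x)"
    and "free_extension s h 0 = 0"
proof -
  interpret vector_space s by fact
  show add: "free_extension s h (p + q) = free_extension s h p + free_extension s h q" for p q
    unfolding free_extension_def
    by (rule setsum_keys_plus_distrib[where f = "\<lambda>x c. s c (h x)"]) (simp_all add: scale_left_distrib)
  show "free_extension s h (p - q) = free_extension s h p - free_extension s h q"
    using add[of "p - q" q] by (simp add: algebra_simps)
  show "free_extension s h (Poly_Mapping.single x c) = s c (h x)"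
    by (cases "c = 0") (simp_all add: free_extension_def)
  show "free_extension s h 0 = 0"
    by (simp add: free_extension_def)
qed

lemma poly_mapping_single_induct:
  fixes p :: "'x \<Rightarrow>\<^sub>0 'b::comm_monoid_add"
  assumes "P 0" and "\<And>x c. P (Poly_Mapping.single x c)" and "\<And>p q. P p \<Longrightarrow> P q \<Longrightarrow> P (p + q)"
  shows "P p"
proof -
  have eq: "p = (\<Sum>x\<in>Poly_Mapping.keys p. Poly_Mapping.single x (Poly_Mapping.lookup p x))"
    by (rule poly_mapping_eqI)
      (auto simp: lookup_sum lookup_single when_def in_keys_iff sum.delta)
  have "P (\<Sum>x\<in>A. Poly_Mapping.single x (Poly_Mapping.lookup p x))" for A
    by (induction A rule: infinite_finite_induct) (simp_all add: assms)
  then show ?thesis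
    by (subst eq)
qed

text \<open>A word acts by composing the operators of its letters. Working with operators on a space
  serves both \<open>free_eval\<close>, where letters act by left multiplication, and the adjoint
  representation.\<close>

definition word_action ::
  "('k::zero \<Rightarrow> 'z::comm_monoid_add \<Rightarrow> 'z) \<Rightarrow> ('x \<Rightarrow> 'z \<Rightarrow> 'z) \<Rightarrow> ('x, 'k) free_algebra \<Rightarrow> 'z \<Rightarrow> 'z" where
  "word_action s \<rho> p z = free_extension s (\<lambda>w. foldr \<rho> (letters w) z) p"

lemma lin_foldr:
  assumes "vector_space s" and "\<And>x. lin s s (\<rho> x)"
  shows "lin s s (foldr \<rho> xs)"
  by (induction xs) (simp_all add: lin_ident[OF assms(1)] lin_comp[OF assms(2)] id_def comp_def)

context
  fixes s :: "'k::field \<Rightarrow> 'z::ab_group_add \<Rightarrow> 'z" and \<rho> :: "'x \<Rightarrow> 'z \<Rightarrow> 'z"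
  assumes vs: "vector_space s" and rho: "\<And>x. lin s s (\<rho> x)"
begin

lemma word_action_lin: "lin s s (word_action s \<rho> p)"
  unfolding word_action_def free_extension_def
  by (intro lin_sum vs lin_scale lin_foldr rho)

lemma word_action_simps:
  "word_action s \<rho> (p + q) z = word_action s \<rho> p z + word_action s \<rho> q z"
  "word_action s \<rho> (p - q) z = word_action s \<rho> p z - word_action s \<rho> q z"
  "word_action s \<rho> (gen x) z = \<rho> x z"
  "word_action s \<rho> (const c) z = s c z"
  "word_action s \<rho> 0 z = 0"
  "word_action s \<rho> 1 z = z"
  "word_action s \<rho> (Poly_Mapping.single w c) z = s c (foldr \<rho> (letters w) z)"
proof -
  interpret vector_space s by (rule vs)
  note simps = free_extension_simps[OF vs]
  show "word_action s \<rho> (p + q) z = word_action s \<rho> p z + word_action s \<rho> q z"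
    "word_action s \<rho> (p - q) z = word_action s \<rho> p z - word_action s \<rho> q z"
    "word_action s \<rho> (gen x) z = \<rho> x z"
    "word_action s \<rho> (const c) z = s c z"
    "word_action s \<rho> 0 z = 0"
    "word_action s \<rho> (Poly_Mapping.single w c) z = s c (foldr \<rho> (letters w) z)"
    by (simp_all add: word_action_def simps gen_def const_def zero_free_monoid_def)
  show "word_action s \<rho> 1 z = z"
    unfolding single_one[symmetric] word_action_def simps by (simp add: zero_free_monoid_def)
qed

lemma word_action_mult: "word_action s \<rho> (p * q) z = word_action s \<rho> p (word_action s \<rho> q z)"
proof (induction p rule: poly_mapping_single_induct)
  case 1
  then show ?case by (simp add: word_action_simps)
next
  case (2 w c)
  show ?case
  proof (induction q rule: poly_mapping_single_induct)
    case 1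
    then show ?case by (simp add: word_action_simps lin_zeroD[OF word_action_lin])
  next
    case (2 w' c')
    show ?case
      using vs by (simp add: mult_single word_action_simps plus_free_monoid_def lin_scaleD[OF lin_foldr[OF vs rho]]
          vector_space_def)
  next
    case (3 p q)
    then show ?case
      by (simp add: distrib_left word_action_simps lin_addD[OF word_action_lin])
  qed
next
  case (3 p q)
  then show ?case by (simp add: distrib_right word_action_simps)
qed

text \<open>The elements acting by zero form a two-sided ideal. The vector varies in the induction
  because in a product the left factor acts on the image of the right one.\<close>

lemma word_action_ideal:
  assumes "\<And>r z. r \<in> R \<Longrightarrow> word_action s \<rho> r z = 0" and "p \<in> ideal_gen R"
  shows "word_action s \<rho> p z = 0"
  using assms(2)
  by (induction arbitrary: z)
    (simp_all add: assms(1) word_action_simps word_action_mult lin_zeroD[OF word_action_lin])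

end

lemma free_eval_word_action: "free_eval s \<iota> p = word_action s (\<lambda>x z. \<iota> x * z) p 1"
proof -
  have "prod_list (map \<iota> xs) = foldr (\<lambda>x z. \<iota> x * z) xs 1" for xs
    by (induction xs) simp_all
  then show ?thesis
    by (simp add: free_eval_def word_action_def free_extension_def)
qed

lemma word_action_left_mult:
  assumes "algebra_over s"
  shows "word_action s (\<lambda>x z. \<iota> x * z) p z = free_eval s \<iota> p * z"
proof -
  have "foldr (\<lambda>x z. \<iota> x * z) xs z = foldr (\<lambda>x z. \<iota> x * z) xs 1 * z" for xs
    by (induction xs) (simp_all add: mult.assoc)
  then have "s c (foldr (\<lambda>x z. \<iota> x * z) xs z) = s c (foldr (\<lambda>x z. \<iota> x * z) xs 1) * z" for c xs
    using assms unfolding algebra_over_def by metis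
  then show ?thesis
    by (simp add: free_eval_word_action word_action_def free_extension_def sum_distrib_right)
qed

lemma left_mult_lin: "algebra_over s \<Longrightarrow> lin s s (\<lambda>z. u * z)"
  by (intro lin_mult_right lin_ident) (simp_all add: algebra_over_vs)

lemma free_eval_simps:
  assumes alg: "algebra_over s"
  shows "free_eval s \<iota> (p + q) = free_eval s \<iota> p + free_eval s \<iota> q"
    and "free_eval s \<iota> (p - q) = free_eval s \<iota> p - free_eval s \<iota> q"
    and "free_eval s \<iota> (gen x) = \<iota> x"
    and "free_eval s \<iota> (const c) = s c 1"
    and "free_eval s \<iota> 1 = 1"
    and "free_eval s \<iota> (p * q) = free_eval s \<iota> p * free_eval s \<iota> q"
  using word_action_simps[OF algebra_over_vs[OF alg], of "\<lambda>x z. \<iota> x * z", OF left_mult_lin[OF alg], where z = 1]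
    word_action_mult[OF algebra_over_vs[OF alg], of "\<lambda>x z. \<iota> x * z", OF left_mult_lin[OF alg], where z = 1]
    word_action_left_mult[OF alg]
  by (simp_all add: free_eval_word_action)

section \<open>Universal properties of presented algebras\<close>

lemma scale_one_mult: "algebra_over s \<Longrightarrow> s c 1 * u = s c u"
  unfolding algebra_over_def by (metis mult_1)

lemma presented_algebra_zero:
  assumes "presented_algebra sU \<iota> R" and "r \<in> R"
  shows "free_eval sU \<iota> r = 0"
  using assms ideal_gen.base[of r R] unfolding presented_algebra_def by blast

text \<open>An element acts through any representative in the free algebra, which is well defined
  because the ideal acts by zero. Uniqueness follows since multiplicativity fixes the values on
  words and linearity the rest. The conclusion has the form of the description in
  \<open>ad_extension\<close>.\<close>

lemma presented_algebra_action:
  fixes s :: "'k::field \<Rightarrow> 'z::ab_group_add \<Rightarrow> 'z" and sU :: "'k \<Rightarrow> 'u::ring_1 \<Rightarrow> 'u"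
  assumes pres: "presented_algebra sU \<iota> R"
    and vs: "vector_space s" and rho: "\<And>x. lin s s (\<rho> x)"
    and rels: "\<And>r z. r \<in> R \<Longrightarrow> word_action s \<rho> r z = 0"
  shows "\<exists>!A. (\<forall>x. A (\<iota> x) = \<rho> x) \<and> A 1 = id \<and> (\<forall>u v. A (u * v) = A u \<circ> A v) \<and>
        (\<forall>z. lin sU s (\<lambda>u. A u z)) \<and> (\<forall>u. lin s s (A u))"
proof -
  let ?ev = "free_eval sU \<iota>" and ?act = "word_action s \<rho>"
  have alg: "algebra_over sU" and surj: "range ?ev = UNIV" and ker: "{p. ?ev p = 0} = ideal_gen R"
    using pres by (simp_all add: presented_algebra_def)
  note act = word_action_simps[OF vs, of \<rho>, OF rho] word_action_mult[OF vs, of \<rho>, OF rho]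
  note ev = free_eval_simps[OF alg]
  define A where "A u = ?act (SOME p. ?ev p = u)" for u
  \<comment> \<open>Independence of the representative: two of them differ by an element of the
    ideal.\<close>
  have A: "A (?ev p) = ?act p" for p
  proof
    fix z
    define q where "q = (SOME q. ?ev q = ?ev p)"
    have "?ev q = ?ev p"
      unfolding q_def by (rule someI) simp
    then have mem: "q - p \<in> ideal_gen R"
      using ker ev(2)[of \<iota> q p] by auto
    have "?act (q - p) z = 0"
      by (rule word_action_ideal[OF vs rho _ mem]) (rule rels)
    then show "A (?ev p) z = ?act p z"
      by (simp add: A_def q_def act)
  qed
  have ex: "\<exists>p. u = ?ev p" for u
    using surj by (metis UNIV_I image_iff)
  show ?thesis
  proof (rule ex1I[of _ A])
    have "A (\<iota> x) = \<rho> x" for x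
      using A[of "gen x"] by (simp add: ev act fun_eq_iff)
    moreover have "A 1 = id"
      using A[of 1] by (simp add: ev act fun_eq_iff)
    moreover have "A (u * v) = A u \<circ> A v" for u v
    proof -
      obtain p q where "u = ?ev p" "v = ?ev q"
        using ex by metis
      then show ?thesis
        using A[of "p * q"] by (simp add: ev act A fun_eq_iff)
    qed
    moreover have "lin sU s (\<lambda>u. A u z)" for z
    proof -
      have "A (u + v) z = A u z + A v z" for u v
      proof -
        obtain p q where "u = ?ev p" "v = ?ev q"
          using ex by metis
        then show ?thesis
          using A[of "p + q"] by (simp add: ev act A)
      qed
      moreover have "A (sU c u) z = s c (A u z)" for c u
      proof -
        obtain p where "u = ?ev p"
          using ex by metis
        then show ?thesis
          using A[of "const c * p"] by (simp add: ev act A scale_one_mult[OF alg])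
      qed
      ultimately show ?thesis
        by (simp add: Vector_Spaces.linear_iff vs algebra_over_vs[OF alg])
    qed
    moreover have "lin s s (A u)" for u
      unfolding A_def by (rule word_action_lin[OF vs rho])
    ultimately show "(\<forall>x. A (\<iota> x) = \<rho> x) \<and> A 1 = id \<and> (\<forall>u v. A (u * v) = A u \<circ> A v) \<and>
        (\<forall>z. lin sU s (\<lambda>u. A u z)) \<and> (\<forall>u. lin s s (A u))"
      by blast
  next
    fix A' assume A': "(\<forall>x. A' (\<iota> x) = \<rho> x) \<and> A' 1 = id \<and> (\<forall>u v. A' (u * v) = A' u \<circ> A' v) \<and>
        (\<forall>z. lin sU s (\<lambda>u. A' u z)) \<and> (\<forall>u. lin s s (A' u))"
    then have lin: "lin sU s (\<lambda>u. A' u z)" for z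
      by blast
    have word: "A' (foldr (\<lambda>x z. \<iota> x * z) xs 1) = foldr \<rho> xs" for xs
      using A' by (induction xs) (simp_all add: id_def)
    have "A' (?ev p) z = ?act p z" for p z
      by (simp add: free_eval_word_action word_action_def free_extension_def lin_sumD[OF lin]
          lin_scaleD[OF lin] word)
    then show "A' = A"
      using ex A by (metis ext)
  qed
qed

text \<open>The target algebra becomes a module in which a generator \<open>x\<close> acts as left
  multiplication by \<open>f x\<close>. Applying the resulting operators to 1 gives the
  homomorphism.\<close>

lemma env_extension_hom:
  fixes sU :: "'k::field \<Rightarrow> 'u::ring_1 \<Rightarrow> 'u" and sW :: "'k \<Rightarrow> 'w::ring_1 \<Rightarrow> 'w"
  assumes pres: "presented_algebra sU \<iota> R" and alg: "algebra_over sW"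
    and rels: "\<And>r. r \<in> R \<Longrightarrow> free_eval sW f r = 0"
  shows "algebra_hom sU sW (env_extension sU \<iota> sW f)" and "env_extension sU \<iota> sW f (\<iota> x) = f x"
proof -
  have "\<exists>!F. algebra_hom sU sW F \<and> (\<forall>x. F (\<iota> x) = f x)"
  proof -
    let ?\<rho> = "\<lambda>x z. f x * z"
    have "\<exists>!A. (\<forall>x. A (\<iota> x) = ?\<rho> x) \<and> A 1 = id \<and> (\<forall>u v. A (u * v) = A u \<circ> A v) \<and>
        (\<forall>z. lin sU sW (\<lambda>u. A u z)) \<and> (\<forall>u. lin sW sW (A u))"
    proof (rule presented_algebra_action[OF pres algebra_over_vs[OF alg]])
      show "lin sW sW (?\<rho> x)" for x
        by (rule left_mult_lin[OF alg])
      show "word_action sW ?\<rho> r z = 0" if "r \<in> R" for r z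
        using that by (simp add: word_action_left_mult[OF alg] rels)
    qed
    then obtain A where conj: "(\<forall>x. A (\<iota> x) = ?\<rho> x) \<and> A 1 = id \<and> (\<forall>u v. A (u * v) = A u \<circ> A v) \<and>
        (\<forall>z. lin sU sW (\<lambda>u. A u z)) \<and> (\<forall>u. lin sW sW (A u))"
      by (elim ex1E)
    have A: "A (\<iota> x) = ?\<rho> x" "A 1 = id" "A (u * v) = A u \<circ> A v" "lin sU sW (\<lambda>u. A u z)" for x u v z
      using conj by simp_all
    have surj: "range (free_eval sU \<iota>) = UNIV"
      using pres by (simp add: presented_algebra_def)
    have word: "A (foldr (\<lambda>x z. \<iota> x * z) xs 1) = foldr ?\<rho> xs" for xs
      by (induction xs) (simp_all add: A fun_eq_iff)
    have "A (free_eval sU \<iota> p) z = word_action sW ?\<rho> p z" for p z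
      by (simp add: free_eval_word_action word_action_def free_extension_def lin_sumD[OF A(4)]
          lin_scaleD[OF A(4)] word)
    then have ev: "A (free_eval sU \<iota> p) z = free_eval sW f p * z" for p z
      by (simp add: word_action_left_mult[OF alg])
    have ex: "\<exists>p. u = free_eval sU \<iota> p" for u
      using surj by blast
    \<comment> \<open>Every operator is itself a left multiplication, which makes evaluation at 1
      multiplicative.\<close>
    have left: "A u z = A u 1 * z" for u z
      using ex[of u] by (auto simp: ev)
    show ?thesis
    proof (rule ex1I[of _ "\<lambda>u. A u 1"])
      have "A (u * v) 1 = A u 1 * A v 1" for u v
        using left[of u "A v 1"] by (simp add: A(3))
      then show "algebra_hom sU sW (\<lambda>u. A u 1) \<and> (\<forall>x. A (\<iota> x) 1 = f x)"
        by (simp add: algebra_hom_def A(1,2,4))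
    next
      fix F assume F: "algebra_hom sU sW F \<and> (\<forall>x. F (\<iota> x) = f x)"
      then have lin: "lin sU sW F"
        by (simp add: algebra_hom_def)
      have "F (foldr (\<lambda>x z. \<iota> x * z) xs 1) = foldr ?\<rho> xs 1" for xs
        using F by (induction xs) (simp_all add: algebra_hom_def)
      then have "F (free_eval sU \<iota> p) = free_eval sW f p" for p
        by (simp add: free_eval_word_action word_action_def free_extension_def lin_sumD[OF lin]
            lin_scaleD[OF lin])
      then have "F u = A u 1" for u
        using ex[of u] by (auto simp: ev)
      then show "F = (\<lambda>u. A u 1)" ..
    qed
  qed
  from theI'[OF this] show "algebra_hom sU sW (env_extension sU \<iota> sW f)"
    "env_extension sU \<iota> sW f (\<iota> x) = f x"
    unfolding env_extension_def by auto
qed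

lemma lookup_free_scale: "Poly_Mapping.lookup (free_scale c p) x = c * Poly_Mapping.lookup p x"
  unfolding free_scale_def by transfer (simp add: when_def)

lemma free_scale_single: "free_scale c (Poly_Mapping.single x b) = Poly_Mapping.single x (c * b)"
  by (rule poly_mapping_eqI) (simp add: lookup_free_scale lookup_single when_def)

lemma module_free_scale: "module (free_scale :: 'k::field \<Rightarrow> ('x \<Rightarrow>\<^sub>0 'k) \<Rightarrow> _)"
  by standard (auto intro!: poly_mapping_eqI simp: lookup_free_scale lookup_add algebra_simps)

lemma tensor_product_bilinear:
  fixes s1 :: "'a::field \<Rightarrow> 'b::ab_group_add \<Rightarrow> 'b" and s2 :: "'a \<Rightarrow> 'c::ab_group_add \<Rightarrow> 'c"
    and s3 :: "'a \<Rightarrow> 'd::ab_group_add \<Rightarrow> 'd"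
  assumes vs1: "vector_space s1" and vs2: "vector_space s2" and tp: "tensor_product s1 s2 s3 t"
  shows "bilinear_map s1 s2 s3 t"
proof -
  have vs3: "vector_space s3" and ker: "{p. tensor_eval s3 t p = 0} = module.span free_scale (bilinearity_rels s1 s2)"
    using tp by (simp_all add: tensor_product_def)
  have eval: "tensor_eval s3 t p = free_extension s3 (\<lambda>(u, v). t u v) p" for p
    by (simp add: tensor_eval_def free_extension_def case_prod_beta)
  interpret F: module "free_scale :: 'a \<Rightarrow> _ \<Rightarrow> 'b \<times> 'c \<Rightarrow>\<^sub>0 'a"
    by (rule module_free_scale)
  have rel: "free_extension s3 (\<lambda>(u, v). t u v) p = 0" if "p \<in> bilinearity_rels s1 s2" for p
    using F.span_base[OF that] unfolding ker[symmetric] eval by simp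
  note simps = free_extension_simps[OF vs3] free_scale_single
  have mem: "Poly_Mapping.single (u + u', v) 1 - Poly_Mapping.single (u, v) 1 - Poly_Mapping.single (u', v) 1 \<in> bilinearity_rels s1 s2"
    "Poly_Mapping.single (u, v + v') 1 - Poly_Mapping.single (u, v) 1 - Poly_Mapping.single (u, v') 1 \<in> bilinearity_rels s1 s2"
    "Poly_Mapping.single (s1 c u, v) 1 - free_scale c (Poly_Mapping.single (u, v) 1) \<in> bilinearity_rels s1 s2"
    "Poly_Mapping.single (u, s2 c v) 1 - free_scale c (Poly_Mapping.single (u, v) 1) \<in> bilinearity_rels s1 s2"
    for u u' v v' c
    unfolding bilinearity_rels_def Let_def by blast+
  have one: "s3 1 w = w" for w
    using vs3 by (simp add: vector_space_def)
  have "t (u + u') v = t u v + t u' v" for u u' v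
    using rel[OF mem(1)[of u u' v]] by (simp add: simps one algebra_simps)
  moreover have "t u (v + v') = t u v + t u v'" for u v v'
    using rel[OF mem(2)[of u v v']] by (simp add: simps one algebra_simps)
  moreover have "t (s1 c u) v = s3 c (t u v)" for c u v
    using rel[OF mem(3)[of c u v]] by (simp add: simps one)
  moreover have "t u (s2 c v) = s3 c (t u v)" for c u v
    using rel[OF mem(4)[of u c v]] by (simp add: simps one)
  ultimately show ?thesis
    by (simp add: bilinear_map_def Vector_Spaces.linear_iff vs1 vs2 vs3)
qed

section \<open>Enveloping and Clifford algebras\<close>

lemma tensor_relsI: "gen (x + y) - gen x - gen y \<in> tensor_rels s" "gen (s c x) - const c * gen x \<in> tensor_rels s"
  unfolding tensor_rels_def by blast+

lemma enveloping_algebra_relations: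
  assumes vs: "vector_space s" and env: "enveloping_algebra s G \<epsilon> br sU \<iota>"
  shows "algebra_over sU" and "lin s sU \<iota>"
    and "x \<in> G a \<Longrightarrow> y \<in> G b \<Longrightarrow> \<iota> x * \<iota> y = sU (\<epsilon> a b) (\<iota> y * \<iota> x) + \<iota> (br x y)"
proof -
  note zero = presented_algebra_zero[OF env[unfolded enveloping_algebra_def]]
  show alg: "algebra_over sU"
    using env by (simp add: enveloping_algebra_def presented_algebra_def)
  note simps = free_eval_simps[OF alg] scale_one_mult[OF alg]
  have "\<iota> (x + y) = \<iota> x + \<iota> y" for x y
    using zero[OF UnI1[OF tensor_relsI(1)]] by (simp add: simps algebra_simps)
  moreover have "\<iota> (s c x) = sU c (\<iota> x)" for c x
    using zero[OF UnI1[OF tensor_relsI(2)]] by (simp add: simps)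
  ultimately show "lin s sU \<iota>"
    by (simp add: Vector_Spaces.linear_iff vs algebra_over_vs[OF alg])
  assume "x \<in> G a" "y \<in> G b"
  then have "free_eval sU \<iota> (gen x * gen y - const (\<epsilon> a b) * gen y * gen x - gen (br x y)) = 0"
    by (intro zero) blast
  then show "\<iota> x * \<iota> y = sU (\<epsilon> a b) (\<iota> y * \<iota> x) + \<iota> (br x y)"
    by (simp add: simps mult.assoc algebra_simps)
qed

lemma clifford_algebra_relations:
  assumes vs: "vector_space s" and cl: "clifford_algebra s G \<epsilon> B sC \<iota>"
  shows "algebra_over sC" and "lin s sC \<iota>"
    and "x \<in> G a \<Longrightarrow> y \<in> G b \<Longrightarrow> \<iota> x * \<iota> y = sC (2 * B x y) 1 - sC (\<epsilon> a b) (\<iota> y * \<iota> x)"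
proof -
  note zero = presented_algebra_zero[OF cl[unfolded clifford_algebra_def]]
  show alg: "algebra_over sC"
    using cl by (simp add: clifford_algebra_def presented_algebra_def)
  note simps = free_eval_simps[OF alg] scale_one_mult[OF alg]
  have "\<iota> (x + y) = \<iota> x + \<iota> y" for x y
    using zero[OF UnI1[OF tensor_relsI(1)]] by (simp add: simps algebra_simps)
  moreover have "\<iota> (s c x) = sC c (\<iota> x)" for c x
    using zero[OF UnI1[OF tensor_relsI(2)]] by (simp add: simps)
  ultimately show "lin s sC \<iota>"
    by (simp add: Vector_Spaces.linear_iff vs algebra_over_vs[OF alg])
  assume "x \<in> G a" "y \<in> G b"
  then have "free_eval sC \<iota> (gen x * gen y + const (\<epsilon> a b) * gen y * gen x - const (2 * B x y)) = 0"
    by (intro zero) blast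
  then show "\<iota> x * \<iota> y = sC (2 * B x y) 1 - sC (\<epsilon> a b) (\<iota> y * \<iota> x)"
    by (simp add: simps mult.assoc algebra_simps)
qed

lemma enveloping_algebra_hom:
  assumes env: "enveloping_algebra s G \<epsilon> br sU \<iota>" and alg: "algebra_over sW" and f: "lin s sW f"
    and comm: "\<And>a b x y. x \<in> G a \<Longrightarrow> y \<in> G b \<Longrightarrow> f x * f y = sW (\<epsilon> a b) (f y * f x) + f (br x y)"
  shows "algebra_hom sU sW (env_extension sU \<iota> sW f)" and "env_extension sU \<iota> sW f (\<iota> x) = f x"
proof -
  note simps = free_eval_simps[OF alg] scale_one_mult[OF alg]
  have "free_eval sW f r = 0" if "r \<in> tensor_rels s \<union>
       {gen x * gen y - const (\<epsilon> a b) * gen y * gen x - gen (br x y) |a b x y. x \<in> G a \<and> y \<in> G b}" for r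
  proof -
    have "f x * f y - sW (\<epsilon> a b) (f y * f x) - f (br x y) = 0" if "x \<in> G a" "y \<in> G b" for a b x y
      using comm[OF that] by simp
    then show ?thesis
      using that by (auto simp: tensor_rels_def simps lin_addD[OF f] lin_scaleD[OF f] mult.assoc
          simp del: right_minus_eq)
  qed
  then show "algebra_hom sU sW (env_extension sU \<iota> sW f)" "env_extension sU \<iota> sW f (\<iota> x) = f x"
    using env_extension_hom[OF env[unfolded enveloping_algebra_def] alg, of f] by blast+
qed

section \<open>The adjoint representation and its extension\<close>

lemma graded_lin_zero:
  assumes "graded_space s G" and f: "lin s t f" and "\<And>a v. v \<in> G a \<Longrightarrow> f v = 0"
  shows "f z = 0"
proof -
  obtain h where "homogeneous_decomp G z h"
    using assms(1) unfolding graded_space_def by metis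
  then have "z = (\<Sum>a | h a \<noteq> 0. h a)" and "\<And>a. h a \<in> G a"
    by (auto simp: homogeneous_decomp_def)
  then have "f z = (\<Sum>a | h a \<noteq> 0. f (h a))" and "\<And>a. f (h a) = 0"
    using lin_sumD[OF f] assms(3) by metis+
  then show ?thesis by simp
qed

lemma colour_lie_algebraD:
  assumes "colour_lie_algebra s G \<epsilon> br"
  shows "graded_space s G" and "vector_space s" and "bilinear_map s s s br"
    and "x \<in> G a \<Longrightarrow> y \<in> G b \<Longrightarrow> br x y \<in> G (a + b)"
    and "x \<in> G a \<Longrightarrow> y \<in> G b \<Longrightarrow> br x y = - s (\<epsilon> a b) (br y x)"
    and "x \<in> G a \<Longrightarrow> y \<in> G b \<Longrightarrow> z \<in> G c \<Longrightarrow>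
      s (\<epsilon> c a) (br x (br y z)) + s (\<epsilon> a b) (br y (br z x)) + s (\<epsilon> b c) (br z (br x y)) = 0"
  using assms unfolding colour_lie_algebra_def graded_space_def by blast+

context commutation
begin

text \<open>For homogeneous \<open>z\<close> this is the Jacobi identity after two antisymmetry
  steps and cancellation of \<open>\<epsilon> c a\<close>; linearity extends it to all
  \<open>z\<close>, as needed for an identity between operators.\<close>

lemma leibniz:
  assumes lie: "colour_lie_algebra s G \<epsilon> br" and x: "x \<in> G a" and y: "y \<in> G b"
  shows "br x (br y z) = br (br x y) z + s (\<epsilon> a b) (br y (br x z))"
proof -
  interpret vector_space s using lie by (rule colour_lie_algebraD)
  note bl = bilinear_mapD[OF colour_lie_algebraD(3)[OF lie]]
  have "br x (br y z) - (br (br x y) z + s (\<epsilon> a b) (br y (br x z))) = 0"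
  proof (rule graded_lin_zero[OF colour_lie_algebraD(1)[OF lie], of s "\<lambda>z. br x (br y z) - (br (br x y) z + s (\<epsilon> a b) (br y (br x z)))"])
    show "lin s s (\<lambda>z. br x (br y z) - (br (br x y) z + s (\<epsilon> a b) (br y (br x z))))"
      by (intro lin_diff lin_add lin_scale lin_comp[OF bl(1)] bl(1))
  next
    fix c z assume z: "z \<in> G c"
    have zx: "br z x = - s (\<epsilon> c a) (br x z)"
      by (rule colour_lie_algebraD(5)[OF lie z x])
    have zxy: "br z (br x y) = - s (\<epsilon> c (a + b)) (br (br x y) z)"
      by (rule colour_lie_algebraD(5)[OF lie z colour_lie_algebraD(4)[OF lie x y]])
    have eps: "\<epsilon> b c * \<epsilon> c (a + b) = \<epsilon> c a"
      using eps_inv[of b c] unfolding eps_simps by algebra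
    have "s (\<epsilon> c a) (br x (br y z)) - s (\<epsilon> a b * \<epsilon> c a) (br y (br x z)) - s (\<epsilon> b c * \<epsilon> c (a + b)) (br (br x y) z) = 0"
      using colour_lie_algebraD(6)[OF lie x y z]
      by (simp add: zx zxy lin_minusD[OF bl(1)] lin_scaleD[OF bl(1)])
    then have "s (\<epsilon> c a) (br x (br y z) - (br (br x y) z + s (\<epsilon> a b) (br y (br x z)))) = 0"
      unfolding eps by (simp add: algebra_simps)
    then show "br x (br y z) - (br (br x y) z + s (\<epsilon> a b) (br y (br x z))) = 0"
      using eps_nz[of c a] by simp
  qed
  then show ?thesis by simp
qed

text \<open>The Leibniz rule says that the relators act by zero, so the described extension exists
  and is unique; its multiplicativity gives the value on quadratic elements.\<close>

lemma ad_extension: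
  assumes lie: "colour_lie_algebra s G \<epsilon> br" and env: "enveloping_algebra s G \<epsilon> br sU \<iota>"
  shows "ad_extension s br sU \<iota> (\<Sum>i\<in>I. \<iota> (p i) * \<iota> (q i)) z = (\<Sum>i\<in>I. br (p i) (br (q i) z))"
proof -
  note vs = colour_lie_algebraD(2)[OF lie]
  note bl = bilinear_mapD[OF colour_lie_algebraD(3)[OF lie]]
  note act = word_action_simps[OF vs, of br, OF bl(1)] word_action_mult[OF vs, of br, OF bl(1)]
  have "word_action s br r z = 0" if "r \<in> tensor_rels s \<union>
       {gen x * gen y - const (\<epsilon> a b) * gen y * gen x - gen (br x y) |a b x y. x \<in> G a \<and> y \<in> G b}" for r z
  proof -
    have "br x (br y z) - s (\<epsilon> a b) (br y (br x z)) - br (br x y) z = 0" if "x \<in> G a" "y \<in> G b" for a b x y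
      using leibniz[OF lie that] by simp
    then show ?thesis
      using that by (auto simp: tensor_rels_def act lin_addD[OF bl(2)] lin_scaleD[OF bl(2)] mult.assoc
          simp del: right_minus_eq)
  qed
  note ex = presented_algebra_action[OF env[unfolded enveloping_algebra_def] vs, of br, OF bl(1) this]
  let ?A = "ad_extension s br sU \<iota>"
  have "?A (\<iota> x) = br x" and "?A (u * v) = ?A u \<circ> ?A v" and lin: "lin sU s (\<lambda>u. ?A u z)" for x u v
    using theI'[OF ex] unfolding ad_extension_def by blast+
  then show ?thesis
    by (simp add: lin_sumD[OF lin])
qed

end

section \<open>Traces\<close>

context colour_form
begin

text \<open>In the basis chosen by \<open>lin_trace\<close> the coordinates are pairings with dual
  vectors. Independence of the basis then moves the sum to \<open>E\<close>.\<close>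

lemma lin_trace_dual:
  assumes f: "lin s s f"
  shows "lin_trace s f = (\<Sum>e\<in>E. B (f e) (du e))"
proof -
  define E0 where "E0 = (SOME E. finite_dimensional_vector_space s E)"
  have E0: "finite_dimensional_vector_space s E0"
    unfolding E0_def by (rule someI, rule basis)
  interpret F: finite_dimensional_vector_space s E0 by fact
  have "F.representation E0 v e = B v (dual_basis B E0 e)" if e: "e \<in> E0" for v e
  proof -
    have "v = (\<Sum>b\<in>E0. s (F.representation E0 v b) b)"
      using F.sum_representation_eq[OF F.independent_Basis _ F.finite_Basis subset_refl, of v] F.span_Basis by simp
    then have "B v (dual_basis B E0 e) = B (\<Sum>b\<in>E0. s (F.representation E0 v b) b) (dual_basis B E0 e)"
      by (rule arg_cong)
    also have "\<dots> = (\<Sum>b\<in>E0. F.representation E0 v b * (if b = e then 1 else 0))"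
      by (simp add: lin_sumD[OF B_lin(2)] lin_scaleD[OF B_lin(2)] B_dual_basis[OF E0] cong: sum.cong)
    also have "\<dots> = F.representation E0 v e"
      using e F.finite_Basis by (simp add: if_distrib[of "\<lambda>c. _ * c"] cong: if_cong)
    finally show ?thesis by simp
  qed
  then have "lin_trace s f = (\<Sum>e\<in>E0. B (f e) (dual_basis B E0 e))"
    by (simp add: lin_trace_def flip: E0_def)
  also have "\<dots> = (\<Sum>e\<in>E. B (f e) (du e))"
    by (rule dual_sum_independent[OF E0, of "(*)" "\<lambda>p q. B (f q) p"])
      (simp_all add: expand_basis[OF basis] bilinear_map_def B_lin(1) B_lin_comp(2)[OF f])
  finally show ?thesis .
qed

text \<open>Grouping the basis expansion of \<open>v\<close> by degree yields a homogeneous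
  decomposition, which by uniqueness is \<open>hcomp G v\<close>.\<close>

lemma eps_op_expand: "eps_op s G \<epsilon> v = (\<Sum>e\<in>E. s (\<epsilon> (d e) (d e) * B v (du e)) e)"
proof -
  interpret vs: vector_space s by (rule vs)
  define h where "h a = (\<Sum>e | e \<in> E \<and> d e = a. s (B v (du e)) e)" for a
  have supp: "a \<in> d ` E" if "h a \<noteq> 0" for a
  proof (rule ccontr)
    assume "a \<notin> d ` E"
    then have "{e. e \<in> E \<and> d e = a} = {}" by blast
    then show False
      using that unfolding h_def by (metis sum.empty)
  qed
  have sum: "(\<Sum>a | h a \<noteq> 0. s (c a) (h a)) = (\<Sum>e\<in>E. s (c (d e) * B v (du e)) e)" for c
  proof -
    have "(\<Sum>a | h a \<noteq> 0. s (c a) (h a)) = (\<Sum>a\<in>d ` E. s (c a) (h a))"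
      using supp finE by (intro sum.mono_neutral_left) auto
    also have "\<dots> = (\<Sum>a\<in>d ` E. \<Sum>e | e \<in> E \<and> d e = a. s (c (d e) * B v (du e)) e)"
      by (intro sum.cong refl) (simp add: h_def vs.scale_sum_right)
    also have "\<dots> = (\<Sum>e\<in>E. s (c (d e) * B v (du e)) e)"
      using sum.image_gen[OF finE, of _ d] by (rule sym)
    finally show ?thesis .
  qed
  have "homogeneous_decomp G v h"
    unfolding homogeneous_decomp_def
  proof (intro conjI allI)
    show "h a \<in> G a" for a
      unfolding h_def using deg by (intro vs.subspace_sum vs.subspace_scale subspaces) auto
    show "finite {a. h a \<noteq> 0}"
      by (rule finite_subset[of _ "d ` E"]) (use supp finE in auto)
    show "v = (\<Sum>a | h a \<noteq> 0. h a)"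
      using sum[of "\<lambda>_. 1"] by (simp add: expand_basis[OF basis])
  qed
  then have "hcomp G v = h"
    unfolding hcomp_def using graded unfolding graded_space_def by (metis the1_equality)
  then show ?thesis
    by (simp add: eps_op_def sum[of "\<lambda>a. \<epsilon> a a"])
qed

text \<open>The factor \<open>\<epsilon> (d e) (d e)\<close> introduced by \<open>eps_op\<close> is
  the one absorbed when the basis is exchanged with its dual. The result has the shape of the
  scalars in \<open>S_Cas\<close> and \<open>S_Kas\<close>.\<close>

lemma eps_trace_dual:
  assumes f: "lin s s f"
  shows "eps_trace s G \<epsilon> f = (\<Sum>e\<in>E. B (f (du e)) e)"
proof -
  have lin: "lin s s (eps_op s G \<epsilon> \<circ> f)"
    unfolding comp_def eps_op_expand
    by (intro lin_sum vs lin_scale_fixed lin_mult_right[OF algebra_over_field] B_lin_comp f)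
  have "B (eps_op s G \<epsilon> (f e)) (du e) = \<epsilon> (d e) (d e) * B (f e) (du e)" if e: "e \<in> E" for e
  proof -
    have "B (eps_op s G \<epsilon> (f e)) (du e)
        = (\<Sum>e'\<in>E. \<epsilon> (d e') (d e') * B (f e) (du e') * (if e' = e then 1 else 0))"
      by (simp add: eps_op_expand lin_sumD[OF B_lin(2)] lin_scaleD[OF B_lin(2)] B_dual_basis[OF basis]
          cong: sum.cong)
    then show ?thesis
      using e finE by (simp add: if_distrib[of "\<lambda>c. _ * c"] cong: if_cong)
  qed
  then have "eps_trace s G \<epsilon> f = (\<Sum>e\<in>E. \<epsilon> (d e) (d e) * B (f e) (du e))"
    by (simp add: eps_trace_def lin_trace_dual[OF lin])
  also have "\<dots> = (\<Sum>e\<in>E. B (f (du e)) e)"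
    by (rule flip) (simp add: bilinear_map_def B_lin(1) B_lin_comp(2)[OF f])
  finally show ?thesis .
qed

end

section \<open>Representations of colour Lie type\<close>

lemma colour_formI:
  assumes "commutation \<epsilon>" "graded_space s G" "eps_symmetric_form s G \<epsilon> B" "nondegenerate B"
    and "homogeneous_basis s G E"
  shows "colour_form \<epsilon> s G B E (\<lambda>e. SOME a. e \<in> G a)"
  using assms unfolding colour_form_def colour_form_axioms_def homogeneous_basis_def by (metis someI_ex)

lemma hcomp_zero:
  assumes "graded_space s G"
  shows "hcomp G 0 = (\<lambda>_. 0)"
proof -
  interpret vector_space s using assms by (simp add: graded_space_def)
  have "homogeneous_decomp G 0 (\<lambda>_. 0)"
    using assms by (simp add: homogeneous_decomp_def graded_space_def subspace_0)
  then show ?thesis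
    using assms unfolding hcomp_def graded_space_def by (metis the1_equality)
qed

lemma numeral_nonzero:
  assumes "CHAR('k::field) \<noteq> 2" "CHAR('k) \<noteq> 3"
  shows "(2::'k) \<noteq> 0" and "(3::'k) \<noteq> 0"
proof -
  have "CHAR('k) \<noteq> 1"
    using of_nat_CHAR[where 'a = 'k] by auto
  moreover have "\<not> n dvd 2 \<and> \<not> n dvd 3" if "n \<noteq> 1" "n \<noteq> 2" "n \<noteq> 3" for n :: nat
  proof -
    have "n = 0 \<or> n > 3"
      using that by linarith
    then show ?thesis
      by (auto dest: dvd_imp_le)
  qed
  ultimately have "\<not> CHAR('k) dvd 2" "\<not> CHAR('k) dvd 3"
    using assms by blast+
  then show "(2::'k) \<noteq> 0" "(3::'k) \<noteq> 0"
    using of_nat_eq_0_iff_char_dvd[of 2, where 'a = 'k] of_nat_eq_0_iff_char_dvd[of 3, where 'a = 'k] by simp_all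
qed

locale lie_type_rep = commutation \<epsilon>
  for \<epsilon> :: "'a::ab_group_add \<Rightarrow> 'a \<Rightarrow> 'k::field" +
  fixes sg :: "'k \<Rightarrow> 'g::ab_group_add \<Rightarrow> 'g" and Gg :: "'a \<Rightarrow> 'g set"
    and brg :: "'g \<Rightarrow> 'g \<Rightarrow> 'g" and Bg :: "'g \<Rightarrow> 'g \<Rightarrow> 'k"
    and sv :: "'k \<Rightarrow> 'v::ab_group_add \<Rightarrow> 'v" and Gv :: "'a \<Rightarrow> 'v set"
    and Bv :: "'v \<Rightarrow> 'v \<Rightarrow> 'k"
    and \<pi> :: "'g \<Rightarrow> 'v \<Rightarrow> 'v" and \<phi> :: "'v \<Rightarrow> 'v \<Rightarrow> 'v"
    and st :: "'k \<Rightarrow> 'g \<times> 'v \<Rightarrow> 'g \<times> 'v" and Gt :: "'a \<Rightarrow> ('g \<times> 'v) set"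
    and brt :: "'g \<times> 'v \<Rightarrow> 'g \<times> 'v \<Rightarrow> 'g \<times> 'v" and Bt :: "'g \<times> 'v \<Rightarrow> 'g \<times> 'v \<Rightarrow> 'k"
    and X :: "'g set" and E :: "'v set" and Y :: "('g \<times> 'v) set"
  assumes quad_g: "eps_quadratic sg Gg \<epsilon> brg Bg"
    and rep: "orthogonal_rep sg Gg \<epsilon> brg sv Gv Bv \<pi>"
    and lie_type: "colour_lie_type sg Gg \<epsilon> brg Bg sv Gv Bv \<pi> \<phi>"
    and st_def: "st = ext_scale sg sv" and Gt_def: "Gt = ext_part Gg Gv"
    and brt_def: "brt = ext_bracket Gg \<epsilon> brg Bg sv Gv Bv \<pi> \<phi>" and Bt_def: "Bt = ext_form Bg Bv"
    and basis_g: "homogeneous_basis sg Gg X" and basis_v: "homogeneous_basis sv Gv E"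
    and basis_t: "homogeneous_basis st Gt Y"
begin

definition dg :: "'g \<Rightarrow> 'a" where "dg x = (SOME a. x \<in> Gg a)"
definition dv :: "'v \<Rightarrow> 'a" where "dv x = (SOME a. x \<in> Gv a)"
definition dt :: "'g \<times> 'v \<Rightarrow> 'a" where "dt x = (SOME a. x \<in> Gt a)"

lemma quad_t: "eps_quadratic st Gt \<epsilon> brt Bt"
  using lie_type unfolding colour_lie_type_def st_def Gt_def brt_def Bt_def by blast

lemma lie_g: "colour_lie_algebra sg Gg \<epsilon> brg" and lie_t: "colour_lie_algebra st Gt \<epsilon> brt"
  using quad_g quad_t by (simp_all add: eps_quadratic_def)

sublocale g: colour_form \<epsilon> sg Gg Bg X dg
  using colour_formI[OF commutation_axioms colour_lie_algebraD(1)[OF lie_g] _ _ basis_g] quad_g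
  unfolding dg_def[abs_def] eps_quadratic_def by blast

sublocale v: colour_form \<epsilon> sv Gv Bv E dv
  using colour_formI[OF commutation_axioms _ _ _ basis_v] rep
  unfolding dv_def[abs_def] orthogonal_rep_def by blast

sublocale t: colour_form \<epsilon> st Gt Bt Y dt
  using colour_formI[OF commutation_axioms colour_lie_algebraD(1)[OF lie_t] _ _ basis_t] quad_t
  unfolding dt_def[abs_def] eps_quadratic_def by blast

section \<open>The bracket of the associated colour Lie algebra\<close>

lemma st_pair: "st c (x, v) = (sg c x, sv c v)"
  by (simp add: st_def ext_scale_def)

lemma Gt_pair: "(x, v) \<in> Gt a \<longleftrightarrow> x \<in> Gg a \<and> v \<in> Gv a"
  by (simp add: Gt_def ext_part_def)

lemma Bt_pair: "Bt (x, v) (y, w) = Bg x y + Bv v w"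
  by (simp add: Bt_def ext_form_def)

interpretation g: vector_space sg by (rule g.vs)
interpretation v: vector_space sv by (rule v.vs)

lemma zero_deg [simp]: "0 \<in> Gg a" "0 \<in> Gv a"
  using g.subspaces v.subspaces by (simp_all add: g.subspace_0 v.subspace_0)

lemma incl_lin: "lin sg st (\<lambda>x. (x, 0))" "lin sv st (\<lambda>v. (0, v))"
  by (simp_all add: Vector_Spaces.linear_iff g.vs v.vs t.vs st_pair)

lemma pi_lin1: "lin sg sv (\<lambda>x. \<pi> x v)"
  and pi_so: "x \<in> Gg a \<Longrightarrow> \<pi> x \<in> so_eps sv Gv \<epsilon> Bv a"
  and pi_br: "x \<in> Gg a \<Longrightarrow> y \<in> Gg b \<Longrightarrow> \<pi> (brg x y) v = \<pi> x (\<pi> y v) - sv (\<epsilon> a b) (\<pi> y (\<pi> x v))"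
  using rep unfolding orthogonal_rep_def by blast+

text \<open>Membership in \<open>so_eps\<close> is available for homogeneous \<open>x\<close>; a
  general \<open>x\<close> is expanded in the homogeneous basis \<open>X\<close>.\<close>

lemma pi_lin2: "lin sv sv (\<pi> x)"
proof -
  have "\<pi> x = (\<lambda>v. \<Sum>x'\<in>X. sv (Bg x (g.du x')) (\<pi> x' v))"
    using g.expand[OF pi_lin1] by metis
  moreover have "lin sv sv (\<lambda>v. \<Sum>x'\<in>X. sv (Bg x (g.du x')) (\<pi> x' v))"
    by (intro lin_sum v.vs lin_scale v.so_epsD(1)[OF pi_so[OF g.deg]])
  ultimately show ?thesis by simp
qed

lemma phi_bil: "bilinear_map sv sv sv \<phi>"
  and phi_deg: "u \<in> Gv a \<Longrightarrow> w \<in> Gv b \<Longrightarrow> \<phi> u w \<in> Gv (a + b)"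
  and phi_inv: "u \<in> Gv a \<Longrightarrow> v \<in> Gv b \<Longrightarrow> Bv (\<phi> u v) w = - \<epsilon> a b * Bv v (\<phi> u w)"
  and phi_anti: "u \<in> Gv a \<Longrightarrow> w \<in> Gv b \<Longrightarrow> \<phi> u w = - sv (\<epsilon> a b) (\<phi> w u)"
  using lie_type unfolding colour_lie_type_def by blast+

lemmas phi_lin = bilinear_mapD[OF phi_bil]

lemma phi_so: "u \<in> Gv a \<Longrightarrow> \<phi> u \<in> so_eps sv Gv \<epsilon> Bv a"
  unfolding so_eps_def by (auto simp: phi_lin(1) phi_deg phi_inv)

abbreviation mu :: "'v \<Rightarrow> 'v \<Rightarrow> 'g" where "mu \<equiv> moment_map Bg Bv \<pi>"

lemma mu_expand: "mu v w = (\<Sum>x\<in>X. sg (Bv (\<pi> x v) w) (g.du x))"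
proof -
  let ?m = "\<Sum>x\<in>X. sg (Bv (\<pi> x v) w) (g.du x)"
  have m: "Bg y ?m = Bv (\<pi> y v) w" for y
    using g.expand[OF v.B_lin_comp(2)[OF pi_lin1], of y v w]
    by (simp add: lin_sumD[OF g.B_lin(1)] lin_scaleD[OF g.B_lin(1)] mult.commute)
  show ?thesis
    unfolding moment_map_def by (rule the_equality) (auto intro: g.B_eqI simp: m)
qed

lemma mu_zero: "mu 0 w = 0" "mu v 0 = 0"
  by (simp_all add: mu_expand lin_zeroD[OF pi_lin2] lin_zeroD[OF v.B_lin(1)] lin_zeroD[OF v.B_lin(2)])

lemmas brg_lin = bilinear_mapD[OF colour_lie_algebraD(3)[OF lie_g]]
lemmas brt_lin = bilinear_mapD[OF colour_lie_algebraD(3)[OF lie_t]]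

lemma brt_simps:
  "brt (x, 0) (y, 0) = (brg x y, 0)"
  "brt (x, 0) (0, w) = (0, \<pi> x w)"
  "brt (0, u) (0, w) = (mu u w, \<phi> u w)"
  using hcomp_zero[OF g.graded] hcomp_zero[OF v.graded]
  by (simp_all add: brt_def ext_bracket_def mu_zero lin_zeroD[OF pi_lin1] lin_zeroD[OF pi_lin2]
      lin_zeroD[OF phi_lin(1)] lin_zeroD[OF phi_lin(2)] lin_zeroD[OF brg_lin(1)])

text \<open>Antisymmetry reduces this to the bracket with \<open>\<g>\<close> on the left and
  bypasses the double sum in \<open>ext_bracket\<close>.\<close>

lemma brt_vg:
  assumes "u \<in> Gv a" "x \<in> Gg b"
  shows "brt (0, u) (x, 0) = (0, - sv (\<epsilon> a b) (\<pi> x u))"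
  using colour_lie_algebraD(5)[OF lie_t, of "(0, u)" a "(x, 0)" b] assms
  by (simp add: Gt_pair brt_simps st_pair)

lemma mu_deg: "u \<in> Gv a \<Longrightarrow> w \<in> Gv b \<Longrightarrow> mu u w \<in> Gg (a + b)"
  using colour_lie_algebraD(4)[OF lie_t, of "(0, u)" a "(0, w)" b] by (simp add: brt_simps Gt_pair)

lemma brt_v: "u \<in> Gv a \<Longrightarrow> x \<in> Gg b \<Longrightarrow> brt (0, u) (x, w) = (mu u w, \<phi> u w - sv (\<epsilon> a b) (\<pi> x u))"
  using lin_addD[OF brt_lin(1), of "(0, u)" "(x, 0)" "(0, w)"] by (simp add: brt_simps brt_vg)

text \<open>This is the \<open>V\<close>-component of \<open>leibniz\<close> in the extended
  algebra; the moment map terms come from brackets of \<open>V\<close> with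
  \<open>\<g>\<close>.\<close>

lemma jacobi_V:
  assumes u: "u \<in> Gv a" and v: "v \<in> Gv b" and w: "w \<in> Gv c"
  shows "\<phi> u (\<phi> v w) - \<phi> (\<phi> u v) w - sv (\<epsilon> a b) (\<phi> v (\<phi> u w))
      = sv (\<epsilon> a (b + c)) (\<pi> (mu v w) u) + \<pi> (mu u v) w - sv (\<epsilon> b c) (\<pi> (mu u w) v)"
proof -
  have eps: "\<epsilon> a b * \<epsilon> b (a + c) = \<epsilon> b c"
    using eps_inv[of a b] unfolding eps_simps by algebra
  have add: "brt (mu u v, \<phi> u v) (0, w) = brt (mu u v, 0) (0, w) + brt (0, \<phi> u v) (0, w)"
    using lin_addD[OF brt_lin(2), of "(mu u v, 0)" "(0, \<phi> u v)" "(0, w)"] by simp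
  have "brt (0, u) (mu v w, \<phi> v w) = brt (mu u v, \<phi> u v) (0, w) + st (\<epsilon> a b) (brt (0, v) (mu u w, \<phi> u w))"
    using leibniz[OF lie_t, of "(0, u)" a "(0, v)" b "(0, w)"] u v by (simp add: Gt_pair brt_simps)
  then have "\<phi> u (\<phi> v w) - sv (\<epsilon> a (b + c)) (\<pi> (mu v w) u)
      = \<pi> (mu u v) w + \<phi> (\<phi> u v) w + (sv (\<epsilon> a b) (\<phi> v (\<phi> u w)) - sv (\<epsilon> a b * \<epsilon> b (a + c)) (\<pi> (mu u w) v))"
    by (simp add: add brt_simps brt_v[OF u mu_deg[OF v w]] brt_v[OF v mu_deg[OF u w]] st_pair
        v.scale_right_diff_distrib)
  then show ?thesis
    unfolding eps by (simp add: algebra_simps)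
qed

text \<open>The direct sum is orthogonal, so the bases of \<open>\<g>\<close> and \<open>V\<close>
  together with their duals form a dual pair for it. Independence of the basis replaces
  \<open>Y\<close> by this pair.\<close>

lemma dual_sum_pair:
  assumes F: "bilinear_map st st r F"
  shows "(\<Sum>y\<in>Y. F (t.du y) y) = (\<Sum>x\<in>X. F (g.du x, 0) (x, 0)) + (\<Sum>e\<in>E. F (0, v.du e) (0, e))"
proof -
  let ?b = "case_sum (\<lambda>x. (x, 0)) (\<lambda>e. (0, e))"
  let ?b' = "case_sum (\<lambda>x. (g.du x, 0)) (\<lambda>e. (0, v.du e))"
  have "(\<Sum>y\<in>Y. F (t.du y) y) = (\<Sum>i\<in>X <+> E. F (?b' i) (?b i))"
  proof (rule t.dual_sum_independent[OF t.basis F])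
    fix p :: "'g \<times> 'v"
    obtain x u where p: "p = (x, u)" by (cases p)
    have "(\<Sum>i\<in>X <+> E. st (Bt p (?b' i)) (?b i))
        = (\<Sum>x'\<in>X. st (Bg x (g.du x')) (x', 0)) + (\<Sum>e\<in>E. st (Bv u (v.du e)) (0, e))"
      by (simp add: p sum.Plus[OF g.finE v.finE] Bt_pair lin_zeroD[OF g.B_lin(1)] lin_zeroD[OF v.B_lin(1)])
    also have "\<dots> = (x, 0) + (0, u)"
      by (simp only: g.expand[OF incl_lin(1)] v.expand[OF incl_lin(2)])
    finally show "p = (\<Sum>i\<in>X <+> E. st (Bt p (?b' i)) (?b i))"
      by (simp add: p)
  qed
  then show ?thesis
    by (simp add: sum.Plus[OF g.finE v.finE])
qed

section \<open>Traces of the adjoint Casimir operators\<close>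

definition Cas :: "'v \<Rightarrow> 'v" where
  "Cas u = (\<Sum>x\<in>X. \<pi> (g.du x) (\<pi> x u))"

definition Kas :: "'v \<Rightarrow> 'v" where
  "Kas u = (\<Sum>e\<in>E. \<phi> (v.du e) (\<phi> e u))"

lemma Cas_trace: "(\<Sum>e\<in>E. Bv (v.du e) (Cas e)) = (\<Sum>e\<in>E. Bv (Cas (v.du e)) e)"
  using v.casimir_symmetric(3)[OF g.colour_form_axioms pi_lin1 pi_lin2 pi_so v.du_deg]
  unfolding Cas_def by simp

lemma Bg_mu:
  assumes x: "x \<in> X"
  shows "Bg (mu u w) x = \<epsilon> (dg x) (dg x) * Bv (\<pi> x u) w"
proof -
  have "Bg (mu u w) x = (\<Sum>x'\<in>X. Bv (\<pi> x' u) w * Bg (g.du x') x)"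
    by (simp add: mu_expand lin_sumD[OF g.B_lin(2)] lin_scaleD[OF g.B_lin(2)])
  also have "\<dots> = (\<Sum>x'\<in>X. if x' = x then \<epsilon> (dg x) (dg x) * Bv (\<pi> x u) w else 0)"
    using x g.B_swap(2)[OF g.du_deg g.deg[OF x]]
    by (intro sum.cong) (auto simp: g.B_dual_basis[OF g.basis])
  finally show ?thesis
    using x g.finE by simp
qed

text \<open>The part of the trace where elements of \<open>V\<close> act twice on
  \<open>\<g>\<close>. The inner bracket lands in \<open>V\<close>, the outer one returns through
  the moment map, and skewness of \<open>\<pi>\<close> with \<open>g.flip\<close> recovers the trace
  of \<open>Cas\<close>.\<close>

lemma trace_block_X:
  "(\<Sum>x\<in>X. \<Sum>e\<in>E. Bt (brt (0, v.du e) (brt (0, e) (g.du x, 0))) (x, 0)) = (\<Sum>e\<in>E. Bv (Cas (v.du e)) e)"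
proof -
  have "Bt (brt (0, v.du e) (brt (0, e) (g.du x, 0))) (x, 0)
      = \<epsilon> (dg x) (dg x) * Bv (v.du e) (\<pi> x (\<pi> (g.du x) e))" if x: "x \<in> X" and e: "e \<in> E" for x e
  proof -
    have "Bt (brt (0, v.du e) (brt (0, e) (g.du x, 0))) (x, 0)
        = - (\<epsilon> (dg x) (dg x) * (\<epsilon> (dv e) (- dg x) * Bv (\<pi> x (v.du e)) (\<pi> (g.du x) e)))"
      by (simp add: brt_vg[OF v.deg[OF e] g.du_deg[OF x]] brt_simps Bt_pair Bg_mu[OF x]
          lin_zeroD[OF v.B_lin(1)] lin_minusD[OF v.B_lin(1)] lin_scaleD[OF v.B_lin(1)])
    also have "Bv (\<pi> x (v.du e)) (\<pi> (g.du x) e) = - \<epsilon> (dg x) (- dv e) * Bv (v.du e) (\<pi> x (\<pi> (g.du x) e))"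
      by (rule v.so_epsD(3)[OF pi_so[OF g.deg[OF x]] v.du_deg[OF e]])
    finally show ?thesis
      using eps_inv[of "dg x" "dv e"] unfolding eps_simps by algebra
  qed
  then have "(\<Sum>x\<in>X. \<Sum>e\<in>E. Bt (brt (0, v.du e) (brt (0, e) (g.du x, 0))) (x, 0))
      = (\<Sum>x\<in>X. \<Sum>e\<in>E. \<epsilon> (dg x) (dg x) * Bv (v.du e) (\<pi> x (\<pi> (g.du x) e)))"
    by simp
  also have "\<dots> = (\<Sum>e\<in>E. \<Sum>x\<in>X. \<epsilon> (dg x) (dg x) * Bv (v.du e) (\<pi> x (\<pi> (g.du x) e)))"
    by (rule sum.swap)
  also have "\<dots> = (\<Sum>e\<in>E. \<Sum>x\<in>X. Bv (v.du e) (\<pi> (g.du x) (\<pi> x e)))"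
    by (intro sum.cong refl g.flip bilinear_mapI v.B_lin_comp pi_lin1 lin_comp[OF pi_lin2 pi_lin1])
  finally show ?thesis
    unfolding Cas_trace[symmetric] by (simp add: Cas_def lin_sumD[OF v.B_lin(1)])
qed

text \<open>The part where elements of \<open>V\<close> act twice on \<open>V\<close>. Passing
  through \<open>\<g>\<close> contributes the trace of \<open>Cas\<close>, staying in
  \<open>V\<close> that of \<open>Kas\<close>.\<close>

lemma trace_block_E:
  "(\<Sum>e'\<in>E. \<Sum>e\<in>E. Bt (brt (0, v.du e) (brt (0, e) (0, v.du e'))) (0, e'))
    = (\<Sum>e\<in>E. Bv (Cas (v.du e)) e) + (\<Sum>e\<in>E. Bv (Kas (v.du e)) e)"
proof -
  have "Bt (brt (0, v.du e) (brt (0, e) (0, v.du e'))) (0, e') = Bv (\<phi> (v.du e) (\<phi> e (v.du e'))) e'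
      - (\<Sum>x\<in>X. \<epsilon> (dv e) (dg x) * (Bv (\<pi> x e) (v.du e') * Bv (\<pi> (g.du x) (v.du e)) e'))"
    if e: "e \<in> E" for e e'
  proof -
    have "brt (0, v.du e) (mu e (v.du e'), 0) = (\<Sum>x\<in>X. st (Bv (\<pi> x e) (v.du e')) (brt (0, v.du e) (g.du x, 0)))"
      unfolding mu_expand lin_sumD[OF incl_lin(1)] lin_scaleD[OF incl_lin(1)]
        lin_sumD[OF brt_lin(1)] lin_scaleD[OF brt_lin(1)] ..
    also have "\<dots> = (\<Sum>x\<in>X. st (Bv (\<pi> x e) (v.du e')) (0, - sv (\<epsilon> (dv e) (dg x)) (\<pi> (g.du x) (v.du e))))"
      by (intro sum.cong refl) (simp add: brt_vg[OF v.du_deg[OF e] g.du_deg] eps_simps)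
    finally have mu: "Bt (brt (0, v.du e) (mu e (v.du e'), 0)) (0, e')
        = - (\<Sum>x\<in>X. \<epsilon> (dv e) (dg x) * (Bv (\<pi> x e) (v.du e') * Bv (\<pi> (g.du x) (v.du e)) e'))"
      by (simp add: lin_sumD[OF t.B_lin(2)] lin_scaleD[OF t.B_lin(2)] Bt_pair lin_zeroD[OF g.B_lin(1)]
          lin_minusD[OF v.B_lin(2)] lin_scaleD[OF v.B_lin(2)] sum_negf mult_ac)
    have "brt (0, v.du e) (mu e (v.du e'), \<phi> e (v.du e'))
        = brt (0, v.du e) (mu e (v.du e'), 0) + brt (0, v.du e) (0, \<phi> e (v.du e'))"
      using lin_addD[OF brt_lin(1), of "(0, v.du e)" "(mu e (v.du e'), 0)" "(0, \<phi> e (v.du e'))"] by simp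
    then show ?thesis
      by (simp add: brt_simps lin_addD[OF t.B_lin(2)] mu) (simp add: Bt_pair lin_zeroD[OF g.B_lin(1)])
  qed
  then have "(\<Sum>e'\<in>E. \<Sum>e\<in>E. Bt (brt (0, v.du e) (brt (0, e) (0, v.du e'))) (0, e'))
      = (\<Sum>e'\<in>E. \<Sum>e\<in>E. Bv (\<phi> (v.du e) (\<phi> e (v.du e'))) e')
       - (\<Sum>e'\<in>E. \<Sum>e\<in>E. \<Sum>x\<in>X. \<epsilon> (dv e) (dg x) * (Bv (\<pi> x e) (v.du e') * Bv (\<pi> (g.du x) (v.du e)) e'))"
    by (simp add: sum_subtractf)
  also have "(\<Sum>e'\<in>E. \<Sum>e\<in>E. Bv (\<phi> (v.du e) (\<phi> e (v.du e'))) e') = (\<Sum>e\<in>E. Bv (Kas (v.du e)) e)"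
    by (simp add: Kas_def lin_sumD[OF v.B_lin(2)])
  also have "(\<Sum>e'\<in>E. \<Sum>e\<in>E. \<Sum>x\<in>X. \<epsilon> (dv e) (dg x) * (Bv (\<pi> x e) (v.du e') * Bv (\<pi> (g.du x) (v.du e)) e'))
      = (\<Sum>e\<in>E. \<Sum>x\<in>X. \<Sum>e'\<in>E. \<epsilon> (dv e) (dg x) * (Bv (\<pi> x e) (v.du e') * Bv (\<pi> (g.du x) (v.du e)) e'))"
    by (rule sum_rotate[symmetric])
  also have "\<dots> = (\<Sum>e\<in>E. \<Sum>x\<in>X. \<epsilon> (dv e) (dg x) * Bv (\<pi> (g.du x) (v.du e)) (\<pi> x e))"
    unfolding sum_distrib_left[symmetric] v.expand[OF v.B_lin(1)] ..
  also have "\<dots> = (\<Sum>e\<in>E. \<Sum>x\<in>X. - Bv (v.du e) (\<pi> (g.du x) (\<pi> x e)))"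
  proof (intro sum.cong refl)
    fix e x assume e: "e \<in> E" and x: "x \<in> X"
    have "Bv (\<pi> (g.du x) (v.du e)) (\<pi> x e) = - \<epsilon> (- dg x) (- dv e) * Bv (v.du e) (\<pi> (g.du x) (\<pi> x e))"
      by (rule v.so_epsD(3)[OF pi_so[OF g.du_deg[OF x]] v.du_deg[OF e]])
    then show "\<epsilon> (dv e) (dg x) * Bv (\<pi> (g.du x) (v.du e)) (\<pi> x e) = - Bv (v.du e) (\<pi> (g.du x) (\<pi> x e))"
      using eps_inv[of "dg x" "dv e"] unfolding eps_simps by algebra
  qed
  also have "\<dots> = - (\<Sum>e\<in>E. Bv (Cas (v.du e)) e)"
    unfolding Cas_trace[symmetric] by (simp add: Cas_def lin_sumD[OF v.B_lin(1)] sum_negf)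
  finally show ?thesis by simp
qed

text \<open>The trace splits into four blocks. The action of \<open>\<g>\<close> on itself cancels,
  \<open>\<g>\<close> on \<open>V\<close> and \<open>V\<close> on \<open>\<g>\<close> give the trace
  of \<open>Cas\<close> once each, and \<open>V\<close> on \<open>V\<close> gives it again together
  with the trace of \<open>Kas\<close>.\<close>

lemma trace_difference:
  assumes env_g: "enveloping_algebra sg Gg \<epsilon> brg sU \<iota>U" and env_t: "enveloping_algebra st Gt \<epsilon> brt sUt \<iota>Ut"
  shows "eps_trace st Gt \<epsilon> (ad_extension st brt sUt \<iota>Ut (casimir \<iota>Ut Bt Y))
      - eps_trace sg Gg \<epsilon> (ad_extension sg brg sU \<iota>U (casimir \<iota>U Bg X))
    = 3 * (\<Sum>e\<in>E. Bv (Cas (v.du e)) e) + (\<Sum>e\<in>E. Bv (Kas (v.du e)) e)"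
proof -
  let ?f = "\<lambda>z. \<Sum>y\<in>Y. brt (t.du y) (brt y z)" and ?g = "\<lambda>z. \<Sum>x\<in>X. brg (g.du x) (brg x z)"
  have f: "ad_extension st brt sUt \<iota>Ut (casimir \<iota>Ut Bt Y) = ?f"
    unfolding casimir_def by (rule ext) (rule ad_extension[OF lie_t env_t])
  have g: "ad_extension sg brg sU \<iota>U (casimir \<iota>U Bg X) = ?g"
    unfolding casimir_def by (rule ext) (rule ad_extension[OF lie_g env_g])
  have flin: "lin st st ?f"
    by (intro lin_sum t.vs lin_comp[OF brt_lin(1) brt_lin(1)])
  have glin: "lin sg sg ?g"
    by (intro lin_sum g.vs lin_comp[OF brg_lin(1) brg_lin(1)])
  have tr_g: "eps_trace sg Gg \<epsilon> ?g = (\<Sum>x'\<in>X. \<Sum>x\<in>X. Bg (brg (g.du x) (brg x (g.du x'))) x')"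
    by (simp add: g.eps_trace_dual[OF glin] lin_sumD[OF g.B_lin(2)])
  have f_pair: "Bt (?f z) w = (\<Sum>x\<in>X. Bt (brt (g.du x, 0) (brt (x, 0) z)) w)
      + (\<Sum>e\<in>E. Bt (brt (0, v.du e) (brt (0, e) z)) w)" for z w
  proof -
    have "bilinear_map st st (*) (\<lambda>p q. Bt (brt p (brt q z)) w)"
      by (intro bilinear_mapI t.B_lin_comp brt_lin(2) lin_comp[OF brt_lin(1) brt_lin(2)])
    from dual_sum_pair[OF this] show ?thesis
      by (simp add: lin_sumD[OF t.B_lin(2)])
  qed
  have "bilinear_map st st (*) (\<lambda>p q. Bt (?f p) q)"
    by (intro bilinear_mapI t.B_lin(1) t.B_lin_comp(2) flin)
  from dual_sum_pair[OF this]
  have "eps_trace st Gt \<epsilon> ?f = (\<Sum>x\<in>X. Bt (?f (g.du x, 0)) (x, 0)) + (\<Sum>e\<in>E. Bt (?f (0, v.du e)) (0, e))"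
    by (simp only: t.eps_trace_dual[OF flin])
  also have "\<dots> = (\<Sum>x'\<in>X. \<Sum>x\<in>X. Bg (brg (g.du x) (brg x (g.du x'))) x') + (\<Sum>e\<in>E. Bv (Cas (v.du e)) e)
      + ((\<Sum>e\<in>E. Bv (Cas (v.du e)) e) + ((\<Sum>e\<in>E. Bv (Cas (v.du e)) e) + (\<Sum>e\<in>E. Bv (Kas (v.du e)) e)))"
  proof -
    have "(\<Sum>e\<in>E. \<Sum>x\<in>X. Bt (brt (g.du x, 0) (brt (x, 0) (0, v.du e))) (0, e)) = (\<Sum>e\<in>E. Bv (Cas (v.du e)) e)"
      by (simp add: brt_simps Bt_pair Cas_def lin_sumD[OF v.B_lin(2)] lin_zeroD[OF g.B_lin(1)])
    moreover have "(\<Sum>x'\<in>X. \<Sum>x\<in>X. Bt (brt (g.du x, 0) (brt (x, 0) (g.du x', 0))) (x', 0))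
        = (\<Sum>x'\<in>X. \<Sum>x\<in>X. Bg (brg (g.du x) (brg x (g.du x'))) x')"
      by (simp add: brt_simps Bt_pair lin_zeroD[OF v.B_lin(1)])
    ultimately show ?thesis
      unfolding f_pair sum.distrib trace_block_X trace_block_E by simp
  qed
  finally show ?thesis
    unfolding f g tr_g by simp
qed

end

section \<open>Realisation in the twisted tensor product\<close>

lemma algebra_part_generator:
  assumes "vector_space s" "x \<in> P i"
  shows "\<iota> x \<in> algebra_part s \<iota> P i"
proof -
  interpret vector_space s by fact
  have "prod_list (map \<iota> [x]) \<in> {prod_list (map \<iota> xs) |xs is. list_all2 (\<lambda>x j. x \<in> P j) xs is \<and> sum_list is = i}"
    using assms(2) by (intro CollectI exI[of _ "[x]"] exI[of _ "[i]"]) simp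
  then show ?thesis
    unfolding algebra_part_def by (intro span_base) simp
qed

lemma algebra_part_one:
  assumes "vector_space s"
  shows "1 \<in> algebra_part s \<iota> P 0"
proof -
  interpret vector_space s by fact
  have "prod_list (map \<iota> []) \<in> {prod_list (map \<iota> xs) |xs is. list_all2 (\<lambda>x j. x \<in> P j) xs is \<and> sum_list is = 0}"
    by (intro CollectI exI[of _ "[]"]) simp
  then show ?thesis
    unfolding algebra_part_def by (intro span_base) simp
qed

locale cubic_dirac_setting = lie_type_rep \<epsilon> sg Gg brg Bg sv Gv Bv \<pi> \<phi> st Gt brt Bt X E Y
  for \<epsilon> :: "'a::ab_group_add \<Rightarrow> 'a \<Rightarrow> 'k::field"
    and sg :: "'k \<Rightarrow> 'g::ab_group_add \<Rightarrow> 'g" and Gg brg Bg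
    and sv :: "'k \<Rightarrow> 'v::ab_group_add \<Rightarrow> 'v" and Gv Bv \<pi> \<phi> st Gt brt Bt X E Y +
  fixes sU :: "'k \<Rightarrow> 'u::ring_1 \<Rightarrow> 'u" and \<iota>U :: "'g \<Rightarrow> 'u"
    and sUt :: "'k \<Rightarrow> 'ut::ring_1 \<Rightarrow> 'ut" and \<iota>Ut :: "'g \<times> 'v \<Rightarrow> 'ut"
    and sC :: "'k \<Rightarrow> 'c::ring_1 \<Rightarrow> 'c" and \<iota>C :: "'v \<Rightarrow> 'c"
    and sW :: "'k \<Rightarrow> 'w::ring_1 \<Rightarrow> 'w" and tens :: "'ut \<Rightarrow> 'c \<Rightarrow> 'w"
  assumes two_nz: "(2::'k) \<noteq> 0" and three_nz: "(3::'k) \<noteq> 0"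
    and env_g: "enveloping_algebra sg Gg \<epsilon> brg sU \<iota>U"
    and env_t: "enveloping_algebra st Gt \<epsilon> brt sUt \<iota>Ut"
    and cliff: "clifford_algebra sv Gv \<epsilon> Bv sC \<iota>C"
    and twisted: "twisted_tensor_algebra sUt (algebra_part sUt \<iota>Ut (z2_part 0 Gt))
           sC (algebra_part sC \<iota>C (z2_part 1 Gv)) (eps_tilde \<epsilon>) sW tens"
begin

lemmas env_t_rels = enveloping_algebra_relations[OF t.vs env_t]
lemmas cliff_rels = clifford_algebra_relations[OF v.vs cliff]

lemma algW: "algebra_over sW" and tens_one: "tens 1 1 = 1"
  using twisted by (simp_all add: twisted_tensor_algebra_def)

lemma tens_bil: "bilinear_map sUt sC sW tens"
  using twisted unfolding twisted_tensor_algebra_def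
  by (intro tensor_product_bilinear algebra_over_vs[OF env_t_rels(1)] algebra_over_vs[OF cliff_rels(1)]) blast

lemmas tens_lin = bilinear_mapD[OF tens_bil]

text \<open>Since \<open>c\<close> has \<open>\<int>\<close>-parity 0, the sign in
  \<open>eps_tilde\<close> is +1 for either parity \<open>y\<close> of \<open>b\<close>.\<close>

lemma tens_mult:
  assumes "b \<in> algebra_part sC \<iota>C (z2_part 1 Gv) (y, i)" "c \<in> algebra_part sUt \<iota>Ut (z2_part 0 Gt) (0, j)"
  shows "tens a b * tens c e = sW (\<epsilon> i j) (tens (a * c) (b * e))"
  using twisted assms unfolding twisted_tensor_algebra_def by (fastforce simp: eps_tilde_def)

lemma one_part: "1 \<in> algebra_part sC \<iota>C (z2_part 1 Gv) (0, 0)" "1 \<in> algebra_part sUt \<iota>Ut (z2_part 0 Gt) (0, 0)"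
  using algebra_part_one[OF algebra_over_vs[OF cliff_rels(1)], of \<iota>C "z2_part 1 Gv"]
    algebra_part_one[OF algebra_over_vs[OF env_t_rels(1)], of \<iota>Ut "z2_part 0 Gt"]
  by (simp_all add: zero_prod_def)

lemma iotaC_part: "u \<in> Gv a \<Longrightarrow> \<iota>C u \<in> algebra_part sC \<iota>C (z2_part 1 Gv) (1, a)"
  by (rule algebra_part_generator[OF algebra_over_vs[OF cliff_rels(1)]]) (simp add: z2_part_def)

lemma iotaUt_part: "p \<in> Gt a \<Longrightarrow> \<iota>Ut p \<in> algebra_part sUt \<iota>Ut (z2_part 0 Gt) (0, a)"
  by (rule algebra_part_generator[OF algebra_over_vs[OF env_t_rels(1)]]) (simp add: z2_part_def)

lemma sW_one [simp]: "sW 1 w = w"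
  using algebra_over_vs[OF algW] by (simp add: vector_space_def)

definition Xi :: "'g \<times> 'v \<Rightarrow> 'w" where "Xi p = tens (\<iota>Ut p) 1"
definition T :: "'c \<Rightarrow> 'w" where "T c = tens 1 c"

lemma Xi_lin: "lin st sW Xi"
  unfolding Xi_def[abs_def] by (rule lin_comp[OF tens_lin(2) env_t_rels(2)])

lemma T_lin: "lin sC sW T"
  unfolding T_def[abs_def] by (rule tens_lin(1))

lemma tens_split: "tens (\<iota>Ut p) c = Xi p * T c"
  unfolding Xi_def T_def using tens_mult[OF one_part, of "\<iota>Ut p" c] by simp

lemma Xi_mult: "q \<in> Gt b \<Longrightarrow> Xi p * Xi q = tens (\<iota>Ut p * \<iota>Ut q) 1"
  unfolding Xi_def using tens_mult[OF one_part(1) iotaUt_part] by simp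

lemma Xi_commutator:
  assumes "p \<in> Gt a" "q \<in> Gt b"
  shows "Xi p * Xi q = sW (\<epsilon> a b) (Xi q * Xi p) + Xi (brt p q)"
  unfolding Xi_mult[OF assms(1)] Xi_mult[OF assms(2)] env_t_rels(3)[OF assms]
  by (simp add: Xi_def lin_addD[OF tens_lin(2)] lin_scaleD[OF tens_lin(2)])

lemma T_Xi:
  assumes "u \<in> Gv a" "p \<in> Gt b"
  shows "T (\<iota>C u) * Xi p = sW (\<epsilon> a b) (Xi p * T (\<iota>C u))"
  using tens_mult[OF iotaC_part[OF assms(1)] iotaUt_part[OF assms(2)], of 1 1]
  by (simp add: tens_split[symmetric]) (simp add: T_def Xi_def)

text \<open>The twisted product rule concerns a homogeneous left factor. It is applied to
  homogeneous vectors, then extended to all vectors by linearity, to words by induction, and to the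
  whole algebra because words span it.\<close>

lemma T_mult: "T (b * c) = T b * T c"
proof -
  have hom: "T (\<iota>C u * c) = T (\<iota>C u) * T c" if "u \<in> Gv a" for u a c
    unfolding T_def using tens_mult[OF iotaC_part[OF that] one_part(2), of 1 c] by simp
  have gen: "T (\<iota>C u * c) = T (\<iota>C u) * T c" for u c
  proof -
    have "T (\<iota>C u * c) - T (\<iota>C u) * T c = 0"
      by (rule graded_lin_zero[OF v.graded, of sW "\<lambda>u. T (\<iota>C u * c) - T (\<iota>C u) * T c"])
        (intro lin_diff lin_comp[OF T_lin] lin_mult_left[OF cliff_rels(1)] lin_mult_left[OF algW] cliff_rels(2),
          simp add: hom)
    then show ?thesis by simp
  qed
  have word: "T (prod_list (map \<iota>C us) * c) = T (prod_list (map \<iota>C us)) * T c" for us c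
  proof (induction us)
    case Nil
    then show ?case by (simp add: T_def tens_one)
  next
    case (Cons u us)
    then show ?case by (simp add: gen mult.assoc)
  qed
  obtain p where "b = free_eval sC \<iota>C p"
    using cliff unfolding clifford_algebra_def presented_algebra_def by blast
  moreover have "sC k u * v = sC k (u * v)" "sW k w * w' = sW k (w * w')" for k u v w w'
    using cliff_rels(1) algW unfolding algebra_over_def by metis+
  ultimately show ?thesis
    by (simp add: free_eval_def sum_distrib_right lin_sumD[OF T_lin] lin_scaleD[OF T_lin] word)
qed

sublocale D: dirac_form \<epsilon> sv Gv Bv E dv sC \<iota>C sg Gg Bg X dg \<pi> \<phi> mu brg sW "\<lambda>x. Xi (x, 0)" "\<lambda>u. Xi (0, u)" T
proof (intro dirac_form.intro colour_lie_form.intro clifford_form.intro clifford_form_axioms.intro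
    colour_lie_form_axioms.intro dirac_form_axioms.intro)
  show "\<iota>C x * \<iota>C y = sC (2 * Bv x y) 1 - sC (\<epsilon> a b) (\<iota>C y * \<iota>C x)" if "x \<in> Gv a" "y \<in> Gv b" for x y a b
    using that by (rule cliff_rels(3))
  show "Xi (x, 0) * Xi (y, 0) = sW (\<epsilon> a b) (Xi (y, 0) * Xi (x, 0)) + Xi (brg x y, 0)"
    if "x \<in> Gg a" "y \<in> Gg b" for x y a b
    using Xi_commutator[of "(x, 0)" a "(y, 0)" b] that by (simp add: Gt_pair brt_simps)
  show "Xi (0, x) * Xi (0, y) = sW (\<epsilon> a b) (Xi (0, y) * Xi (0, x)) + Xi (mu x y, 0) + Xi (0, \<phi> x y)"
    if "x \<in> Gv a" "y \<in> Gv b" for x y a b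
    using Xi_commutator[of "(0, x)" a "(0, y)" b] lin_addD[OF Xi_lin, of "(mu x y, 0)" "(0, \<phi> x y)"] that
    by (simp add: Gt_pair brt_simps add.assoc)
  show "T (\<iota>C u) * Xi (x, 0) = sW (\<epsilon> a b) (Xi (x, 0) * T (\<iota>C u))" if "u \<in> Gv a" "x \<in> Gg b" for u x a b
    by (rule T_Xi[OF that(1)]) (simp add: Gt_pair that)
  show "T (\<iota>C u) * Xi (0, x) = sW (\<epsilon> a b) (Xi (0, x) * T (\<iota>C u))" if "u \<in> Gv a" "x \<in> Gv b" for u x a b
    by (rule T_Xi[OF that(1)]) (simp add: Gt_pair that)
qed (fact v.colour_form_axioms g.colour_form_axioms cliff_rels two_nz three_nz pi_lin1 pi_lin2 pi_so phi_bil phi_so phi_anti mu_expand jacobi_V algW pi_br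
    lin_comp[OF Xi_lin incl_lin(1)] lin_comp[OF Xi_lin incl_lin(2)] T_lin tens_one[folded T_def] T_mult)+

section \<open>Identification of the operators and Casimir elements of the statement\<close>

lemma cubic_dirac_eq: "cubic_dirac tens \<iota>Ut sC \<iota>C Bv \<phi> E = D.Dir + T (sC (1 / 12) D.Psi)"
  by (simp add: cubic_dirac_def D.cubic_term_Psi D.Dir_def tens_split flip: T_def)

lemma delta_map_eq: "delta_map tens \<iota>Ut sC \<iota>C Bv \<pi> E = D.Delta"
  by (rule ext) (simp add: delta_map_def D.Delta_def pi_star_def D.S_def flip: Xi_def T_def)

lemma delta_casimir:
  "env_extension sU \<iota>U sW D.Delta (casimir \<iota>U Bg X) = (\<Sum>x\<in>X. D.Delta (g.du x) * D.Delta x)"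
proof -
  have "lin sg sW D.Delta"
    unfolding D.Delta_def[abs_def]
    by (intro lin_add lin_comp[OF Xi_lin incl_lin(1)] lin_comp[OF T_lin] lin_scale D.S_pi_lin lin_ident g.vs)
  from enveloping_algebra_hom[OF env_g algW this D.Delta_commutator]
  have hom: "algebra_hom sU sW (env_extension sU \<iota>U sW D.Delta)"
    and gen: "env_extension sU \<iota>U sW D.Delta (\<iota>U x) = D.Delta x" for x
    by blast+
  then have lin: "lin sU sW (env_extension sU \<iota>U sW D.Delta)"
    by (simp add: algebra_hom_def)
  show ?thesis
    using hom by (simp add: casimir_def lin_sumD[OF lin] algebra_hom_def gen)
qed

text \<open>Basis independence splits the Casimir element over \<open>Y\<close> into its parts from
  \<open>\<g>\<close> and from \<open>V\<close>, the two sums in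
  \<open>cubic_Dirac_square\<close>.\<close>

lemma tens_casimir:
  "tens (casimir \<iota>Ut Bt Y) 1 = (\<Sum>x\<in>X. Xi (g.du x, 0) * Xi (x, 0)) + (\<Sum>e\<in>E. Xi (0, v.du e) * Xi (0, e))"
proof -
  have "bilinear_map st st sUt (\<lambda>p q. \<iota>Ut p * \<iota>Ut q)"
    by (intro bilinear_mapI lin_mult_left[OF env_t_rels(1)] lin_mult_right[OF env_t_rels(1)] env_t_rels(2))
  from dual_sum_pair[OF this] show ?thesis
    using Xi_mult[of "(x, 0)" "dg x" for x] Xi_mult[of "(0, e)" "dv e" for e]
    by (simp add: casimir_def lin_addD[OF tens_lin(2)] lin_sumD[OF tens_lin(2)] Gt_pair g.deg v.deg)
qed

theorem cubic_dirac_square: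
  "(cubic_dirac tens \<iota>Ut sC \<iota>C Bv \<phi> E)\<^sup>2 =
    tens (casimir \<iota>Ut Bt Y) 1
    - env_extension sU \<iota>U sW (delta_map tens \<iota>Ut sC \<iota>C Bv \<pi> E) (casimir \<iota>U Bg X)
    + sW (1 / 24 * (eps_trace st Gt \<epsilon> (ad_extension st brt sUt \<iota>Ut (casimir \<iota>Ut Bt Y))
                    - eps_trace sg Gg \<epsilon> (ad_extension sg brg sU \<iota>U (casimir \<iota>U Bg X))))
        (tens 1 1)"
proof -
  \<comment> \<open>The operators behind the scalar in the square and those behind the traces are
    the same sums.\<close>
  have "D.Cas = Cas" "D.Kas = Kas"
    by (simp_all add: D.Cas_def Cas_def D.Kas_def Kas_def fun_eq_iff)
  then show ?thesis
    unfolding cubic_dirac_eq delta_map_eq delta_casimir tens_casimir tens_one trace_difference[OF env_g env_t]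
      D.cubic_Dirac_square by simp
qed

end

theorem theorem2:
  fixes \<epsilon> :: "'a::ab_group_add \<Rightarrow> 'a \<Rightarrow> 'k::field"
    and sg :: "'k \<Rightarrow> 'g::ab_group_add \<Rightarrow> 'g" and Gg :: "'a \<Rightarrow> 'g set"
    and brg :: "'g \<Rightarrow> 'g \<Rightarrow> 'g" and Bg :: "'g \<Rightarrow> 'g \<Rightarrow> 'k"
    and sv :: "'k \<Rightarrow> 'v::ab_group_add \<Rightarrow> 'v" and Gv :: "'a \<Rightarrow> 'v set"
    and Bv :: "'v \<Rightarrow> 'v \<Rightarrow> 'k"
    and \<pi> :: "'g \<Rightarrow> 'v \<Rightarrow> 'v" and \<phi> :: "'v \<Rightarrow> 'v \<Rightarrow> 'v"
    and st :: "'k \<Rightarrow> 'g \<times> 'v \<Rightarrow> 'g \<times> 'v" and Gt :: "'a \<Rightarrow> ('g \<times> 'v) set"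
    and brt :: "'g \<times> 'v \<Rightarrow> 'g \<times> 'v \<Rightarrow> 'g \<times> 'v" and Bt :: "'g \<times> 'v \<Rightarrow> 'g \<times> 'v \<Rightarrow> 'k"
    and X :: "'g set" and E :: "'v set" and Y :: "('g \<times> 'v) set"
    and sU :: "'k \<Rightarrow> 'u::ring_1 \<Rightarrow> 'u" and \<iota>U :: "'g \<Rightarrow> 'u"
    and sUt :: "'k \<Rightarrow> 'ut::ring_1 \<Rightarrow> 'ut" and \<iota>Ut :: "'g \<times> 'v \<Rightarrow> 'ut"
    and sC :: "'k \<Rightarrow> 'c::ring_1 \<Rightarrow> 'c" and \<iota>C :: "'v \<Rightarrow> 'c"
    and sW :: "'k \<Rightarrow> 'w::ring_1 \<Rightarrow> 'w" and tens :: "'ut \<Rightarrow> 'c \<Rightarrow> 'w"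
  assumes "CHAR('k) \<noteq> 2" and "CHAR('k) \<noteq> 3"
    and "commutation_factor \<epsilon>"
    and "eps_quadratic sg Gg \<epsilon> brg Bg"
    and "orthogonal_rep sg Gg \<epsilon> brg sv Gv Bv \<pi>"
    and "colour_lie_type sg Gg \<epsilon> brg Bg sv Gv Bv \<pi> \<phi>"
    and "st = ext_scale sg sv" and "Gt = ext_part Gg Gv"
    and "brt = ext_bracket Gg \<epsilon> brg Bg sv Gv Bv \<pi> \<phi>" and "Bt = ext_form Bg Bv"
    and "homogeneous_basis sg Gg X" and "homogeneous_basis sv Gv E" and "homogeneous_basis st Gt Y"
    and "vector_space.dim sv UNIV \<ge> 2"
    and "enveloping_algebra sg Gg \<epsilon> brg sU \<iota>U"
    and "enveloping_algebra st Gt \<epsilon> brt sUt \<iota>Ut"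
    and "clifford_algebra sv Gv \<epsilon> Bv sC \<iota>C"
    and "twisted_tensor_algebra sUt (algebra_part sUt \<iota>Ut (z2_part 0 Gt))
           sC (algebra_part sC \<iota>C (z2_part 1 Gv)) (eps_tilde \<epsilon>) sW tens"
  shows "(cubic_dirac tens \<iota>Ut sC \<iota>C Bv \<phi> E)\<^sup>2 =
    tens (casimir \<iota>Ut Bt Y) 1
    - env_extension sU \<iota>U sW (delta_map tens \<iota>Ut sC \<iota>C Bv \<pi> E) (casimir \<iota>U Bg X)
    + sW (1 / 24 * (eps_trace st Gt \<epsilon> (ad_extension st brt sUt \<iota>Ut (casimir \<iota>Ut Bt Y))
                    - eps_trace sg Gg \<epsilon> (ad_extension sg brg sU \<iota>U (casimir \<iota>U Bg X))))
        (tens 1 1)"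
proof -
  interpret cubic_dirac_setting \<epsilon> sg Gg brg Bg sv Gv Bv \<pi> \<phi> st Gt brt Bt X E Y sU \<iota>U sUt \<iota>Ut sC \<iota>C sW tens
    by unfold_locales (fact assms numeral_nonzero[OF assms(1,2)])+
  show ?thesis
    by (rule cubic_dirac_square)
qed

end
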